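(* Let $\Omega\subseteq\mathbb{R}^n$ be open and bounded and let $X_1,\dots,X_m$ be vector fields whose coefficient matrix $\sigma=(\sigma_{ij})$ ($n\times m$, the $j$-th column $\sigma^j$ being the coefficients of $X_j$) has entries in $C^{1,1}(\overline\Omega)$. Assume that $K:\overline\Omega\times\mathbb{R}\times\mathbb{R}^n\times S^n\to\mathbb{R}$ satisfies the structure conditions on $S^n$. Let $u:\overline\Omega\to\mathbb{R}$ be bounded and uniformly $\mathcal X$-convex, and suppose that for all open $\Omega_1$ with $\overline\Omega_1\subseteq\Omega$ there is $\gamma_1>0$ such that $u$ is a viscosity subsolution of $$-\log\det(D^2_{\mathcal X}u)+K(x,u,Du,D^2u)\le-\gamma_1\quad\text{in }\Omega_1 .$$ Let $v:\overline\Omega\to\mathbb{R}$ be a bounded, lower semicontinuous viscosity supersolution of $$-\log\det(D^2_{\mathcal X}v)+K(x,v,Dv,D^2v)=0\quad\text{in }\Omega .$$ Then $$\sup_\Omega(u-v)\le\max_{\partial\Omega}(u-v)^+ .$$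
   Context: $S^n$ is the space of real symmetric $n\times n$ matrices with the usual partial order. $(\cdot)^+=\max\{\cdot,0\}$. A modulus is a nondecreasing continuous $\omega:[0,\infty)\to[0,\infty)$ with $\omega(0)=0$. For $\varphi\in C^2(\Omega)$, $D^2_{\mathcal X}\varphi$ is the symmetric $m\times m$ matrix with entries $(X_iX_j\varphi+X_jX_i\varphi)/2$; equivalently $D^2_{\mathcal X}\varphi(x)=\sigma^T(x)D^2\varphi(x)\sigma(x)+Q(x,D\varphi(x))$ with $Q_{ij}(x,p)=[D\sigma^j\,\sigma^i+D\sigma^i\,\sigma^j](x)\cdot\frac p2$. Structure conditions on $S^n$: $K$ is continuous, nondecreasing in the second entry, nonincreasing in the last entry, and for some modulus $\omega$ $$K\Big(y,r,\tfrac{x-y}{\epsilon},Y\Big)-K\Big(x,r,\tfrac{x-y}{\epsilon},X\Big)\le\omega\Big(|x-y|\big(1+\tfrac{|x-y|}{\epsilon}\big)\Big)$$ for all $\epsilon>0$, $x,y\in\overline\Omega$, $r\in\mathbb{R}$, $X,Y\in S^n$ satisfying $$-\frac3\epsilon\begin{pmatrix}I&0\\0&I\end{pmatrix}\le\begin{pmatrix}X&0\\0&-Y\end{pmatrix}\le\frac3\epsilon\begin{pmatrix}I&-I\\-I&I\end{pmatrix}.$$ Uniform $\mathcal X$-convexity: $u:\overline\Omega\to\mathbb{R}$ is uniformly $\mathcal X$-convex if it is upper semicontinuous and for some $\gamma>0$ one has $D^2_{\mathcal X}\varphi(x)\ge\gamma I$ for all $\varphi\in C^2(\Omega)$ and all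 local maximum points $x\in\Omega$ of $u-\varphi$. Subsolution of the strict inequality in $\Omega_1$ (for uniformly $\mathcal X$-convex $u$): $-\log\det(D^2_{\mathcal X}\varphi(x))+K(x,u(x),D\varphi(x),D^2\varphi(x))\le-\gamma_1$ for all $\varphi\in C^2(\Omega)$ and all local maximum points $x\in\Omega_1$ of $u-\varphi$. Supersolution: $-\log\det(D^2_{\mathcal X}\varphi(x))+K(x,v(x),D\varphi(x),D^2\varphi(x))\ge0$ for all $\varphi\in C^2(\Omega)$ and all local minimum points $x\in\Omega$ of $v-\varphi$ at which $D^2_{\mathcal X}\varphi(x)$ is positive definite. *)

theory Defs
  imports "HOL-Analysis.Analysis"
begin

section \<open>Symmetric matrices\<close>

definition Sym :: "(real^'n^'n) set" where
  "Sym = {A. transpose A = A}"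

definition mat_le :: "real^'n^'n \<Rightarrow> real^'n^'n \<Rightarrow> bool"  (infix \<open>\<preceq>\<close> 50) where
  "A \<preceq> B \<longleftrightarrow> (\<forall>z. z \<bullet> (A *v z) \<le> z \<bullet> (B *v z))"

definition pos_def :: "real^'n^'n \<Rightarrow> bool" where
  "pos_def A \<longleftrightarrow> A \<in> Sym \<and> (\<forall>z. z \<noteq> 0 \<longrightarrow> 0 < z \<bullet> (A *v z))"

definition block :: "real^'n^'n \<Rightarrow> real^'n^'n \<Rightarrow> real^'n^'n \<Rightarrow> real^'n^'n
    \<Rightarrow> real^('n + 'n)^('n + 'n)" where
  "block A B C D = (\<chi> i j. case i of
       Inl a \<Rightarrow> (case j of Inl b \<Rightarrow> A $ a $ b | Inr b \<Rightarrow> B $ a $ b)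
     | Inr a \<Rightarrow> (case j of Inl b \<Rightarrow> C $ a $ b | Inr b \<Rightarrow> D $ a $ b))"


section \<open>Smooth functions\<close>

definition grad :: "(real^'n \<Rightarrow> real) \<Rightarrow> real^'n \<Rightarrow> real^'n" where
  "grad f x = (\<chi> k. frechet_derivative f (at x) (axis k 1))"

definition hess :: "(real^'n \<Rightarrow> real) \<Rightarrow> real^'n \<Rightarrow> real^'n^'n" where
  "hess f x = jacobian (grad f) (at x)"

definition C2_on :: "(real^'n) set \<Rightarrow> (real^'n \<Rightarrow> real) \<Rightarrow> bool" where
  "C2_on \<Omega> f \<longleftrightarrow>
     (\<forall>x\<in>\<Omega>. f differentiable at x) \<and>
     (\<forall>x\<in>\<Omega>. grad f differentiable at x) \<and>
     continuous_on \<Omega> (hess f)"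

text \<open>\<open>C\<^sup>1\<^sup>,\<^sup>1\<close> up to the boundary: \<open>f\<close> is continuous on the closure of \<open>\<Omega>\<close> and has a
  Lipschitz gradient on \<open>\<Omega>\<close>. The gradient then extends continuously to the closure.\<close>

definition C11_closure :: "(real^'n) set \<Rightarrow> (real^'n \<Rightarrow> real) \<Rightarrow> bool" where
  "C11_closure \<Omega> f \<longleftrightarrow>
     continuous_on (closure \<Omega>) f \<and>
     (\<forall>x\<in>\<Omega>. f differentiable at x) \<and>
     (\<exists>L. L-lipschitz_on \<Omega> (grad f))"


section \<open>Vector fields\<close>

text \<open>The fields are encoded by \<open>\<sigma>\<close>, an \<open>n \<times> m\<close> matrix at each point; the coefficients of
  \<open>X\<^sub>j\<close> are the \<open>j\<close>-th column.\<close>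

definition vf :: "(real^'n \<Rightarrow> real^'m^'n) \<Rightarrow> 'm \<Rightarrow> (real^'n \<Rightarrow> real) \<Rightarrow> real^'n \<Rightarrow> real" where
  "vf \<sigma> j f x = column j (\<sigma> x) \<bullet> grad f x"

definition D2X :: "(real^'n \<Rightarrow> real^'m^'n) \<Rightarrow> (real^'n \<Rightarrow> real) \<Rightarrow> real^'n \<Rightarrow> real^'m^'m" where
  "D2X \<sigma> f x = (\<chi> i j. (vf \<sigma> i (vf \<sigma> j f) x + vf \<sigma> j (vf \<sigma> i f) x) / 2)"


section \<open>Structure conditions\<close>

definition modulus :: "(real \<Rightarrow> real) \<Rightarrow> bool" where
  "modulus \<omega> \<longleftrightarrow>
     continuous_on {0..} \<omega> \<and> mono_on {0..} \<omega> \<and> \<omega> ` {0..} \<subseteq> {0..} \<and> \<omega> 0 = 0"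

text \<open>Only the values of \<open>K\<close> on \<open>closure \<Omega> \<times> UNIV \<times> UNIV \<times> Sym\<close> are constrained.\<close>

definition structure_conditions ::
    "(real^'n) set \<Rightarrow> (real^'n \<Rightarrow> real \<Rightarrow> real^'n \<Rightarrow> real^'n^'n \<Rightarrow> real) \<Rightarrow> bool" where
  "structure_conditions \<Omega> K \<longleftrightarrow>
     continuous_on (closure \<Omega> \<times> UNIV \<times> UNIV \<times> Sym) (\<lambda>(x, r, p, X). K x r p X) \<and>
     (\<forall>x\<in>closure \<Omega>. \<forall>r s p. \<forall>X\<in>Sym. r \<le> s \<longrightarrow> K x r p X \<le> K x s p X) \<and>
     (\<forall>x\<in>closure \<Omega>. \<forall>r p. \<forall>X\<in>Sym. \<forall>Y\<in>Sym. X \<preceq> Y \<longrightarrow> K x r p Y \<le> K x r p X) \<and>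
     (\<exists>\<omega>. modulus \<omega> \<and>
       (\<forall>\<epsilon>>0. \<forall>x\<in>closure \<Omega>. \<forall>y\<in>closure \<Omega>. \<forall>r. \<forall>X\<in>Sym. \<forall>Y\<in>Sym.
          - (3 / \<epsilon>) *\<^sub>R block (mat 1) 0 0 (mat 1) \<preceq> block X 0 0 (- Y) \<and>
          block X 0 0 (- Y) \<preceq> (3 / \<epsilon>) *\<^sub>R block (mat 1) (- mat 1) (- mat 1) (mat 1)
          \<longrightarrow> K y r ((x - y) /\<^sub>R \<epsilon>) Y - K x r ((x - y) /\<^sub>R \<epsilon>) X
              \<le> \<omega> (norm (x - y) * (1 + norm (x - y) / \<epsilon>))))"


section \<open>Semicontinuity and viscosity notions\<close>

definition usc_on :: "'a::topological_space set \<Rightarrow> ('a \<Rightarrow> real) \<Rightarrow> bool" where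
  "usc_on S f \<longleftrightarrow> (\<forall>x\<in>S. \<forall>a. f x < a \<longrightarrow> (\<forall>\<^sub>F y in at x within S. f y < a))"

definition lsc_on :: "'a::topological_space set \<Rightarrow> ('a \<Rightarrow> real) \<Rightarrow> bool" where
  "lsc_on S f \<longleftrightarrow> (\<forall>x\<in>S. \<forall>a. a < f x \<longrightarrow> (\<forall>\<^sub>F y in at x within S. a < f y))"

definition local_max_at :: "'a::topological_space set \<Rightarrow> ('a \<Rightarrow> real) \<Rightarrow> 'a \<Rightarrow> bool" where
  "local_max_at S f x \<longleftrightarrow> x \<in> S \<and> (\<forall>\<^sub>F y in at x within S. f y \<le> f x)"

definition local_min_at :: "'a::topological_space set \<Rightarrow> ('a \<Rightarrow> real) \<Rightarrow> 'a \<Rightarrow> bool" where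
  "local_min_at S f x \<longleftrightarrow> x \<in> S \<and> (\<forall>\<^sub>F y in at x within S. f x \<le> f y)"

definition uniformly_X_convex ::
    "(real^'n) set \<Rightarrow> (real^'n \<Rightarrow> real^'m^'n) \<Rightarrow> (real^'n \<Rightarrow> real) \<Rightarrow> bool" where
  "uniformly_X_convex \<Omega> \<sigma> u \<longleftrightarrow>
     usc_on (closure \<Omega>) u \<and>
     (\<exists>\<gamma>>0. \<forall>\<phi> x. C2_on \<Omega> \<phi> \<and> local_max_at \<Omega> (\<lambda>y. u y - \<phi> y) x
        \<longrightarrow> \<gamma> *\<^sub>R mat 1 \<preceq> D2X \<sigma> \<phi> x)"

text \<open>The function \<open>ln\<close> is total here; the determinant is positive wherever it matters: for
  supersolutions by the positivity restriction on test functions, for subsolutions because the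
  notion is only used for uniformly \<open>\<X>\<close>-convex functions.\<close>

definition MA_op ::
    "(real^'n \<Rightarrow> real^'m^'n) \<Rightarrow> (real^'n \<Rightarrow> real \<Rightarrow> real^'n \<Rightarrow> real^'n^'n \<Rightarrow> real)
      \<Rightarrow> real \<Rightarrow> (real^'n \<Rightarrow> real) \<Rightarrow> real^'n \<Rightarrow> real" where
  "MA_op \<sigma> K r \<phi> x = - ln (det (D2X \<sigma> \<phi> x)) + K x r (grad \<phi> x) (hess \<phi> x)"

definition strict_subsolution ::
    "(real^'n) set \<Rightarrow> (real^'n \<Rightarrow> real^'m^'n) \<Rightarrow> (real^'n \<Rightarrow> real \<Rightarrow> real^'n \<Rightarrow> real^'n^'n \<Rightarrow> real)
      \<Rightarrow> (real^'n) set \<Rightarrow> real \<Rightarrow> (real^'n \<Rightarrow> real) \<Rightarrow> bool" where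
  "strict_subsolution \<Omega> \<sigma> K \<Omega>\<^sub>1 \<gamma>\<^sub>1 u \<longleftrightarrow>
     (\<forall>\<phi>. \<forall>x\<in>\<Omega>\<^sub>1. C2_on \<Omega> \<phi> \<and> local_max_at \<Omega> (\<lambda>y. u y - \<phi> y) x
        \<longrightarrow> MA_op \<sigma> K (u x) \<phi> x \<le> - \<gamma>\<^sub>1)"

definition supersolution ::
    "(real^'n) set \<Rightarrow> (real^'n \<Rightarrow> real^'m^'n) \<Rightarrow> (real^'n \<Rightarrow> real \<Rightarrow> real^'n \<Rightarrow> real^'n^'n \<Rightarrow> real)
      \<Rightarrow> (real^'n \<Rightarrow> real) \<Rightarrow> bool" where
  "supersolution \<Omega> \<sigma> K v \<longleftrightarrow>
     (\<forall>\<phi> x. C2_on \<Omega> \<phi> \<and> local_min_at \<Omega> (\<lambda>y. v y - \<phi> y) x \<and> pos_def (D2X \<sigma> \<phi> x)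
        \<longrightarrow> MA_op \<sigma> K (v x) \<phi> x \<ge> 0)"

end

theory Submission
  imports Defs
begin

text \<open>If \<open>u - v\<close> had a positive maximum away from the boundary, one would double the variables and
  penalize with \<open>\<bar>x - y\<bar>\<^sup>2 / 2\<epsilon>\<close>. The theorem on sums yields approximate second order jets
  \<open>(q1, X)\<close> of \<open>u\<close> and \<open>(q2, Y)\<close> of \<open>v\<close> obeying the matrix inequalities of the structure
  condition. Uniform convexity gives \<open>D2X u \<ge> \<gamma> I\<close>, while
  \<open>D2X v \<ge> D2X u - O(\<bar>x - y\<bar>\<^sup>2 / \<epsilon>) I\<close>, so the matrix for \<open>v\<close> is positive definite as well, the two
  values of \<open>log det\<close> are asymptotically ordered, and the strictness \<open>\<gamma>\<^sub>1 > 0\<close> is contradicted.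

  The theorem on sums is proved without Alexandrov's theorem. For a semiconvex \<open>w\<close>, let \<open>Z\<close> be the set of
  points where \<open>w\<close> is touched from above by a plane of slope at most \<open>r\<close>. The slope is a Lipschitz
  function on \<open>Z\<close> whose image is a ball, so \<open>Z\<close> is not negligible; hence some point of \<open>Z\<close> is not
  porous and the (extended) slope is differentiable there by Rademacher's theorem. Summing the slopes
  along segments that stay close to \<open>Z\<close> yields a second order expansion of \<open>w\<close> at that point.\<close>

section \<open>Porosity and Rademacher's theorem\<close>

text \<open>The least value of \<bar>a - s\<bar>^2 + \<bar>s - t\<bar>^2 + \<bar>t - b\<bar>^2 over
  s and t is \<bar>a - b\<bar>^2 / 3, reached by trisecting the segment. Hence sup-convolutions of
  \<open>u\<close> and \<open>- v\<close> of weight \<open>c = 3 / (2 * \<epsilon>)\<close>, coupled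
  again with weight c, reproduce the penalization by 1 / (2 \<epsilon>) exactly, and 2 c is the 3 /
  \<epsilon> of the structure condition, in its upper and its lower bound. The coupled function need
  not have a second order expansion at its maximum. A small linear perturbation cures this at the
  price of an error \<open>r\<close> in slopes, matrices and maximality. \<open>K\<close> is merely
  continuous, so the error is harmless only on a compact set of jets, and their bounds depend on
  \<epsilon>: \<open>r\<close> is chosen after \<epsilon>. Nonporosity stands in for density points.
  It says that near the point the set leaves no holes of proportional size, it holds at almost every
  point of any set, measurable or not, and it carries an estimate from the set to all nearby points
  at a relative cost \<theta>. It serves both Rademacher's theorem and the second order
  expansion.\<close>

definition nonporous_at :: "'a::real_normed_vector set \<Rightarrow> 'a \<Rightarrow> bool" where
  "nonporous_at S x \<longleftrightarrow>
     (\<forall>\<theta>>0. \<exists>\<delta>>0. \<forall>h. norm h < \<delta> \<longrightarrow> (\<exists>s\<in>S. norm (x + h - s) \<le> \<theta> * norm h))"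

text \<open>At a porous point the ball of radius \<open>(1 + \<theta>) * norm h\<close> contains a
  hole, the ball of radius \<open>\<theta> * norm h\<close> around \<open>x + h\<close>, which
  misses \<open>S\<close> and takes up a fixed fraction of the volume. Disjoint Vitali balls inside
  an open set \<open>V\<close> barely larger than \<open>F\<close> thus have total volume at most a
  constant times that of \<open>V - F\<close>.\<close>

lemma negligible_porous_points_aux:
  fixes S :: "'a::euclidean_space set"
  assumes \<theta>: "\<theta> > 0"
  shows "negligible {x \<in> S. \<forall>\<delta>>0. \<exists>h. norm h < \<delta> \<and> (\<forall>s\<in>S. \<theta> * norm h < norm (x + h - s))}"
    (is "negligible ?P")
proof -
  have "negligible (?P \<inter> ball 0 R)" for R :: real
  proof (clarsimp simp only: negligible_outer_le)
    fix e :: real assume "e > 0"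
    \<comment> \<open>The closure makes \<open>F\<close> measurable for every \<open>S\<close>, and
      an open hole that misses \<open>S\<close> also misses the closure.\<close>
    define F where "F = closure S \<inter> cball 0 R"
    have F: "compact F" "F \<in> sets lebesgue"
      by (auto simp: F_def compact_Int_closed Int_commute intro: closed_Int)
    \<comment> \<open>Volume of a Vitali ball divided by the volume of its hole.\<close>
    define c where "c = ((1 + \<theta>) / \<theta>) ^ DIM('a)"
    have c: "c > 0" using \<theta> by (simp add: c_def)
    obtain V where V: "open V" "F \<subseteq> V" "V - F \<in> lmeasurable" "emeasure lebesgue (V - F) < ennreal (e / c)"
      by (rule sets_lebesgue_outer_open[OF F(2), of "e/c"]) (use \<open>e > 0\<close> c in simp)
    have mV: "measure lebesgue (V - F) \<le> e / c"
    proof -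
      have "ennreal (measure lebesgue (V - F)) < ennreal (e / c)"
        using V(3,4) by (simp add: emeasure_eq_measure2 fmeasurableD2)
      then show ?thesis by (simp add: ennreal_less_iff)
    qed
    let ?K = "{(x,h). norm h > 0 \<and> ball x ((1+\<theta>) * norm h) \<subseteq> V \<and> ball (x + h) (\<theta> * norm h) \<inter> F = {}}"
    let ?a = "fst :: 'a \<times> 'a \<Rightarrow> 'a" and ?r = "\<lambda>p :: 'a \<times> 'a. (1+\<theta>) * norm (snd p)"
    let ?b = "\<lambda>p :: 'a \<times> 'a. ball (fst p + snd p) (\<theta> * norm (snd p))"
    obtain C where C: "countable C" "C \<subseteq> ?K"
      "pairwise (\<lambda>i j. disjnt (ball (?a i) (?r i)) (ball (?a j) (?r j))) C"
      "negligible (?P \<inter> ball 0 R - (\<Union>i\<in>C. ball (?a i) (?r i)))"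
    proof (rule Vitali_covering_theorem_balls [of "?P \<inter> ball 0 R" ?K ?a ?r])
      fix x d assume x: "x \<in> ?P \<inter> ball 0 R" and d: "(0::real) < d"
      have "x \<in> F" using x closure_subset[of S] by (auto simp: F_def)
      then have "x \<in> V" using V(2) by blast
      with V(1) obtain k where k: "k > 0" "ball x k \<subseteq> V" by (rule openE)
      obtain h where h: "norm h < min d k / (1+\<theta>)" "\<forall>s\<in>S. \<theta> * norm h < norm (x + h - s)"
      proof -
        have "min d k / (1+\<theta>) > 0" using d k \<theta> by simp
        then show ?thesis using x that by blast
      qed
      \<comment> \<open>For \<open>h = 0\<close> the point \<open>x\<close> of \<open>S\<close>
        would itself violate the strict inequality.\<close>
      have h0: "h \<noteq> 0" using h(2) x by auto
      have hd: "(1+\<theta>) * norm h < d" "(1+\<theta>) * norm h < k" using h(1) \<theta> by (auto simp: field_simps)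
      have "ball (x + h) (\<theta> * norm h) \<inter> S = {}"
        using h(2) by (force simp: dist_norm)
      then have "ball (x + h) (\<theta> * norm h) \<inter> closure S = {}"
        by (simp add: open_Int_closure_eq_empty)
      then have "(x,h) \<in> ?K"
        using h0 k hd by (auto simp: F_def)
      moreover have "x \<in> ball x ((1+\<theta>) * norm h)" using h0 \<theta> by simp
      ultimately show "\<exists>i. i \<in> ?K \<and> x \<in> ball (?a i) (?r i) \<and> ?r i < d"
        using hd by (intro exI[of _ "(x,h)"]) auto
    qed
    have sub: "?b p \<subseteq> ball (?a p) (?r p)" for p
    proof
      fix y assume "y \<in> ?b p"
      then have "norm (fst p + snd p - y) < \<theta> * norm (snd p)" by (simp add: dist_norm)
      moreover have "norm (fst p - y) \<le> norm (fst p + snd p - y) + norm (snd p)"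
        using norm_triangle_ineq4[of "fst p + snd p - y" "snd p"] by (simp add: algebra_simps)
      ultimately show "y \<in> ball (?a p) (?r p)" by (simp add: dist_norm algebra_simps)
    qed
    have le: "measure lebesgue (\<Union>p\<in>I. ball (?a p) (?r p)) \<le> e" if I: "I \<subseteq> C" "finite I" for I
    proof -
      have "measure lebesgue (\<Union>p\<in>I. ball (?a p) (?r p)) \<le> (\<Sum>p\<in>I. measure lebesgue (ball (?a p) (?r p)))"
        using I by (intro measure_UNION_le) auto
      also have "\<dots> = (\<Sum>p\<in>I. c * measure lebesgue (?b p))"
      proof (rule sum.cong[OF refl])
        fix p assume "p \<in> I"
        show "measure lebesgue (ball (?a p) (?r p)) = c * measure lebesgue (?b p)"
          using content_ball_conv_unit_ball[of "?r p" "?a p"] content_ball_conv_unit_ball[of "\<theta> * norm (snd p)" "fst p + snd p"] \<theta>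
          by (simp add: c_def power_mult_distrib power_divide)
      qed
      also have "\<dots> = c * measure lebesgue (\<Union>p\<in>I. ?b p)"
      proof -
        have "pairwise (\<lambda>i j. disjnt (?b i) (?b j)) I"
          using C(3) I(1) sub unfolding pairwise_def by (meson disjnt_subset1 disjnt_subset2 subsetD)
        then have "measure lebesgue (\<Union>p\<in>I. ?b p) = (\<Sum>p\<in>I. measure lebesgue (?b p))"
          using I by (intro measure_UNION') auto
        then show ?thesis by (simp add: sum_distrib_left)
      qed
      also have "\<dots> \<le> c * measure lebesgue (V - F)"
      proof (rule mult_left_mono)
        show "measure lebesgue (\<Union>p\<in>I. ?b p) \<le> measure lebesgue (V - F)"
        proof (rule measure_mono_fmeasurable)
          show "(\<Union>p\<in>I. ?b p) \<subseteq> V - F"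
            using C(2) I(1) sub by fastforce
          qed (use V I in \<open>auto intro!: sets.finite_UN\<close>)
      qed (use c in simp)
      also have "\<dots> \<le> e" using mV c by (simp add: field_simps)
      finally show ?thesis .
    qed
    have U: "(\<Union>p\<in>C. ball (?a p) (?r p)) \<in> lmeasurable" "measure lebesgue (\<Union>p\<in>C. ball (?a p) (?r p)) \<le> e"
      using \<open>e > 0\<close> le
      by (auto intro!: fmeasurable_UN_bound [OF \<open>countable C\<close>] measure_UN_bound [OF \<open>countable C\<close>])
    let ?N = "?P \<inter> ball 0 R - (\<Union>i\<in>C. ball (?a i) (?r i))"
    show "\<exists>T. ?P \<inter> ball 0 R \<subseteq> T \<and> T \<in> lmeasurable \<and> measure lebesgue T \<le> e"
    proof (intro exI conjI)
      show "?P \<inter> ball 0 R \<subseteq> (\<Union>p\<in>C. ball (?a p) (?r p)) \<union> ?N" by blast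
      show "(\<Union>p\<in>C. ball (?a p) (?r p)) \<union> ?N \<in> lmeasurable"
        by (intro fmeasurable.Un U negligible_imp_measurable C)
      have "measure lebesgue ((\<Union>p\<in>C. ball (?a p) (?r p)) \<union> ?N) = measure lebesgue (\<Union>p\<in>C. ball (?a p) (?r p))"
        by (rule measure_negligible_symdiff[OF U(1)]) (rule negligible_subset[OF C(4)], blast)
      then show "measure lebesgue ((\<Union>p\<in>C. ball (?a p) (?r p)) \<union> ?N) \<le> e" using U by simp
    qed
  qed
  then have "negligible (\<Union>n::nat. ?P \<inter> ball 0 (real n))"
    by (intro negligible_countable_Union) auto
  moreover have "?P \<subseteq> (\<Union>n::nat. ?P \<inter> ball 0 (real n))"
  proof
    fix x assume "x \<in> ?P"
    moreover obtain n where "norm x < real n" using reals_Archimedean2 by blast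
    ultimately show "x \<in> (\<Union>n::nat. ?P \<inter> ball 0 (real n))" by auto
  qed
  ultimately show ?thesis by (rule negligible_subset)
qed

lemma negligible_porous_points:
  fixes S :: "'a::euclidean_space set"
  shows "negligible {x \<in> S. \<not> nonporous_at S x}"
proof -
  let ?P = "\<lambda>\<theta>. {x \<in> S. \<forall>\<delta>>0. \<exists>h. norm h < \<delta> \<and> (\<forall>s\<in>S. \<theta> * norm h < norm (x + h - s))}"
  have "negligible (\<Union>n. ?P (inverse (real (Suc n))))"
  proof -
    have "negligible (?P (inverse (real (Suc n))))" for n
      by (rule negligible_porous_points_aux) simp
    then show ?thesis by (intro negligible_countable_Union) (auto simp del: of_nat_Suc)
  qed
  moreover have "{x \<in> S. \<not> nonporous_at S x} \<subseteq> (\<Union>n. ?P (inverse (real (Suc n))))"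
  proof clarify
    fix x assume x: "x \<in> S" "\<not> nonporous_at S x"
    then obtain \<theta> where \<theta>: "\<theta> > 0" "\<And>\<delta>. \<delta> > 0 \<Longrightarrow> \<exists>h. norm h < \<delta> \<and> (\<forall>s\<in>S. \<not> norm (x + h - s) \<le> \<theta> * norm h)"
      unfolding nonporous_at_def by metis
    obtain n where n: "inverse (real (Suc n)) < \<theta>" using reals_Archimedean \<theta>(1) by blast
    have "\<exists>h. norm h < \<delta> \<and> (\<forall>s\<in>S. inverse (real (Suc n)) * norm h < norm (x + h - s))" if d0: "\<delta> > 0" for \<delta>
    proof -
      obtain h where h: "norm h < \<delta>" "\<forall>s\<in>S. \<not> norm (x + h - s) \<le> \<theta> * norm h" using \<theta>(2)[OF d0] by auto
      have "inverse (real (Suc n)) * norm h \<le> \<theta> * norm h" using n by (intro mult_right_mono) auto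
      then show ?thesis using h by (intro exI[of _ h]) force
    qed
    then show "x \<in> (\<Union>n. ?P (inverse (real (Suc n))))" using x by blast
  qed
  ultimately show ?thesis by (rule negligible_subset)
qed

text \<open>Adding \<open>(L + 1) * t\<close> makes the function increasing and bi-Lipschitz. Its
  Stieltjes measure, the image of Lebesgue measure under the inverse \<open>G\<close>, is absolutely
  continuous because Lipschitz maps preserve null sets; Radon-Nikodym gives a density, and
  Lebesgue's differentiation theorem recovers the derivative from averages over
  \<open>{t..t+h}\<close>. One side is all that is used later: a negative step is read as a positive
  step from its endpoint.\<close>

lemma Lipschitz_right_derivative_ae:
  fixes F :: "real \<Rightarrow> real"
  assumes L: "\<And>s t. \<bar>F s - F t\<bar> \<le> L * \<bar>s - t\<bar>"
  obtains N where "negligible N"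
    "\<And>t. t \<notin> N \<Longrightarrow> \<exists>D. \<forall>e>0. \<exists>d>0. \<forall>h. 0 < h \<and> h < d \<longrightarrow> \<bar>F (t + h) - F t - h * D\<bar> \<le> e * h"
proof -
  have L0: "L \<ge> 0" using L[of 1 0] by simp
  define F1 where "F1 t = F t + (L + 1) * t" for t
  \<comment> \<open>The slopes of \<open>F1\<close> lie between 1 and \<open>2 * L + 1\<close>: the
    lower bound makes the inverse 1-Lipschitz, the upper one keeps images of null sets null.\<close>
  have F1: "t - s \<le> F1 t - F1 s" "F1 t - F1 s \<le> (2 * L + 1) * (t - s)" if "s \<le> t" for s t
    using L[of t s] that by (auto simp: F1_def algebra_simps abs_le_iff)
  have F1abs: "\<bar>s - t\<bar> \<le> \<bar>F1 s - F1 t\<bar>" "\<bar>F1 s - F1 t\<bar> \<le> (2 * L + 1) * \<bar>s - t\<bar>" for s t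
    using F1[of s t] F1[of t s] by (cases "s \<le> t"; force simp: abs_if)+
  have F1_le: "F1 s \<le> F1 t \<longleftrightarrow> s \<le> t" for s t
    using F1(1)[of s t] F1(1)[of t s] by linarith
  have contF1: "continuous_on UNIV F1"
  proof (rule lipschitz_on_continuous_on)
    show "(2 * L + 1)-lipschitz_on UNIV F1"
      using F1abs L0 by (intro lipschitz_onI) (auto simp: dist_real_def)
  qed
  have "bij F1"
  proof (rule bijI)
    show "inj F1" using F1abs(1) by (intro injI) (smt (verit) )
    show "surj F1"
    proof (rule surjI[where f = "\<lambda>y. SOME x. F1 x = y"])
      fix y
      define T where "T = \<bar>y - F1 0\<bar>"
      have "F1 (- T) \<le> y" "y \<le> F1 T" using F1(1)[of "-T" 0] F1(1)[of 0 T] by (auto simp: T_def abs_if split: if_splits)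
      then have "\<exists>x\<ge>-T. x \<le> T \<and> F1 x = y"
        by (intro IVT') (auto simp: T_def intro: continuous_on_subset[OF contF1])
      then show "F1 (SOME x. F1 x = y) = y" by (metis (mono_tags, lifting) someI)
    qed
  qed
  define G where "G = inv F1"
  have FG [simp]: "F1 (G y) = y" and GF [simp]: "G (F1 x) = x" for x y
    using \<open>bij F1\<close> by (auto simp: G_def bij_is_surj surj_f_inv_f bij_is_inj)
  have "continuous_on UNIV G"
  proof (rule lipschitz_on_continuous_on)
    show "1-lipschitz_on UNIV G"
      using F1abs(1)[of "G x" "G y" for x y] by (intro lipschitz_onI) (auto simp: dist_real_def)
  qed
  then have G_meas [measurable]: "G \<in> borel_measurable borel" by (rule borel_measurable_continuous_onI)
  define M where "M = distr lborel borel G"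
  have vimG: "G -` A = F1 ` A" for A
  proof
    show "G -` A \<subseteq> F1 ` A" by (metis FG image_eqI subsetI vimage_eq)
  qed auto
  have M_Icc: "emeasure M {a..b} = ennreal (F1 b - F1 a)" if "a \<le> b" for a b
  proof -
    have "G -` {a..b} = {F1 a..F1 b}"
    proof (intro set_eqI)
      fix y show "y \<in> G -` {a..b} \<longleftrightarrow> y \<in> {F1 a..F1 b}"
        using F1_le[of a "G y"] F1_le[of "G y" b] by simp
    qed
    then show ?thesis using that F1_le[of a b] by (simp add: M_def emeasure_distr)
  qed
  have "absolutely_continuous lborel M"
    unfolding absolutely_continuous_def
  proof
    fix A :: "real set" assume A: "A \<in> null_sets lborel"
    then have "negligible A" by (simp add: negligible_iff_null_sets null_sets_completionI)
    then have "negligible (F1 ` A)"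
    proof (rule negligible_locally_Lipschitz_image[rotated])
      fix x assume "x \<in> A"
      show "\<exists>T B. open T \<and> x \<in> T \<and> (\<forall>y\<in>A \<inter> T. norm (F1 y - F1 x) \<le> B * norm (y - x))"
        using F1abs(2) by (intro exI[of _ UNIV] exI[of _ "2*L+1"]) auto
    qed simp
    moreover have A': "A \<in> sets borel" using A by auto
    then have "G -` A \<in> sets borel" using measurable_sets[OF G_meas A'] by simp
    ultimately have "G -` A \<in> null_sets lborel"
      unfolding vimG negligible_iff_null_sets by (simp add: null_sets_completion_iff)
    then show "A \<in> null_sets M" using A'
      by (auto simp: M_def null_sets_def emeasure_distr)
  qed
  moreover have "sets M = sets lborel" by (simp add: M_def)
  ultimately obtain f where f [measurable]: "f \<in> borel_measurable lborel" and dens: "density lborel f = M"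
    using sigma_finite_measure.Radon_Nikodym[OF sigma_finite_lborel, of M] by blast
  have f_int: "(\<integral>\<^sup>+x. f x * indicator {a..b} x \<partial>lborel) = ennreal (F1 b - F1 a)" if "a \<le> b" for a b
    using M_Icc[OF that] unfolding dens[symmetric] by (subst (asm) emeasure_density) auto
  \<comment> \<open>The density takes extended values; the finite measure of each bounded interval
    excludes infinity almost everywhere.\<close>
  have fin: "AE x in lborel. f x \<noteq> \<infinity>"
  proof -
    have "AE x in lborel. f x * indicator {- real n..real n} x \<noteq> \<infinity>" for n
      by (rule nn_integral_noteq_infinite) (auto simp: f_int)
    then have "AE x in lborel. \<forall>n. f x * indicator {- real n..real n} x \<noteq> \<infinity>"
      by (simp add: AE_all_countable)
    then show ?thesis
    proof eventually_elim
      case (elim x)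
      obtain n where "\<bar>x\<bar> \<le> real n" using real_arch_simple by blast
      then have "x \<in> {- real n..real n}" by auto
      then show ?case using elim[rule_format, of n] by (simp only: indicator_simps) simp
    qed
  qed
  define g where "g x = enn2real (f x)" for x
  have [measurable]: "g \<in> borel_measurable lborel" by (simp add: g_def[abs_def])
  have g: "(g has_integral F1 b - F1 a) {a..b}" if "a \<le> b" for a b
  proof -
    have "(\<integral>\<^sup>+x. ennreal (g x * indicator {a..b} x) \<partial>lborel) = (\<integral>\<^sup>+x. f x * indicator {a..b} x \<partial>lborel)"
      using fin by (intro nn_integral_cong_AE) (auto simp: g_def indicator_def ennreal_enn2real_if)
    also have "\<dots> = ennreal (F1 b - F1 a)" using f_int that by simp
    finally have "((\<lambda>x. g x * indicator {a..b} x) has_integral F1 b - F1 a) UNIV"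
      using that F1_le[of a b] by (intro nn_integral_has_integral) (auto simp: g_def)
    then have "((\<lambda>x. if x \<in> {a..b} then g x else 0) has_integral F1 b - F1 a) UNIV"
      by (rule has_integral_eq[rotated]) (auto simp: indicator_def)
    then show ?thesis by (simp only: has_integral_restrict_UNIV)
  qed
  have "g integrable_on cbox a b" for a b
    using g[of a b] by (cases "a \<le> b") (auto simp: integrable_on_def)
  then have gi: "g integrable_on cbox a b" for a b .
  define P where "P N \<longleftrightarrow> negligible N \<and> (\<forall>x. x \<notin> N \<longrightarrow> (\<forall>e>0.
      \<exists>d>0. \<forall>h. 0 < h \<and> h < d \<longrightarrow> norm (integral (cbox x (x + h *\<^sub>R One)) g /\<^sub>R h ^ DIM(real) - g x) < e))" for N
  \<comment> \<open>On the line, the cube with lower corner \<open>x\<close> and side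
    \<open>h\<close> is the interval to the right of \<open>x\<close>.\<close>
  have "\<exists>N. P N"
  proof (rule integrable_ccontinuous_explicit[of g, OF gi])
    fix N
    assume "negligible N" and "\<And>x e. \<lbrakk>x \<notin> N; 0 < e\<rbrakk> \<Longrightarrow>
        \<exists>d>0. \<forall>h. 0 < h \<and> h < d \<longrightarrow> norm (integral (cbox x (x + h *\<^sub>R One)) g /\<^sub>R h ^ DIM(real) - g x) < e"
    then have "P N" unfolding P_def by blast
    then show ?thesis ..
  qed
  then obtain N where "P N" ..
  then have N: "negligible N"
    "\<And>x e. \<lbrakk>x \<notin> N; 0 < e\<rbrakk> \<Longrightarrow>
        \<exists>d>0. \<forall>h. 0 < h \<and> h < d \<longrightarrow> norm(integral (cbox x (x + h *\<^sub>R One)) g /\<^sub>R h ^ DIM(real) - g x) < e"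
    unfolding P_def by blast+
  have "\<exists>d>0. \<forall>h. 0 < h \<and> h < d \<longrightarrow> \<bar>F (t + h) - F t - h * (g t - (L + 1))\<bar> \<le> e * h"
    if te: "t \<notin> N" "e > 0" for t e
  proof -
    obtain d where d: "d > 0"
      "\<And>h. 0 < h \<Longrightarrow> h < d \<Longrightarrow> norm(integral (cbox t (t + h *\<^sub>R One)) g /\<^sub>R h ^ DIM(real) - g t) < e"
      using N(2)[OF te] by blast
    show "\<exists>d>0. \<forall>h. 0 < h \<and> h < d \<longrightarrow> \<bar>F (t + h) - F t - h * (g t - (L + 1))\<bar> \<le> e * h"
    proof (intro exI conjI allI impI)
      fix h assume h: "0 < h \<and> h < d"
      have "integral {t..t+h} g = F1 (t+h) - F1 t" using g[of t "t+h"] h by (simp add: integral_unique)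
      then have "\<bar>(F1 (t+h) - F1 t) / h - g t\<bar> < e" using d(2)[of h] h by (simp add: divide_inverse mult.commute)
      then have "h * \<bar>(F1 (t+h) - F1 t) / h - g t\<bar> \<le> h * e" using h by (intro mult_left_mono) auto
      moreover have "h * \<bar>(F1 (t+h) - F1 t) / h - g t\<bar> = \<bar>F1 (t+h) - F1 t - h * g t\<bar>"
      proof -
        have "h * ((F1 (t+h) - F1 t) / h - g t) = F1 (t+h) - F1 t - h * g t" using h by (simp add: field_simps)
        then show ?thesis using h by (metis abs_mult abs_of_pos)
      qed
      ultimately show "\<bar>F (t + h) - F t - h * (g t - (L + 1))\<bar> \<le> e * h"
        by (simp add: F1_def algebra_simps)
    qed (fact d(1))
  qed
  then have "\<exists>D. \<forall>e>0. \<exists>d>0. \<forall>h. 0 < h \<and> h < d \<longrightarrow> \<bar>F (t + h) - F t - h * D\<bar> \<le> e * h" if "t \<notin> N" for t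
    using that by (intro exI[of _ "g t - (L + 1)"]) simp
  with N(1) show thesis by (rule that)
qed

text \<open>The slope \<open>r\<close> may depend on \<open>e\<close>, since in the application it
  is a rational vector. Two slopes with errors \<open>e\<close> and \<open>e'\<close> differ by at
  most \<open>e + e'\<close>, as the direction \<open>r - r'\<close> shows, so slopes with errors
  tending to 0 form a Cauchy sequence, and its limit is the gradient.\<close>

lemma differentiable_at_if_approx_affine:
  fixes f :: "'a::euclidean_space \<Rightarrow> real"
  assumes "\<And>e. e > 0 \<Longrightarrow> \<exists>r. \<exists>\<delta>>0. \<forall>h. norm h < \<delta> \<longrightarrow> \<bar>f (x + h) - f x - r \<bullet> h\<bar> \<le> e * norm h"
  shows "f differentiable at x"
proof -
  let ?P = "\<lambda>e r. \<exists>\<delta>>0. \<forall>h. norm h < \<delta> \<longrightarrow> \<bar>f (x + h) - f x - r \<bullet> h\<bar> \<le> e * norm h"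
  have close: "norm (r - r') \<le> e + e'" if rr: "?P e r" "?P e' r'" "e > 0" "e' > 0" for e r e' r'
  proof (cases "r = r'")
    case True
    then show ?thesis using rr by simp
  next
    case False
    obtain \<delta> where \<delta>: "\<delta> > 0" "\<And>h. norm h < \<delta> \<Longrightarrow> \<bar>f (x + h) - f x - r \<bullet> h\<bar> \<le> e * norm h" using rr by blast
    obtain \<delta>' where \<delta>': "\<delta>' > 0" "\<And>h. norm h < \<delta>' \<Longrightarrow> \<bar>f (x + h) - f x - r' \<bullet> h\<bar> \<le> e' * norm h" using rr by blast
    define t where "t = min \<delta> \<delta>' / (2 * norm (r - r'))"
    define h where "h = t *\<^sub>R (r - r')"
    have t: "t > 0" using False \<delta>(1) \<delta>'(1) by (simp add: t_def)
    have nh: "norm h = min \<delta> \<delta>' / 2" using False \<delta>(1) \<delta>'(1) by (simp add: h_def t_def)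
    then have "norm h < \<delta>" "norm h < \<delta>'" using \<delta>(1) \<delta>'(1) by auto
    then have "\<bar>(r - r') \<bullet> h\<bar> \<le> (e + e') * norm h"
      using \<delta>(2)[of h] \<delta>'(2)[of h] by (simp add: inner_diff_left algebra_simps)
    moreover have "(r - r') \<bullet> h = norm (r - r') * norm h"
      using t by (simp add: h_def dot_square_norm power2_eq_square)
    ultimately have "norm (r - r') * norm h \<le> (e + e') * norm h" by simp
    then show ?thesis using nh \<delta>(1) \<delta>'(1) by simp
  qed
  have "\<exists>r. ?P (inverse (real (Suc n))) r" for n using assms by simp
  then obtain r where r: "\<And>n. ?P (inverse (real (Suc n))) (r n)" by metis
  have "Cauchy r"
  proof (rule metric_CauchyI)
    fix e :: real assume "e > 0"
    then obtain N where N: "inverse (real (Suc N)) < e / 2" using reals_Archimedean half_gt_zero by blast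
    have "inverse (real (Suc n)) < e / 2" if "n \<ge> N" for n
      by (rule le_less_trans[OF _ N]) (use that in \<open>simp add: field_simps\<close>)
    moreover have "norm (r m - r n) \<le> inverse (real (Suc m)) + inverse (real (Suc n))" for m n
      by (rule close[OF r r]) auto
    ultimately have "dist (r m) (r n) < e" if "m \<ge> N" "n \<ge> N" for m n
      using that unfolding dist_norm by (smt (verit) field_sum_of_halves)
    then show "\<exists>M. \<forall>m\<ge>M. \<forall>n\<ge>M. dist (r m) (r n) < e" by blast
  qed
  then obtain R where R: "r \<longlonglongrightarrow> R" using Cauchy_convergent convergent_def by blast
  have "(f has_derivative (\<lambda>h. R \<bullet> h)) (at x)"
    unfolding has_derivative_at_alt
  proof (intro conjI allI impI)
    show "bounded_linear ((\<bullet>) R)" by (rule bounded_linear_inner_right)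
    fix e :: real assume e: "e > 0"
    have "\<forall>\<^sub>F n in sequentially. inverse (real (Suc n)) < e / 2"
      using LIMSEQ_inverse_real_of_nat e by (intro order_tendstoD) auto
    moreover have "\<forall>\<^sub>F n in sequentially. dist (r n) R < e / 2"
      using R e by (intro tendstoD) auto
    ultimately have "\<forall>\<^sub>F n in sequentially. inverse (real (Suc n)) < e / 2 \<and> dist (r n) R < e / 2"
      by eventually_elim auto
    then obtain n where n: "inverse (real (Suc n)) < e / 2" "norm (r n - R) < e / 2"
      by (auto simp: eventually_sequentially dist_norm)
    obtain \<delta> where \<delta>: "\<delta> > 0" "\<And>h. norm h < \<delta> \<Longrightarrow> \<bar>f (x + h) - f x - r n \<bullet> h\<bar> \<le> inverse (real (Suc n)) * norm h"
      using r[of n] by blast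
    show "\<exists>d>0. \<forall>y. norm (y - x) < d \<longrightarrow> norm (f y - f x - R \<bullet> (y - x)) \<le> e * norm (y - x)"
    proof (intro exI conjI allI impI)
      fix y assume y: "norm (y - x) < \<delta>"
      have "\<bar>f y - f x - r n \<bullet> (y - x)\<bar> \<le> inverse (real (Suc n)) * norm (y - x)"
        using \<delta>(2)[OF y] by simp
      also have "\<dots> \<le> e / 2 * norm (y - x)" using n by (intro mult_right_mono) auto
      finally have "\<bar>f y - f x - r n \<bullet> (y - x)\<bar> \<le> e / 2 * norm (y - x)" .
      moreover have "\<bar>(r n - R) \<bullet> (y - x)\<bar> \<le> e / 2 * norm (y - x)"
        using Cauchy_Schwarz_ineq2[of "r n - R" "y - x"] n mult_right_mono[of "norm (r n - R)" "e/2" "norm (y - x)"] by auto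
      ultimately show "norm (f y - f x - R \<bullet> (y - x)) \<le> e * norm (y - x)"
        unfolding real_norm_def inner_diff_left[of "r n"] by linarith
    qed (fact \<delta>(1))
  qed
  then show ?thesis by (auto simp: differentiable_def)
qed

lemma Lipschitz_const_nonneg:
  fixes f :: "'a::euclidean_space \<Rightarrow> real"
  assumes "\<And>x y. \<bar>f x - f y\<bar> \<le> L * norm (x - y)"
  shows "L \<ge> 0"
proof -
  obtain i :: 'a where "i \<in> Basis" using nonempty_Basis by blast
  then show ?thesis using assms[of i 0] by simp
qed

text \<open>Integrate the indicator of \<open>B\<close> at \<open>w + t *\<^sub>R b\<close> over
  \<open>w\<close> and \<open>t\<close>. In one order the inner integral vanishes by assumption; in
  the other, translation invariance makes it the measure of \<open>B\<close> for each
  \<open>t\<close>, and a constant whose integral over the line is 0 must vanish.\<close>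

lemma negligible_if_lines_negligible:
  fixes B :: "'a::euclidean_space set"
  assumes [measurable]: "B \<in> sets borel" and B: "\<And>w. negligible {t::real. w + t *\<^sub>R b \<in> B}"
  shows "negligible B"
proof -
  let ?f = "\<lambda>(w::'a) (t::real). indicator B (w + t *\<^sub>R b) :: ennreal"
  have "(\<integral>\<^sup>+t. (\<integral>\<^sup>+w. ?f w t \<partial>lborel) \<partial>lborel) = (\<integral>\<^sup>+w. (\<integral>\<^sup>+t. ?f w t \<partial>lborel) \<partial>lborel)"
    by (rule lborel_pair.Fubini') measurable
  also have "\<dots> = (\<integral>\<^sup>+w. 0 \<partial>(lborel :: 'a measure))"
  proof (rule nn_integral_cong)
    fix w :: 'a
    have *: "{t::real. w + t *\<^sub>R b \<in> B} \<in> sets borel" by measurable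
    then have "{t::real. w + t *\<^sub>R b \<in> B} \<in> null_sets lborel"
      using B[of w] by (simp add: negligible_iff_null_sets null_sets_completion_iff)
    then have "AE t in lborel. w + t *\<^sub>R b \<notin> B" by (auto intro: AE_I')
    then have "(\<integral>\<^sup>+t. ?f w t \<partial>lborel) = (\<integral>\<^sup>+(t::real). 0 \<partial>lborel)"
      by (intro nn_integral_cong_AE) (auto simp: indicator_def)
    then show "(\<integral>\<^sup>+t. ?f w t \<partial>lborel) = 0" by simp
  qed
  finally have 0: "(\<integral>\<^sup>+t. (\<integral>\<^sup>+w. ?f w t \<partial>lborel) \<partial>lborel) = 0" by simp
  have "(\<integral>\<^sup>+w. ?f w t \<partial>lborel) = emeasure lborel B" for t
  proof -
    have "emeasure lborel B = (\<integral>\<^sup>+w. indicator B w \<partial>distr lborel borel ((+) (t *\<^sub>R b)))"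
      by (simp add: lborel_distr_plus)
    also have "\<dots> = (\<integral>\<^sup>+w. indicator B (t *\<^sub>R b + w) \<partial>lborel)"
      by (subst nn_integral_distr) auto
    finally show ?thesis by (simp add: add.commute)
  qed
  with 0 have "emeasure lborel B * emeasure lborel (UNIV :: real set) = 0" by simp
  then have "emeasure lborel B = 0" by simp
  then have "B \<in> null_sets lborel" by (auto simp: null_sets_def)
  then show ?thesis by (simp add: negligible_iff_null_sets null_sets_completionI)
qed

text \<open>Rational slopes and the scales \<open>inverse (Suc n)\<close> turn the existence of a
  right derivative along \<open>b\<close> into a countable combination of closed conditions, so the
  exceptional set is Borel and Fubini applies.\<close>

lemma Lipschitz_line_derivative_ae:
  fixes f :: "'a::euclidean_space \<Rightarrow> real"
  assumes L: "\<And>x y. \<bar>f x - f y\<bar> \<le> L * norm (x - y)"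
  shows "negligible {x. \<not> (\<forall>k::nat. \<exists>q\<in>\<rat>. \<exists>n::nat. \<forall>t. 0 \<le> t \<and> t < inverse (Suc n) \<longrightarrow>
      \<bar>f (x + t *\<^sub>R b) - f x - t * q\<bar> \<le> t * inverse (Suc k))}" (is "negligible ?B")
proof (rule negligible_if_lines_negligible[where b = b])
  have cont: "continuous_on UNIV f"
  proof -
    have "L \<ge> 0" using L by (rule Lipschitz_const_nonneg)
    then have "L-lipschitz_on UNIV f" using L by (intro lipschitz_onI) (auto simp: dist_norm)
    then show ?thesis by (rule lipschitz_on_continuous_on)
  qed
  define A where "A k q n = {x. \<forall>t. 0 \<le> t \<and> t < inverse (real (Suc n)) \<longrightarrow>
      \<bar>f (x + t *\<^sub>R b) - f x - t * q\<bar> \<le> t * inverse (real (Suc k))}" for k q and n :: nat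
  have "closed (A k q n)" for k q n
  proof -
    have "A k q n = (\<Inter>t\<in>{0..<inverse (real (Suc n))}. {x. \<bar>f (x + t *\<^sub>R b) - f x - t * q\<bar> \<le> t * inverse (real (Suc k))})"
      by (auto simp: A_def)
    moreover have "continuous_on UNIV (\<lambda>x. \<bar>f (x + t *\<^sub>R b) - f x - t * q\<bar>)" for t
      by (intro continuous_intros continuous_on_compose2[OF cont]) auto
    ultimately show ?thesis by (auto intro!: closed_Collect_le)
  qed
  then have [measurable]: "A k q n \<in> sets borel" for k q n by (rule borel_closed)
  have "?B = {x. \<not> (\<forall>k. \<exists>q\<in>\<rat>. \<exists>n. x \<in> A k q n)}"
    unfolding A_def mem_Collect_eq ..
  also have "\<dots> = - (\<Inter>k. \<Union>q\<in>\<rat>. \<Union>n. A k q n)"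
    by (simp only: Compl_eq mem_Collect_eq INT_iff UN_iff UNIV_I simp_thms ball_UNIV bex_UNIV)
  finally have eqB: "?B = - (\<Inter>k. \<Union>q\<in>\<rat>. \<Union>n. A k q n)" .
  have "(\<Inter>k. \<Union>q\<in>\<rat>. \<Union>n. A k q n) \<in> sets borel"
    by (intro sets.countable_INT'' sets.countable_UN' countable_rat) auto
  then show "?B \<in> sets borel" unfolding eqB by (rule borel_comp)
next
  fix w
  have "\<bar>f (w + s *\<^sub>R b) - f (w + t *\<^sub>R b)\<bar> \<le> (L * norm b) * \<bar>s - t\<bar>" for s t
    using L[of "w + s *\<^sub>R b" "w + t *\<^sub>R b"] by (simp add: algebra_simps flip: scaleR_diff_left)
  then obtain N where N: "negligible N" "\<And>t. t \<notin> N \<Longrightarrow> \<exists>D. \<forall>e>0. \<exists>d>0. \<forall>h. 0 < h \<and> h < d \<longrightarrow>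
      \<bar>f (w + (t + h) *\<^sub>R b) - f (w + t *\<^sub>R b) - h * D\<bar> \<le> e * h"
    by (rule Lipschitz_right_derivative_ae[of "\<lambda>t. f (w + t *\<^sub>R b)" "L * norm b"]) blast
  have "\<exists>q\<in>\<rat>. \<exists>n. \<forall>h. 0 \<le> h \<and> h < inverse (real (Suc n)) \<longrightarrow>
      \<bar>f (w + t *\<^sub>R b + h *\<^sub>R b) - f (w + t *\<^sub>R b) - h * q\<bar> \<le> h * inverse (real (Suc k))" if t: "t \<notin> N" for t and k :: nat
  proof -
    obtain D where D: "\<And>e. e > 0 \<Longrightarrow> \<exists>d>0. \<forall>h. 0 < h \<and> h < d \<longrightarrow>
      \<bar>f (w + (t + h) *\<^sub>R b) - f (w + t *\<^sub>R b) - h * D\<bar> \<le> e * h" using N(2)[OF t] by blast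
    let ?e = "inverse (real (Suc k)) / 2"
    obtain d where d: "d > 0" "\<And>h. 0 < h \<Longrightarrow> h < d \<Longrightarrow> \<bar>f (w + (t + h) *\<^sub>R b) - f (w + t *\<^sub>R b) - h * D\<bar> \<le> ?e * h"
      using D[of ?e] by auto
    \<comment> \<open>The rational \<open>q\<close> misses \<open>D\<close> by less than
      \<open>?e\<close>, half of the allowed error; the difference quotient uses up the other
      half.\<close>
    obtain q where q: "q \<in> \<rat>" "D < q" "q < D + ?e" using Rats_dense_in_real[of D "D + ?e"] by auto
    obtain n where n: "inverse (real (Suc n)) < d" using reals_Archimedean d(1) by blast
    show ?thesis
    proof (intro bexI[OF _ q(1)] exI[of _ n] allI impI)
      fix h assume h: "0 \<le> h \<and> h < inverse (real (Suc n))"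
      show "\<bar>f (w + t *\<^sub>R b + h *\<^sub>R b) - f (w + t *\<^sub>R b) - h * q\<bar> \<le> h * inverse (real (Suc k))"
      proof (cases "h = 0")
        case False
        have eq: "w + (t + h) *\<^sub>R b = w + t *\<^sub>R b + h *\<^sub>R b" by (simp add: scaleR_add_left)
        have "\<bar>f (w + t *\<^sub>R b + h *\<^sub>R b) - f (w + t *\<^sub>R b) - h * D\<bar> \<le> ?e * h"
          using d(2)[of h] h n False unfolding eq by auto
        moreover have "\<bar>h * D - h * q\<bar> \<le> h * ?e" 
        proof -
          have "\<bar>h * D - h * q\<bar> = h * (q - D)" using h q by (simp add: abs_mult flip: right_diff_distrib)
          also have "\<dots> \<le> h * ?e" using h q by (intro mult_left_mono) auto
          finally show ?thesis .
        qed
        moreover have "?e * h + h * ?e = h * inverse (real (Suc k))" by simp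
        ultimately show ?thesis unfolding abs_le_iff by linarith
      qed simp
    qed
  qed
  then have "{t. w + t *\<^sub>R b \<in> ?B} \<subseteq> N" by blast
  then show "negligible {t. w + t *\<^sub>R b \<in> ?B}" using N(1) negligible_subset by blast
qed

text \<open>Walk from \<open>x\<close> to \<open>x + h\<close> one coordinate at a time. By
  nonporosity each corner of the path is within a small multiple of \<open>norm h\<close> of a point
  of \<open>E\<close>, where the estimate along the axis holds at the uniform scale
  \<open>\<tau>\<close>. A step costs 3 \<epsilon> times \<open>norm h\<close>: two transfers by the
  Lipschitz bound and one difference quotient.\<close>

lemma approx_affine_at_nonporous:
  fixes f :: "'a::euclidean_space \<Rightarrow> real"
  assumes L: "\<And>x y. \<bar>f x - f y\<bar> \<le> L * norm (x - y)"
    and E: "\<And>y b t. y \<in> E \<Longrightarrow> b \<in> Basis \<Longrightarrow> 0 \<le> t \<Longrightarrow> t < \<tau> \<Longrightarrow> \<bar>f (y + t *\<^sub>R b) - f y - t * c b\<bar> \<le> t * \<epsilon>"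
    and x: "nonporous_at E x" and pos: "\<tau> > 0" "\<epsilon> > 0"
  shows "\<exists>\<delta>>0. \<forall>h. norm h < \<delta> \<longrightarrow> \<bar>f (x + h) - f x - (\<Sum>b\<in>Basis. c b *\<^sub>R b) \<bullet> h\<bar> \<le> 3 * real DIM('a) * \<epsilon> * norm h"
proof -
  define N where "N = real DIM('a)"
  have N: "N \<ge> 1" by (simp add: N_def Suc_leI)
  have L0: "L \<ge> 0" using L by (rule Lipschitz_const_nonneg)
  \<comment> \<open>\<open>L + 1\<close> instead of \<open>L\<close> covers \<open>L = 0\<close>;
    the factor \<open>N\<close> pays for the length of the partial sums \<open>S B\<close>.\<close>
  define \<theta> where "\<theta> = \<epsilon> / ((L + 1) * N)"
  have \<theta>: "\<theta> > 0" using pos N L0 by (simp add: \<theta>_def)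
  have L\<theta>: "L * (\<theta> * N) \<le> \<epsilon>"
  proof -
    have "\<theta> * N = \<epsilon> / (L + 1)" using N by (simp add: \<theta>_def)
    then show ?thesis using pos L0 by (simp add: pos_divide_le_eq algebra_simps)
  qed
  obtain \<delta> where \<delta>: "\<delta> > 0" "\<And>h. norm h < \<delta> \<Longrightarrow> \<exists>s\<in>E. norm (x + h - s) \<le> \<theta> * norm h"
    using x \<theta> unfolding nonporous_at_def by blast
  show ?thesis
  proof (intro exI conjI allI impI)
    show "min \<tau> (\<delta> / N) > 0" using \<delta>(1) pos N by simp
    fix h :: 'a assume h: "norm h < min \<tau> (\<delta> / N)"
    define S where "S B = (\<Sum>b\<in>B. (h \<bullet> b) *\<^sub>R b)" for B
    have S: "norm (S B) \<le> N * norm h" if "B \<subseteq> Basis" for B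
    proof -
      have "norm (S B) \<le> (\<Sum>b\<in>B. norm ((h \<bullet> b) *\<^sub>R b))" unfolding S_def by (rule norm_sum)
      also have "\<dots> \<le> (\<Sum>b\<in>B. norm h)"
      proof (rule sum_mono)
        fix b assume "b \<in> B"
        then have "b \<in> Basis" using that by blast
        then show "norm ((h \<bullet> b) *\<^sub>R b) \<le> norm h" using Basis_le_norm[of b h] by simp
      qed
      also have "\<dots> = real (card B) * norm h" by simp
      also have "\<dots> \<le> N * norm h" unfolding N_def using that by (intro mult_right_mono) (auto intro: card_mono)
      finally show ?thesis .
    qed
    have near: "\<exists>s\<in>E. L * norm (x + S B - s) \<le> \<epsilon> * norm h" if B: "B \<subseteq> Basis" for B
    proof -
      have "N * norm h < \<delta>" using h N by (simp add: field_simps)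
      then have "norm (S B) < \<delta>" using S[OF B] by linarith
      then obtain s where s: "s \<in> E" "norm (x + S B - s) \<le> \<theta> * norm (S B)" using \<delta>(2) by blast
      have "norm (x + S B - s) \<le> \<theta> * (N * norm h)"
        using s(2) mult_left_mono[OF S[OF B], of \<theta>] \<theta> by linarith
      then have "L * norm (x + S B - s) \<le> L * (\<theta> * (N * norm h))" using L0 by (rule mult_left_mono)
      also have "\<dots> = (L * (\<theta> * N)) * norm h" by simp
      also have "\<dots> \<le> \<epsilon> * norm h" using L\<theta> by (intro mult_right_mono) auto
      finally show ?thesis using s(1) by blast
    qed
    have "B \<subseteq> Basis \<longrightarrow> \<bar>f (x + S B) - f x - (\<Sum>b\<in>B. (h \<bullet> b) * c b)\<bar> \<le> real (card B) * (3 * \<epsilon> * norm h)" if "finite B" for B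
      using that
    proof (induction B rule: finite_induct)
      case empty
      then show ?case by (simp add: S_def)
    next
      case (insert b B)
      show ?case
      proof
        assume iB: "insert b B \<subseteq> Basis"
        let ?t = "h \<bullet> b"
        have Sb: "S (insert b B) = S B + ?t *\<^sub>R b" using insert.hyps by (simp add: S_def add.commute)
        have t: "\<bar>?t\<bar> \<le> norm h" "\<bar>?t\<bar> < \<tau>" using iB Basis_le_norm[of b h] h by auto
        have step: "\<bar>f (x + S B + ?t *\<^sub>R b) - f (x + S B) - ?t * c b\<bar> \<le> 3 * \<epsilon> * norm h"
        proof (cases "?t \<ge> 0")
          case True
          obtain s where s: "s \<in> E" "L * norm (x + S B - s) \<le> \<epsilon> * norm h" using near[of B] iB by blast
          have "\<bar>f (s + ?t *\<^sub>R b) - f s - ?t * c b\<bar> \<le> ?t * \<epsilon>" using E[OF s(1)] iB t True by simp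
          moreover have "?t * \<epsilon> \<le> \<epsilon> * norm h" using t pos True by (simp add: mult.commute)
          moreover have "\<bar>f (x + S B + ?t *\<^sub>R b) - f (s + ?t *\<^sub>R b)\<bar> \<le> L * norm (x + S B - s)"
            using L[of "x + S B + ?t *\<^sub>R b" "s + ?t *\<^sub>R b"] by simp
          moreover have "\<bar>f (x + S B) - f s\<bar> \<le> L * norm (x + S B - s)" by (rule L)
          ultimately show ?thesis using s(2) by linarith
        next
          case False
          \<comment> \<open>Only forward increments are controlled on \<open>E\<close>, so a
            negative step is traversed backwards, from a point of \<open>E\<close> near its
            endpoint.\<close>
          define t' where "t' = - ?t"
          have t': "0 \<le> t'" "t' < \<tau>" "t' \<le> norm h" using t False by (auto simp: t'_def)
          have e2: "x + S B - (s + t' *\<^sub>R b) = x + S (insert b B) - s" for s by (simp add: Sb t'_def)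
          obtain s where s: "s \<in> E" "L * norm (x + S (insert b B) - s) \<le> \<epsilon> * norm h" using near[OF iB] by blast
          have "\<bar>f (s + t' *\<^sub>R b) - f s - t' * c b\<bar> \<le> t' * \<epsilon>" using E[OF s(1) _ t'(1,2)] iB by simp
          moreover have "t' * \<epsilon> \<le> \<epsilon> * norm h" using mult_left_mono[OF t'(3), of \<epsilon>] pos by (simp add: mult.commute)
          moreover have "\<bar>f (x + S B) - f (s + t' *\<^sub>R b)\<bar> \<le> L * norm (x + S (insert b B) - s)"
            using L[of "x + S B" "s + t' *\<^sub>R b"] unfolding e2 .
          moreover have "\<bar>f (x + S (insert b B)) - f s\<bar> \<le> L * norm (x + S (insert b B) - s)" by (rule L)
          moreover have "x + S B + ?t *\<^sub>R b = x + S (insert b B)" by (simp add: Sb)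
          moreover have "?t * c b = - (t' * c b)" by (simp add: t'_def)
          ultimately show ?thesis using s(2) by (simp only:)
        qed
        have "(\<Sum>b\<in>insert b B. (h \<bullet> b) * c b) = (\<Sum>b\<in>B. (h \<bullet> b) * c b) + ?t * c b" using insert.hyps by simp
        moreover have "real (card (insert b B)) * (3 * \<epsilon> * norm h) = real (card B) * (3 * \<epsilon> * norm h) + 3 * \<epsilon> * norm h"
          using insert.hyps by (simp add: algebra_simps)
        moreover have "x + S (insert b B) = x + S B + ?t *\<^sub>R b" by (simp add: Sb)
        ultimately show "\<bar>f (x + S (insert b B)) - f x - (\<Sum>b\<in>insert b B. (h \<bullet> b) * c b)\<bar> \<le> real (card (insert b B)) * (3 * \<epsilon> * norm h)"
          using insert.IH iB step by (simp only: insert_subset simp_thms)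
      qed
    qed
    note bound = mp[OF this[OF finite_Basis] order_refl]
    have sb: "S Basis = h" by (simp add: S_def euclidean_representation)
    have ci: "(\<Sum>b\<in>Basis. c b *\<^sub>R b) \<bullet> h = (\<Sum>b\<in>Basis. (h \<bullet> b) * c b)"
      by (simp add: inner_sum_left mult.commute inner_commute[of h])
    show "\<bar>f (x + h) - f x - (\<Sum>b\<in>Basis. c b *\<^sub>R b) \<bullet> h\<bar> \<le> 3 * real DIM('a) * \<epsilon> * norm h"
      using bound unfolding sb ci by (simp only: mult_ac)
  qed
qed

text \<open>Difference quotients along the axes converge at a rate that depends on the point. The
  sets \<open>E c k n\<close> fix an approximate slope, an accuracy and a scale; there are countably
  many of them, so off a null set a point is nonporous in each one that contains it, and there the
  slopes along the axes combine to an approximate gradient.\<close>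

theorem Rademacher:
  fixes f :: "'a::euclidean_space \<Rightarrow> real"
  assumes L: "\<And>x y. \<bar>f x - f y\<bar> \<le> L * norm (x - y)"
  shows "negligible {x. \<not> f differentiable at x}"
proof -
  define E where "E c k n = {x. \<forall>b\<in>Basis. \<forall>t. 0 \<le> t \<and> t < inverse (real (Suc n)) \<longrightarrow>
      \<bar>f (x + t *\<^sub>R b) - f x - t * c b\<bar> \<le> t * inverse (real (Suc k))}" for c and k n :: nat
  \<comment> \<open>Extensional functions, with a fixed value off the basis; otherwise the slope
    vectors would be uncountably many.\<close>
  define Q where "Q = (Basis \<rightarrow>\<^sub>E \<rat> :: ('a \<Rightarrow> real) set)"
  have "countable Q" unfolding Q_def by (intro countable_PiE) (auto simp: countable_rat)
  define B where "B b = {x. \<not> (\<forall>k::nat. \<exists>q\<in>\<rat>. \<exists>n::nat. \<forall>t. 0 \<le> t \<and> t < inverse (Suc n) \<longrightarrow>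
      \<bar>f (x + t *\<^sub>R b) - f x - t * q\<bar> \<le> t * inverse (Suc k))}" for b
  define Bad where "Bad = (\<Union>b\<in>Basis. B b) \<union> (\<Union>c\<in>Q. \<Union>k. \<Union>n. {x \<in> E c k n. \<not> nonporous_at (E c k n) x})"
  have "negligible (\<Union>b\<in>Basis. B b)"
    unfolding B_def by (intro negligible_Union finite_imageI finite_Basis) (auto intro: Lipschitz_line_derivative_ae[OF L, simplified])
  moreover have "negligible (\<Union>c\<in>Q. \<Union>k. \<Union>n. {x \<in> E c k n. \<not> nonporous_at (E c k n) x})"
    using \<open>countable Q\<close> negligible_porous_points by (intro negligible_countable_Union countable_image; clarsimp)+
  ultimately have "negligible Bad" by (simp add: Bad_def)
  moreover have "f differentiable at x" if x: "x \<notin> Bad" for x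
  proof (rule differentiable_at_if_approx_affine)
    fix e :: real assume "e > 0"
    define N where "N = real DIM('a)"
    have N: "N > 0" by (simp add: N_def)
    obtain k where k: "inverse (real (Suc k)) < e / (3 * N)"
      using reals_Archimedean[of "e / (3 * N)"] \<open>e > 0\<close> N by auto
    have "\<forall>b\<in>Basis. \<exists>q\<in>\<rat>. \<exists>n::nat. \<forall>t. 0 \<le> t \<and> t < inverse (Suc n) \<longrightarrow>
      \<bar>f (x + t *\<^sub>R b) - f x - t * q\<bar> \<le> t * inverse (Suc k)"
    proof
      fix b :: 'a assume "b \<in> Basis"
      then have "x \<notin> B b" using x unfolding Bad_def by blast
      then show "\<exists>q\<in>\<rat>. \<exists>n::nat. \<forall>t. 0 \<le> t \<and> t < inverse (Suc n) \<longrightarrow>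
        \<bar>f (x + t *\<^sub>R b) - f x - t * q\<bar> \<le> t * inverse (Suc k)"
        unfolding B_def by blast
    qed
    then obtain q n where q: "\<And>b. b \<in> Basis \<Longrightarrow> q b \<in> \<rat>"
      "\<And>b t. b \<in> Basis \<Longrightarrow> 0 \<le> t \<Longrightarrow> t < inverse (real (Suc (n b))) \<Longrightarrow>
        \<bar>f (x + t *\<^sub>R b) - f x - t * q b\<bar> \<le> t * inverse (real (Suc k))"
      by metis
    define c where "c = restrict q Basis"
    \<comment> \<open>One scale that serves all axes.\<close>
    define m where "m = Max (n ` Basis)"
    have c: "c \<in> Q" using q(1) by (auto simp: c_def Q_def)
    have "x \<in> E c k m"
    proof -
      have "inverse (real (Suc m)) \<le> inverse (real (Suc (n b)))" if "b \<in> Basis" for b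
        using that by (intro le_imp_inverse_le) (auto simp: m_def)
      then have "\<bar>f (x + t *\<^sub>R b) - f x - t * c b\<bar> \<le> t * inverse (real (Suc k))"
        if "b \<in> Basis" "0 \<le> t" "t < inverse (real (Suc m))" for b t
        using q(2)[OF that(1,2)] that less_le_trans by (simp only: c_def restrict_apply' ) blast
      then show ?thesis unfolding E_def by blast
    qed
    then have "nonporous_at (E c k m) x" using x c by (auto simp: Bad_def)
    then have "\<exists>\<delta>>0. \<forall>h. norm h < \<delta> \<longrightarrow> \<bar>f (x + h) - f x - (\<Sum>b\<in>Basis. c b *\<^sub>R b) \<bullet> h\<bar> \<le> 3 * real DIM('a) * inverse (real (Suc k)) * norm h"
      by (intro approx_affine_at_nonporous[OF L, where \<tau> = "inverse (real (Suc m))"]) (auto simp: E_def)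
    moreover have "3 * real DIM('a) * inverse (real (Suc k)) * norm h \<le> e * norm h" for h :: 'a
      using k N by (intro mult_right_mono) (simp_all add: N_def field_simps)
    ultimately show "\<exists>r. \<exists>\<delta>>0. \<forall>h. norm h < \<delta> \<longrightarrow> \<bar>f (x + h) - f x - r \<bullet> h\<bar> \<le> e * norm h"
      by (meson order_trans)
  qed
  ultimately show ?thesis by (rule_tac negligible_subset[of Bad]) auto
qed

section \<open>Second order expansions of semiconvex functions\<close>

text \<open>McShane's formula. It carries each component of the slope from the contact set to the
  whole space, where Rademacher's theorem applies.\<close>

lemma Lipschitz_real_extension:
  fixes f :: "'a::real_normed_vector \<Rightarrow> real"
  assumes Z: "Z \<noteq> {}" and L: "L \<ge> 0" and f: "\<And>x y. x \<in> Z \<Longrightarrow> y \<in> Z \<Longrightarrow> \<bar>f x - f y\<bar> \<le> L * norm (x - y)"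
  obtains g where "\<And>x. x \<in> Z \<Longrightarrow> g x = f x" "\<And>x y. \<bar>g x - g y\<bar> \<le> L * norm (x - y)"
proof -
  define g where "g x = (INF z\<in>Z. f z + L * norm (x - z))" for x
  obtain z0 where z0: "z0 \<in> Z" using Z by blast
  have bdd: "bdd_below ((\<lambda>z. f z + L * norm (x - z)) ` Z)" for x
  proof (rule bdd_belowI2)
    fix z assume z: "z \<in> Z"
    have "norm (z0 - z) \<le> norm (x - z) + norm (x - z0)"
      using norm_triangle_ineq4[of "x - z" "x - z0"] by simp
    then have "L * norm (z0 - z) \<le> L * norm (x - z) + L * norm (x - z0)"
      using L mult_left_mono[of "norm (z0 - z)" "norm (x - z) + norm (x - z0)" L] by (simp add: distrib_left)
    then show "f z0 - L * norm (x - z0) \<le> f z + L * norm (x - z)" using f[OF z0 z] by linarith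
  qed
  have le: "g x \<le> f z + L * norm (x - z)" if "z \<in> Z" for x z
    unfolding g_def using bdd that by (rule cINF_lower)
  have lip: "g x \<le> g y + L * norm (x - y)" for x y
  proof -
    have "g x - L * norm (x - y) \<le> g y"
      unfolding g_def[of y]
    proof (rule cINF_greatest[OF Z])
      fix z assume z: "z \<in> Z"
      have "norm (x - z) \<le> norm (y - z) + norm (x - y)"
        using norm_triangle_ineq[of "x - y" "y - z"] by simp
      then have "L * norm (x - z) \<le> L * norm (y - z) + L * norm (x - y)"
        using L mult_left_mono[of "norm (x - z)" "norm (y - z) + norm (x - y)" L] by (simp add: distrib_left)
      then show "g x - L * norm (x - y) \<le> f z + L * norm (y - z)" using le[OF z, of x] by linarith
    qed
    then show ?thesis by simp
  qed
  show thesis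
  proof
    fix x assume x: "x \<in> Z"
    have "f x \<le> g x" unfolding g_def
    proof (rule cINF_greatest[OF Z])
      fix z assume "z \<in> Z"
      then show "f x \<le> f z + L * norm (x - z)" using f[OF x, of z] by linarith
    qed
    then show "g x = f x" using le[OF x, of x] by simp
  next
    fix x y show "\<bar>g x - g y\<bar> \<le> L * norm (x - y)"
      using lip[of x y] lip[of y x] by (simp add: norm_minus_commute abs_le_iff)
  qed
qed

text \<open>The sum of \<open>real i / (real k)\<^sup>2\<close> over \<open>i < k\<close> is 1/2 -
  1/(2k): the integral of a linear slope, up to the defect of a left Riemann sum with
  \<open>k\<close> nodes.\<close>

lemma telescoping_quadratic_bound:
  fixes a :: "nat \<Rightarrow> real"
  assumes k: "k > 0" and step: "\<And>i. i < k \<Longrightarrow> a (Suc i) - a i \<le> p / real k + q * (real i / (real k)\<^sup>2) + c"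
  shows "a k - a 0 \<le> p + q * (1/2 - 1 / (2 * real k)) + real k * c"
proof -
  have "i \<le> k \<longrightarrow> a i - a 0 \<le> real i * (p / real k) + q * (real i * (real i - 1) / (2 * (real k)\<^sup>2)) + real i * c" for i
  proof (induction i)
    case (Suc i)
    show ?case
    proof
      assume "Suc i \<le> k"
      then have "a i - a 0 \<le> real i * (p / real k) + q * (real i * (real i - 1) / (2 * (real k)\<^sup>2)) + real i * c"
        and "a (Suc i) - a i \<le> p / real k + q * (real i / (real k)\<^sup>2) + c" using Suc step by auto
      moreover have "q * (real (Suc i) * (real (Suc i) - 1) / (2 * (real k)\<^sup>2)) = q * (real i * (real i - 1) / (2 * (real k)\<^sup>2)) + q * (real i / (real k)\<^sup>2)"
        using k by (simp add: field_simps)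
      moreover have "real (Suc i) * (p / real k) = real i * (p / real k) + p / real k" "real (Suc i) * c = real i * c + c"
        by (simp_all add: distrib_right add_divide_distrib)
      ultimately show "a (Suc i) - a 0 \<le> real (Suc i) * (p / real k) + q * (real (Suc i) * (real (Suc i) - 1) / (2 * (real k)\<^sup>2)) + real (Suc i) * c"
        by linarith
    qed
  qed simp
  from this[of k] have *: "a k - a 0 \<le> real k * (p / real k) + q * (real k * (real k - 1) / (2 * (real k)\<^sup>2)) + real k * c" by simp
  have "real k * (real k - 1) / (2 * (real k)\<^sup>2) = 1/2 - 1 / (2 * real k)" "real k * (p / real k) = p"
    using k by (simp_all add: field_simps power2_eq_square)
  with * show ?thesis by (simp only:)
qed

text \<open>Move from \<open>z\<close> by \<open>l - p\<close> divided by \<kappa>: the linear gain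
  of the lower paraboloid over the plane is \<bar>l - p\<bar>^2 / \<kappa>, and the quadratic term
  takes back only half of it.\<close>

lemma touching_slope_unique:
  fixes p l :: "'a::real_inner"
  assumes lam: "\<kappa> > 0"
    and below: "\<And>z'. w z' \<ge> w z + l \<bullet> (z' - z) - \<kappa> / 2 * (norm (z' - z))\<^sup>2"
    and above: "\<And>z'. w z' \<le> w z + p \<bullet> (z' - z)"
  shows "l = p"
proof -
  define d where "d = l - p"
  have "l \<bullet> ((1/\<kappa>) *\<^sub>R d) - \<kappa> / 2 * (norm ((1/\<kappa>) *\<^sub>R d))\<^sup>2 \<le> p \<bullet> ((1/\<kappa>) *\<^sub>R d)"
    using below[of "z + (1/\<kappa>) *\<^sub>R d"] above[of "z + (1/\<kappa>) *\<^sub>R d"] by simp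
  moreover have "l \<bullet> ((1/\<kappa>) *\<^sub>R d) - p \<bullet> ((1/\<kappa>) *\<^sub>R d) = (norm d)\<^sup>2 / \<kappa>"
    by (simp add: d_def power2_norm_eq_inner flip: inner_diff_left diff_divide_distrib)
  moreover have "\<kappa> / 2 * (norm ((1/\<kappa>) *\<^sub>R d))\<^sup>2 = (norm d)\<^sup>2 / (2 * \<kappa>)"
    using lam by (simp add: power_mult_distrib power_divide power2_eq_square)
  ultimately have "(norm d)\<^sup>2 / \<kappa> \<le> (norm d)\<^sup>2 / (2 * \<kappa>)" by linarith
  then have "norm d = 0" using lam by (simp add: field_simps)
  then show ?thesis by (simp add: d_def)
qed

text \<open>The analogous displacement, \<open>p1 - p2\<close> divided by \<kappa> from
  \<open>z1\<close>, is compared with the plane at \<open>z2\<close>, while the plane at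
  \<open>z1\<close> bounds \<open>w z2\<close>. The slope is thus Lipschitz on the contact set
  although \<open>w\<close> may fail to be differentiable around it.\<close>

lemma touching_slope_Lipschitz:
  fixes p1 p2 :: "'a::real_inner"
  assumes lam: "\<kappa> > 0"
    and below: "\<And>z'. w z' \<ge> w z1 + p1 \<bullet> (z' - z1) - \<kappa> / 2 * (norm (z' - z1))\<^sup>2"
    and above1: "\<And>z'. w z' \<le> w z1 + p1 \<bullet> (z' - z1)"
    and above2: "\<And>z'. w z' \<le> w z2 + p2 \<bullet> (z' - z2)"
  shows "norm (p1 - p2) \<le> 2 * \<kappa> * norm (z1 - z2)"
proof -
  define d where "d = p1 - p2"
  let ?z = "z1 + (1/\<kappa>) *\<^sub>R d"
  have "w z1 + p1 \<bullet> ((1/\<kappa>) *\<^sub>R d) - \<kappa> / 2 * (norm ((1/\<kappa>) *\<^sub>R d))\<^sup>2 \<le> w z2 + p2 \<bullet> (?z - z2)"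
    using below[of ?z] above2[of ?z] by simp
  moreover have "w z2 \<le> w z1 + p1 \<bullet> (z2 - z1)" by (rule above1)
  ultimately have "(p1 - p2) \<bullet> ((1/\<kappa>) *\<^sub>R d) - \<kappa> / 2 * (norm ((1/\<kappa>) *\<^sub>R d))\<^sup>2 \<le> (p1 - p2) \<bullet> (z2 - z1)"
    by (simp add: inner_diff_left inner_diff_right inner_add_right algebra_simps diff_divide_distrib)
  moreover have "(p1 - p2) \<bullet> ((1/\<kappa>) *\<^sub>R d) = (norm d)\<^sup>2 / \<kappa>"
    by (simp add: d_def power2_norm_eq_inner)
  moreover have "\<kappa> / 2 * (norm ((1/\<kappa>) *\<^sub>R d))\<^sup>2 = (norm d)\<^sup>2 / \<kappa> / 2"
    using lam by (simp add: power_mult_distrib power_divide power2_eq_square)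
  moreover have "(p1 - p2) \<bullet> (z2 - z1) \<le> norm d * norm (z1 - z2)"
    using norm_cauchy_schwarz[of d "z2 - z1"] by (simp add: d_def norm_minus_commute)
  ultimately have "(norm d)\<^sup>2 / \<kappa> / 2 \<le> norm d * norm (z1 - z2)" by linarith
  then have "norm d * norm d \<le> norm d * (2 * \<kappa> * norm (z1 - z2))"
    using lam by (simp add: field_simps power2_eq_square)
  then show ?thesis using lam by (cases "norm d = 0") (auto simp: d_def)
qed

text \<open>Only the quadratic form of \<open>A\<close> enters, hence only its symmetric part, which
  is extracted in \<open>symmetric_matrix_of_form\<close>.\<close>

definition second_order_at :: "('a::real_inner \<Rightarrow> real) \<Rightarrow> 'a \<Rightarrow> 'a \<Rightarrow> ('a \<Rightarrow> 'a) \<Rightarrow> bool" where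
  "second_order_at f z p A \<longleftrightarrow>
     (\<forall>e>0. \<exists>d>0. \<forall>h. norm h < d \<longrightarrow> \<bar>f (z + h) - f z - p \<bullet> h - A h \<bullet> h / 2\<bar> \<le> e * (norm h)\<^sup>2)"

text \<open>The slope is known only on \<open>Z\<close>, so \<open>w\<close> cannot be recovered by
  integrating a gradient. Instead the segment from \<open>z\<close> to \<open>z + h\<close> is cut
  into \<open>k\<close> pieces. Near each node a contact point \<open>\<zeta>\<close> supplies a
  plane above and a paraboloid below, which bound the increment by means of
  \<open>P \<zeta>\<close>. Running forward gives the upper bound, running backward the lower
  one.\<close>

lemma second_order_expansion_of_contact:
  fixes w :: "'a::euclidean_space \<Rightarrow> real"
  assumes lam: "\<kappa> > 0"
    and above: "\<And>\<zeta> z'. \<zeta> \<in> Z \<Longrightarrow> w z' \<le> w \<zeta> + P \<zeta> \<bullet> (z' - \<zeta>)"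
    and below: "\<And>\<zeta> z'. \<zeta> \<in> Z \<Longrightarrow> w z' \<ge> w \<zeta> + P \<zeta> \<bullet> (z' - \<zeta>) - \<kappa> / 2 * (norm (z' - \<zeta>))\<^sup>2"
    and z: "z \<in> Z" "nonporous_at Z z"
    and A: "bounded_linear A"
    and deriv: "\<And>e. e > 0 \<Longrightarrow> \<exists>d>0. \<forall>\<zeta>\<in>Z. norm (\<zeta> - z) < d \<longrightarrow> norm (P \<zeta> - P z - A (\<zeta> - z)) \<le> e * norm (\<zeta> - z)"
  shows "second_order_at w z (P z) A"
  unfolding second_order_at_def
proof (intro allI impI)
  fix e :: real assume e: "e > 0"
  interpret A: bounded_linear A by fact
  obtain a where a: "a > 0" "\<And>h. norm (A h) \<le> norm h * a" using A.pos_bounded by blast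
  \<comment> \<open>The total error has three parts of size \<open>e / 3\<close>: the Riemann sum
    defect, which fixes \<open>k\<close>; the slopes at the nodes; and \<open>k\<close> contact
    errors, which fix \<open>\<theta>\<close> once \<open>k\<close> is known.\<close>
  obtain k :: nat where k: "k \<ge> 1" "3 * a / (2 * e) \<le> k"
  proof -
    obtain n :: nat where "3 * a / (2 * e) \<le> n" using real_arch_simple by blast
    then show thesis using that[of "Suc n"] by simp
  qed
  have k1: "a / (2 * k) \<le> e / 3" using k e by (simp add: field_simps)
  define \<theta> where "\<theta> = min 1 (e / (6 * (a + k * \<kappa>)))"
  have pos: "a + k * \<kappa> > 0" using a k lam by (simp add: add_pos_nonneg)
  have \<theta>: "0 < \<theta>" "\<theta> \<le> 1" using e pos by (auto simp: \<theta>_def)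
  have "\<theta> * (a + k * \<kappa>) \<le> e / 6"
  proof -
    have "\<theta> \<le> e / (6 * (a + k * \<kappa>))" by (simp add: \<theta>_def)
    then show ?thesis using pos by (simp add: field_simps)
  qed
  moreover have "\<theta> * (k * \<kappa>) \<ge> 0" "a * \<theta> \<ge> 0" using \<theta> lam a by auto
  ultimately have \<theta>a: "a * \<theta> \<le> e / 6" and \<theta>k: "k * \<kappa> * \<theta> \<le> e / 6" by (auto simp: algebra_simps)
  have \<theta>2: "k * (\<kappa> / 2 * \<theta>\<^sup>2) \<le> e / 3"
  proof -
    have "\<theta>\<^sup>2 \<le> \<theta>" using \<theta> by (simp add: power2_eq_square mult_left_le)
    then have "(k * \<kappa>) * \<theta>\<^sup>2 \<le> (k * \<kappa>) * \<theta>" using lam by (intro mult_left_mono) auto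
    then show ?thesis using \<theta>k e by (simp add: mult.assoc)
  qed
  obtain d1 where d1: "d1 > 0" "\<And>h. norm h < d1 \<Longrightarrow> \<exists>s\<in>Z. norm (z + h - s) \<le> \<theta> * norm h"
    using z(2) \<theta> unfolding nonporous_at_def by blast
  \<comment> \<open>\<open>e / 12\<close> because \<open>\<zeta>\<close> may be as far as
    \<open>2 * H\<close> from \<open>z\<close>; the resulting \<open>e / 6\<close> and another
    \<open>e / 6\<close> for moving \<open>\<zeta>\<close> to the node make
    \<open>e / 3\<close>.\<close>
  obtain d2 where d2: "d2 > 0" "\<And>\<zeta>. \<zeta> \<in> Z \<Longrightarrow> norm (\<zeta> - z) < d2 \<Longrightarrow>
      norm (P \<zeta> - P z - A (\<zeta> - z)) \<le> e / 12 * norm (\<zeta> - z)"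
    using deriv[of "e/12"] e by auto
  show "\<exists>d>0. \<forall>h. norm h < d \<longrightarrow> \<bar>w (z + h) - w z - P z \<bullet> h - A h \<bullet> h / 2\<bar> \<le> e * (norm h)\<^sup>2"
  proof (intro exI conjI allI impI)
    show "min d1 (d2 / 2) > 0" using d1 d2 by simp
    fix h :: 'a assume h: "norm h < min d1 (d2 / 2)"
    define H where "H = norm h"
    have H0: "H \<ge> 0" by (simp add: H_def)
    \<comment> \<open>The contact point is taken near the node \<open>s\<close>; \<open>t\<close>
      may lie on either side of \<open>s\<close>, for the forward and the backward bound.\<close>
    have main: "w (z + t *\<^sub>R h) - w (z + s *\<^sub>R h) \<le> (t - s) * (P z \<bullet> h + s * (A h \<bullet> h)) + \<bar>t - s\<bar> * (e / 3 * H\<^sup>2) + \<kappa> / 2 * \<theta>\<^sup>2 * H\<^sup>2"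
      if s: "0 \<le> s" "s \<le> 1" for s t
    proof -
      have sh: "norm (s *\<^sub>R h) \<le> H" using s by (simp add: H_def mult_left_le_one_le)
      then have "norm (s *\<^sub>R h) < d1" using h by (simp add: H_def)
      then obtain \<zeta> where \<zeta>: "\<zeta> \<in> Z" "norm (z + s *\<^sub>R h - \<zeta>) \<le> \<theta> * norm (s *\<^sub>R h)" using d1(2) by blast
      have \<zeta>1: "norm (z + s *\<^sub>R h - \<zeta>) \<le> \<theta> * H"
        using \<zeta>(2) mult_left_mono[OF sh, of \<theta>] \<theta> by linarith
      have \<zeta>2: "norm (\<zeta> - z) \<le> 2 * H"
      proof -
        have "norm (\<zeta> - z) \<le> norm (s *\<^sub>R h) + norm (z + s *\<^sub>R h - \<zeta>)"
          using norm_triangle_ineq4[of "s *\<^sub>R h" "z + s *\<^sub>R h - \<zeta>"] by simp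
        also have "\<dots> \<le> H + 1 * H" using sh \<zeta>1 mult_right_mono[OF \<theta>(2) H0] by linarith
        finally show ?thesis by simp
      qed
      have "norm (P \<zeta> - P z - A (\<zeta> - z)) \<le> e / 12 * norm (\<zeta> - z)"
        using d2(2)[OF \<zeta>(1)] \<zeta>2 h by (simp add: H_def)
      also have "\<dots> \<le> e / 12 * (2 * H)" using \<zeta>2 e by (intro mult_left_mono) auto
      finally have P1: "norm (P \<zeta> - P z - A (\<zeta> - z)) \<le> e / 6 * H" by (simp add: mult_ac)
      have "norm (A (\<zeta> - z - s *\<^sub>R h)) \<le> norm (\<zeta> - z - s *\<^sub>R h) * a" by (rule a)
      also have "\<dots> \<le> (\<theta> * H) * a" using \<zeta>1 a(1)
        by (intro mult_right_mono) (simp_all add: norm_minus_commute algebra_simps)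
      also have "\<dots> = (a * \<theta>) * H" by simp
      also have "\<dots> \<le> e / 6 * H" using \<theta>a H0 by (rule mult_right_mono)
      finally have P2: "norm (A (\<zeta> - z - s *\<^sub>R h)) \<le> e / 6 * H" .
      have eq: "P \<zeta> - P z - s *\<^sub>R A h = (P \<zeta> - P z - A (\<zeta> - z)) + A (\<zeta> - z - s *\<^sub>R h)"
        by (simp add: A.diff A.scaleR)
      have P3: "norm (P \<zeta> - P z - s *\<^sub>R A h) \<le> e / 3 * H"
        using norm_triangle_ineq[of "P \<zeta> - P z - A (\<zeta> - z)" "A (\<zeta> - z - s *\<^sub>R h)"] P1 P2 unfolding eq by linarith
      have "(t - s) * (P \<zeta> \<bullet> h) = (t - s) * (P z \<bullet> h + s * (A h \<bullet> h)) + (t - s) * ((P \<zeta> - P z - s *\<^sub>R A h) \<bullet> h)"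
        by (simp add: inner_diff_left algebra_simps)
      also have "(t - s) * ((P \<zeta> - P z - s *\<^sub>R A h) \<bullet> h) \<le> \<bar>t - s\<bar> * (e / 3 * H\<^sup>2)"
      proof -
        have "\<bar>(P \<zeta> - P z - s *\<^sub>R A h) \<bullet> h\<bar> \<le> norm (P \<zeta> - P z - s *\<^sub>R A h) * H"
          unfolding H_def by (rule Cauchy_Schwarz_ineq2)
        also have "\<dots> \<le> e / 3 * H * H" using P3 H0 by (rule mult_right_mono)
        finally have "\<bar>t - s\<bar> * \<bar>(P \<zeta> - P z - s *\<^sub>R A h) \<bullet> h\<bar> \<le> \<bar>t - s\<bar> * (e / 3 * H * H)"
          by (intro mult_left_mono) auto
        then show ?thesis by (simp add: power2_eq_square mult.assoc flip: abs_mult) 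
      qed
      finally have 1: "(t - s) * (P \<zeta> \<bullet> h) \<le> (t - s) * (P z \<bullet> h + s * (A h \<bullet> h)) + \<bar>t - s\<bar> * (e / 3 * H\<^sup>2)" by simp
      have "w (z + t *\<^sub>R h) \<le> w \<zeta> + P \<zeta> \<bullet> (z + t *\<^sub>R h - \<zeta>)" by (rule above[OF \<zeta>(1)])
      moreover have "w (z + s *\<^sub>R h) \<ge> w \<zeta> + P \<zeta> \<bullet> (z + s *\<^sub>R h - \<zeta>) - \<kappa> / 2 * (norm (z + s *\<^sub>R h - \<zeta>))\<^sup>2"
        by (rule below[OF \<zeta>(1)])
      moreover have "\<kappa> / 2 * (norm (z + s *\<^sub>R h - \<zeta>))\<^sup>2 \<le> \<kappa> / 2 * (\<theta> * H)\<^sup>2"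
        using \<zeta>1 lam by (intro mult_left_mono power_mono) auto
      moreover have "P \<zeta> \<bullet> (z + t *\<^sub>R h - \<zeta>) - P \<zeta> \<bullet> (z + s *\<^sub>R h - \<zeta>) = (t - s) * (P \<zeta> \<bullet> h)"
        by (simp add: inner_diff_right inner_add_right algebra_simps)
      ultimately have "w (z + t *\<^sub>R h) - w (z + s *\<^sub>R h) \<le> (t - s) * (P \<zeta> \<bullet> h) + \<kappa> / 2 * (\<theta> * H)\<^sup>2" by linarith
      then show ?thesis using 1 by (simp add: power_mult_distrib)
    qed
    define q where "q = A h \<bullet> h"
    define c where "c = 1 / k * (e / 3 * H\<^sup>2) + \<kappa> / 2 * \<theta>\<^sup>2 * H\<^sup>2"
    define u where "u i = w (z + (real i / k) *\<^sub>R h)" for i :: nat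
    have u0k: "u 0 = w z" "u k = w (z + h)" using k by (auto simp: u_def)
    have diff: "(real (Suc i)) / k - i / k = 1 / k" for i by (simp add: add_divide_distrib)
    have "u (Suc i) - u i \<le> (P z \<bullet> h) / real k + q * (real i / (real k)\<^sup>2) + c" if "i < k" for i
    proof -
      have "u (Suc i) - u i \<le> (1 / k) * (P z \<bullet> h + (i / k) * q) + \<bar>1 / k\<bar> * (e / 3 * H\<^sup>2) + \<kappa> / 2 * \<theta>\<^sup>2 * H\<^sup>2"
        using main[of "i / k" "Suc i / k"] that unfolding diff u_def q_def by simp
      moreover have "(1 / k) * (P z \<bullet> h + (i / k) * q) = (P z \<bullet> h) / real k + q * (real i / (real k)\<^sup>2)"
        using k by (simp add: field_simps power2_eq_square)
      ultimately show ?thesis by (simp add: c_def)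
    qed
    then have up: "u k - u 0 \<le> P z \<bullet> h + q * (1/2 - 1 / (2 * real k)) + real k * c"
      using k by (intro telescoping_quadratic_bound[of k u]) auto
    have diff': "i / k - (real (Suc i)) / k = - (1 / k)" for i by (simp add: add_divide_distrib)
    \<comment> \<open>A backward step uses the slope at the right node \<open>Suc i\<close>; the
      shift of the index by one is absorbed in the constant term \<open>- q / k\<close>.\<close>
    have "- u (Suc i) - (- u i) \<le> (- (P z \<bullet> h) - q / k) / real k + (- q) * (real i / (real k)\<^sup>2) + c" if "i < k" for i
    proof -
      have "u i - u (Suc i) \<le> (- (1 / k)) * (P z \<bullet> h + (Suc i / k) * q) + \<bar>- (1 / k)\<bar> * (e / 3 * H\<^sup>2) + \<kappa> / 2 * \<theta>\<^sup>2 * H\<^sup>2"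
        using main[of "Suc i / k" "i / k"] that unfolding diff' u_def q_def by simp
      moreover have "(- (1 / k)) * (P z \<bullet> h + (Suc i / k) * q) = (- (P z \<bullet> h) - q / k) / real k + (- q) * (real i / (real k)\<^sup>2)"
        using k by (simp add: field_simps power2_eq_square)
      ultimately show ?thesis by (simp add: c_def)
    qed
    then have "- u k - (- u 0) \<le> (- (P z \<bullet> h) - q / k) + (- q) * (1/2 - 1 / (2 * real k)) + real k * c"
      using k by (intro telescoping_quadratic_bound[of k "\<lambda>i. - u i"]) auto
    moreover have "(- (P z \<bullet> h) - q / k) + (- q) * (1/2 - 1 / (2 * real k)) = - (P z \<bullet> h) - q / 2 - q / (2 * k)"
      using k by (simp add: field_simps)
    ultimately have down: "u 0 - u k \<le> - (P z \<bullet> h) - q / 2 - q / (2 * k) + k * c" by linarith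
    have kc: "k * c \<le> e / 3 * H\<^sup>2 + e / 3 * H\<^sup>2"
    proof -
      have "k * c = e / 3 * H\<^sup>2 + (k * (\<kappa> / 2 * \<theta>\<^sup>2)) * H\<^sup>2" using k by (simp add: c_def field_simps)
      also have "\<dots> \<le> e / 3 * H\<^sup>2 + e / 3 * H\<^sup>2" using \<theta>2 by (intro add_left_mono mult_right_mono) auto
      finally show ?thesis .
    qed
    have qk: "\<bar>q / (2 * k)\<bar> \<le> e / 3 * H\<^sup>2"
    proof -
      have "\<bar>q\<bar> \<le> norm (A h) * H" unfolding q_def H_def by (rule Cauchy_Schwarz_ineq2)
      also have "\<dots> \<le> H * a * H" using a(2)[of h] H0 by (intro mult_right_mono) (auto simp: H_def)
      finally have "\<bar>q\<bar> / (2 * k) \<le> (H * a * H) / (2 * k)" by (intro divide_right_mono) auto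
      also have "\<dots> = (a / (2 * k)) * H\<^sup>2" by (simp add: power2_eq_square)
      also have "\<dots> \<le> e / 3 * H\<^sup>2" using k1 by (intro mult_right_mono) auto
      finally show ?thesis by (simp add: abs_divide)
    qed
    have "q * (1/2 - 1 / (2 * k)) = q / 2 - q / (2 * k)" by (simp add: right_diff_distrib)
    then have "\<bar>u k - u 0 - P z \<bullet> h - q / 2\<bar> \<le> e / 3 * H\<^sup>2 + (e / 3 * H\<^sup>2 + e / 3 * H\<^sup>2)"
      using up down kc qk unfolding abs_le_iff of_nat_mult of_nat_numeral by linarith
    then show "\<bar>w (z + h) - w z - P z \<bullet> h - A h \<bullet> h / 2\<bar> \<le> e * (norm h)\<^sup>2"
      by (simp add: u0k q_def H_def)
  qed
qed

text \<open>Jensen's lemma and Alexandrov's theorem in one: the expansion is obtained at a point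
  where \<open>w\<close> minus a linear function of slope at most \<open>r\<close> is maximal. The
  assumption \<open>attained\<close> makes the slope map onto the ball of radius
  \<open>r\<close>.\<close>

theorem Jensen_Alexandrov:
  fixes w :: "'a::euclidean_space \<Rightarrow> real"
  assumes lam: "\<kappa> > 0" and r: "r > 0"
    and semiconvex: "\<And>z. \<exists>l. \<forall>z'. w z' \<ge> w z + l \<bullet> (z' - z) - \<kappa> / 2 * (norm (z' - z))\<^sup>2"
    and attained: "\<And>p. norm p \<le> r \<Longrightarrow> \<exists>z. \<forall>z'. w z' \<le> w z + p \<bullet> (z' - z)"
  obtains z p A where "norm p \<le> r" "\<And>z'. w z' \<le> w z + p \<bullet> (z' - z)" "bounded_linear A" "second_order_at w z p A"
proof -
  define Z where "Z = {z. \<exists>p. norm p \<le> r \<and> (\<forall>z'. w z' \<le> w z + p \<bullet> (z' - z))}"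
  define P where "P z = (SOME p. norm p \<le> r \<and> (\<forall>z'. w z' \<le> w z + p \<bullet> (z' - z)))" for z
  have P: "norm (P z) \<le> r" "w z' \<le> w z + P z \<bullet> (z' - z)" if "z \<in> Z" for z z'
  proof -
    have "norm (P z) \<le> r \<and> (\<forall>z'. w z' \<le> w z + P z \<bullet> (z' - z))"
      unfolding P_def by (rule someI_ex) (use that in \<open>simp add: Z_def\<close>)
    then show "norm (P z) \<le> r" "w z' \<le> w z + P z \<bullet> (z' - z)" by auto
  qed
  have below: "w z' \<ge> w z + p \<bullet> (z' - z) - \<kappa> / 2 * (norm (z' - z))\<^sup>2" if "\<And>z'. w z' \<le> w z + p \<bullet> (z' - z)" for z z' p
  proof -
    obtain l where l: "\<And>z'. w z' \<ge> w z + l \<bullet> (z' - z) - \<kappa> / 2 * (norm (z' - z))\<^sup>2" using semiconvex by blast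
    have "l = p" using lam l that by (rule touching_slope_unique)
    then show ?thesis using l by simp
  qed
  have lip: "norm (P z1 - P z2) \<le> 2 * \<kappa> * norm (z1 - z2)" if "z1 \<in> Z" "z2 \<in> Z" for z1 z2
    using lam below[OF P(2)[OF that(1)]] P(2)[OF that(1)] P(2)[OF that(2)] by (rule touching_slope_Lipschitz)
  have "cball 0 r \<subseteq> P ` Z"
  proof
    fix p :: 'a assume "p \<in> cball 0 r"
    then have p: "norm p \<le> r" by simp
    then obtain z where z: "\<And>z'. w z' \<le> w z + p \<bullet> (z' - z)" using attained by blast
    then have "z \<in> Z" using p by (auto simp: Z_def)
    \<comment> \<open>Semiconvexity leaves only one slope at a contact point, so the choice made in
      \<open>P\<close> is forced.\<close>
    moreover have "p = P z" using lam below[OF z] P(2)[OF \<open>z \<in> Z\<close>] by (rule touching_slope_unique)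
    ultimately show "p \<in> P ` Z" by blast
  qed
  have "\<not> negligible Z"
  proof
    assume "negligible Z"
    then have "negligible (P ` Z)"
    proof (rule negligible_locally_Lipschitz_image[rotated])
      fix x assume "x \<in> Z"
      then show "\<exists>T B. open T \<and> x \<in> T \<and> (\<forall>y\<in>Z \<inter> T. norm (P y - P x) \<le> B * norm (y - x))"
        using lip by (intro exI[of _ UNIV] exI[of _ "2 * \<kappa>"]) auto
    qed simp
    then have "negligible (ball (0::'a) r)" using \<open>cball 0 r \<subseteq> P ` Z\<close> by (meson ball_subset_cball negligible_subset order_trans)
    then show False using r by (simp add: open_not_negligible)
  qed
  then have "Z \<noteq> {}" by auto
  have "\<exists>g. (\<forall>x\<in>Z. g x = P x \<bullet> b) \<and> (\<forall>x y. \<bar>g x - g y\<bar> \<le> (2 * \<kappa> * norm b) * norm (x - y))" for b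
  proof -
    have "\<bar>P x \<bullet> b - P y \<bullet> b\<bar> \<le> (2 * \<kappa> * norm b) * norm (x - y)" if "x \<in> Z" "y \<in> Z" for x y
      using Cauchy_Schwarz_ineq2[of "P x - P y" b] mult_right_mono[OF lip[OF that], of "norm b"]
      by (simp add: inner_diff_left mult_ac)
    note lipb = this
    have "2 * \<kappa> * norm b \<ge> 0" using lam by simp
    from \<open>Z \<noteq> {}\<close> this lipb show ?thesis
    proof (rule Lipschitz_real_extension)
      fix g assume "\<And>x. x \<in> Z \<Longrightarrow> g x = P x \<bullet> b" "\<And>x y. \<bar>g x - g y\<bar> \<le> (2 * \<kappa> * norm b) * norm (x - y)"
      then show ?thesis by (intro exI[of _ g]) simp
    qed
  qed
  then obtain g where g: "\<And>b x. x \<in> Z \<Longrightarrow> g b x = P x \<bullet> b"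
    "\<And>b x y. \<bar>g b x - g b y\<bar> \<le> (2 * \<kappa> * norm b) * norm (x - y)" by metis
  define Bad where "Bad = (\<Union>b\<in>Basis. {x. \<not> g b differentiable at x}) \<union> {x \<in> Z. \<not> nonporous_at Z x}"
  have "negligible Bad"
    unfolding Bad_def using Rademacher[OF g(2)] negligible_porous_points by (intro negligible_Un negligible_Union) auto
  then have "\<not> Z \<subseteq> Bad" using \<open>\<not> negligible Z\<close> by (metis negligible_subset)
  then obtain z where "z \<in> Z" "z \<notin> Bad" by blast
  then have z: "z \<in> Z" "nonporous_at Z z" "\<And>b. b \<in> Basis \<Longrightarrow> g b differentiable at z"
    unfolding Bad_def by simp_all
  obtain G where G: "\<And>b. b \<in> Basis \<Longrightarrow> (g b has_derivative G b) (at z)"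
    using z(3) unfolding differentiable_def by metis
  define A where "A h = (\<Sum>b\<in>Basis. G b h *\<^sub>R b)" for h
  define Q where "Q x = (\<Sum>b\<in>Basis. g b x *\<^sub>R b)" for x
  have Q: "Q x = P x" if "x \<in> Z" for x
    using g(1)[OF that] by (simp add: Q_def euclidean_representation)
  have "(Q has_derivative A) (at z)"
    unfolding Q_def A_def by (intro has_derivative_sum has_derivative_scaleR_left G)
  then have A: "bounded_linear A" and dQ: "\<And>e. e > 0 \<Longrightarrow> \<exists>d>0. \<forall>y. norm (y - z) < d \<longrightarrow> norm (Q y - Q z - A (y - z)) \<le> e * norm (y - z)"
    unfolding has_derivative_at_alt by auto
  show thesis
  proof (rule that[OF P(1)[OF z(1)] P(2)[OF z(1)] A])
    show "second_order_at w z (P z) A"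
    proof (rule second_order_expansion_of_contact[OF lam P(2) below z(1,2) A])
      fix e :: real assume "e > 0"
      then obtain d where d: "d > 0" "\<And>y. norm (y - z) < d \<Longrightarrow> norm (Q y - Q z - A (y - z)) \<le> e * norm (y - z)"
        using dQ by blast
      show "\<exists>d>0. \<forall>\<zeta>\<in>Z. norm (\<zeta> - z) < d \<longrightarrow> norm (P \<zeta> - P z - A (\<zeta> - z)) \<le> e * norm (\<zeta> - z)"
      proof (intro exI conjI ballI impI)
        fix \<zeta> assume "\<zeta> \<in> Z" "norm (\<zeta> - z) < d"
        then show "norm (P \<zeta> - P z - A (\<zeta> - z)) \<le> e * norm (\<zeta> - z)"
          using d(2)[of \<zeta>] Q[of \<zeta>] Q[OF z(1)] by simp
      qed (fact d(1))
    qed (use P in auto)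
  qed
qed

section \<open>The theorem on sums\<close>

lemma usc_on_iff_open:
  "usc_on S f \<longleftrightarrow> (\<forall>x\<in>S. \<forall>a. f x < a \<longrightarrow> (\<exists>T. open T \<and> x \<in> T \<and> (\<forall>y\<in>T \<inter> S. f y < a)))"
  unfolding usc_on_def eventually_at_topological by (intro ball_cong refl all_cong) (metis IntE IntI)

lemma usc_on_attains_max:
  assumes S: "compact S" "S \<noteq> {}" and f: "usc_on S f"
  obtains x where "x \<in> S" "\<And>y. y \<in> S \<Longrightarrow> f y \<le> f x"
proof -
  have "\<exists>x\<in>S. \<forall>y\<in>S. f y \<le> f x"
  proof (rule ccontr)
    assume "\<not> ?thesis"
    then obtain Y where Y: "\<And>x. x \<in> S \<Longrightarrow> Y x \<in> S" "\<And>x. x \<in> S \<Longrightarrow> f x < f (Y x)"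
      by (metis linorder_not_less)
    have "\<exists>T. open T \<and> x \<in> T \<and> (\<forall>y\<in>T \<inter> S. f y < f (Y x))" if "x \<in> S" for x
      using f that Y(2)[OF that] unfolding usc_on_iff_open by blast
    then obtain T where T: "\<And>x. x \<in> S \<Longrightarrow> open (T x) \<and> x \<in> T x \<and> (\<forall>y\<in>T x \<inter> S. f y < f (Y x))"
      by metis
    obtain D where D: "D \<subseteq> S" "finite D" "S \<subseteq> (\<Union>x\<in>D. T x)"
      using compactE_image[OF S(1), of S T] T by blast
    then have "D \<noteq> {}" using S(2) by auto
    define M where "M = Max ((\<lambda>x. f (Y x)) ` D)"
    have "M \<in> (\<lambda>x. f (Y x)) ` D" unfolding M_def using D(2) \<open>D \<noteq> {}\<close> by (intro Max_in) auto
    then obtain x0 where x0: "x0 \<in> D" "M = f (Y x0)" by blast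
    then have "Y x0 \<in> S" using D Y by blast
    then obtain x1 where x1: "x1 \<in> D" "Y x0 \<in> T x1" using D by blast
    then have "f (Y x0) < f (Y x1)" using T D \<open>Y x0 \<in> S\<close> by blast
    moreover have "f (Y x1) \<le> M" unfolding M_def using D(2) x1(1) by (intro Max_ge) auto
    ultimately show False using x0(2) by simp
  qed
  then show ?thesis using that by blast
qed

lemma usc_on_add:
  assumes "usc_on S f" "usc_on S g"
  shows "usc_on S (\<lambda>x. f x + g x)"
  unfolding usc_on_def
proof (intro ballI allI impI)
  fix x a assume x: "x \<in> S" and a: "f x + g x < a"
  define e where "e = (a - f x - g x) / 2"
  have "f x < f x + e" "g x < g x + e" using a by (auto simp: e_def)
  then have "\<forall>\<^sub>F y in at x within S. f y < f x + e" "\<forall>\<^sub>F y in at x within S. g y < g x + e"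
    using assms x unfolding usc_on_def by blast+
  then show "\<forall>\<^sub>F y in at x within S. f y + g y < a"
    by eventually_elim (simp add: e_def field_simps)
qed

lemma continuous_on_imp_usc_on: "continuous_on S f \<Longrightarrow> usc_on S f"
  unfolding usc_on_def continuous_on_def by (blast intro: order_tendstoD)

lemma usc_on_uminus_iff: "usc_on S (\<lambda>x. - f x) \<longleftrightarrow> lsc_on S f"
proof -
  have "(\<forall>a. - f x < a \<longrightarrow> (\<forall>\<^sub>F y in at x within S. - f y < a)) \<longleftrightarrow> (\<forall>a. a < f x \<longrightarrow> (\<forall>\<^sub>F y in at x within S. a < f y))" for x
  proof (intro iffI allI impI)
    fix a assume *: "\<forall>a. - f x < a \<longrightarrow> (\<forall>\<^sub>F y in at x within S. - f y < a)" "a < f x"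
    have "\<forall>\<^sub>F y in at x within S. - f y < - a" using *(1)[rule_format, of "- a"] *(2) by simp
    then show "\<forall>\<^sub>F y in at x within S. a < f y" by simp
  next
    fix a assume *: "\<forall>a. a < f x \<longrightarrow> (\<forall>\<^sub>F y in at x within S. a < f y)" "- f x < a"
    then have "\<forall>\<^sub>F y in at x within S. - a < f y" by (simp add: minus_less_iff)
    then show "\<forall>\<^sub>F y in at x within S. - f y < a" by (simp add: minus_less_iff)
  qed
  then show ?thesis by (simp add: usc_on_def lsc_on_def)
qed

lemma usc_on_Times_fst: "usc_on A f \<Longrightarrow> usc_on (A \<times> B) (\<lambda>p. f (fst p))"
  unfolding usc_on_iff_open
proof (intro ballI allI impI)
  fix p a assume f: "\<forall>x\<in>A. \<forall>a. f x < a \<longrightarrow> (\<exists>T. open T \<and> x \<in> T \<and> (\<forall>y\<in>T \<inter> A. f y < a))"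
    and p: "p \<in> A \<times> B" "f (fst p) < a"
  then have "fst p \<in> A" by (auto simp: mem_Times_iff)
  then obtain T where "open T" "fst p \<in> T" "\<forall>y\<in>T \<inter> A. f y < a" using f p(2) by blast
  then show "\<exists>T. open T \<and> p \<in> T \<and> (\<forall>y\<in>T \<inter> A \<times> B. f (fst y) < a)"
    by (intro exI[of _ "T \<times> UNIV"]) (auto simp: open_Times mem_Times_iff)
qed

lemma usc_on_Times_snd: "usc_on B f \<Longrightarrow> usc_on (A \<times> B) (\<lambda>p. f (snd p))"
  unfolding usc_on_iff_open
proof (intro ballI allI impI)
  fix p a assume f: "\<forall>x\<in>B. \<forall>a. f x < a \<longrightarrow> (\<exists>T. open T \<and> x \<in> T \<and> (\<forall>y\<in>T \<inter> B. f y < a))"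
    and p: "p \<in> A \<times> B" "f (snd p) < a"
  then have "snd p \<in> B" by (auto simp: mem_Times_iff)
  then obtain T where "open T" "snd p \<in> T" "\<forall>y\<in>T \<inter> B. f y < a" using f p(2) by blast
  then show "\<exists>T. open T \<and> p \<in> T \<and> (\<forall>y\<in>T \<inter> A \<times> B. f (snd y) < a)"
    by (intro exI[of _ "UNIV \<times> T"]) (auto simp: open_Times mem_Times_iff)
qed

lemma nonneg_if_scaled_small:
  fixes s N :: real
  assumes "\<And>e. e > 0 \<Longrightarrow> \<exists>d>0. \<forall>t. 0 < t \<and> t < d \<longrightarrow> - (e * N * t\<^sup>2) \<le> s * t\<^sup>2"
  shows "0 \<le> s"
proof (rule ccontr)
  assume "\<not> 0 \<le> s"
  \<comment> \<open>Chosen so that the error \<open>e * N\<close> is at most half of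
    \<open>- s\<close>; the added 1 keeps the denominator positive.\<close>
  define e where "e = (- s / 2) / (\<bar>N\<bar> + 1)"
  have N1: "\<bar>N\<bar> + 1 > 0" by simp
  have e: "e > 0" using \<open>\<not> 0 \<le> s\<close> N1 unfolding e_def by (intro divide_pos_pos) auto
  then obtain d where d: "d > 0" "\<And>t. 0 < t \<Longrightarrow> t < d \<Longrightarrow> - (e * N * t\<^sup>2) \<le> s * t\<^sup>2" using assms[OF e] by blast
  have "- (e * N) * (d/2)\<^sup>2 \<le> s * (d/2)\<^sup>2" using d(2)[of "d/2"] d(1) by simp
  then have "- (e * N) \<le> s" by (rule mult_right_le_imp_le) (use d(1) in simp)
  moreover have "e * N \<le> e * (\<bar>N\<bar> + 1)" using e by (intro mult_left_mono) auto
  moreover have "e * (\<bar>N\<bar> + 1) = - s / 2"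
    using nonzero_eq_divide_eq[of "\<bar>N\<bar> + 1" e "- s / 2"] N1 e_def by (metis less_irrefl)
  ultimately show False using \<open>\<not> 0 \<le> s\<close> by linarith
qed

section \<open>Squared distances along a trisected segment\<close>

lemma norm_add_sq: "(norm (a + b :: 'a::real_inner))\<^sup>2 = (norm a)\<^sup>2 + 2 * (a \<bullet> b) + (norm b)\<^sup>2"
  by (simp add: power2_norm_eq_inner inner_add_left inner_add_right inner_commute)

lemma norm_diff_sq: "(norm (a - b :: 'a::real_inner))\<^sup>2 = (norm a)\<^sup>2 - 2 * (a \<bullet> b) + (norm b)\<^sup>2"
  by (simp add: power2_norm_eq_inner inner_diff_left inner_diff_right inner_commute)

text \<open>This is \<bar>x + y + z\<bar>^2 \<le> 3 (\<bar>x\<bar>^2 + \<bar>y\<bar>^2 +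
  \<bar>z\<bar>^2): two sup-convolutions and a coupling of equal weight cost at least a third of the
  squared distance.\<close>

lemma three_segments:
  fixes a b s t :: "'a::real_inner"
  shows "(norm (a - b))\<^sup>2 / 3 \<le> (norm (a - s))\<^sup>2 + (norm (b - t))\<^sup>2 + (norm (s - t))\<^sup>2"
proof -
  define x y z where "x = a - s" and "y = s - t" and "z = t - b"
  have "0 \<le> (norm (x - y))\<^sup>2 + (norm (y - z))\<^sup>2 + (norm (x - z))\<^sup>2" by simp
  moreover have "(norm (x + y + z))\<^sup>2 + ((norm (x - y))\<^sup>2 + (norm (y - z))\<^sup>2 + (norm (x - z))\<^sup>2)
      = 3 * ((norm x)\<^sup>2 + (norm y)\<^sup>2 + (norm z)\<^sup>2)"
    by (simp add: norm_add_sq norm_diff_sq inner_add_left algebra_simps)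
  ultimately have "(norm (x + y + z))\<^sup>2 \<le> 3 * ((norm x)\<^sup>2 + (norm y)\<^sup>2 + (norm z)\<^sup>2)" by linarith
  moreover have "x + y + z = a - b" by (simp add: x_def y_def z_def)
  moreover have "norm z = norm (b - t)" by (simp add: z_def norm_minus_commute)
  ultimately have "(norm (a - b))\<^sup>2 \<le> 3 * ((norm x)\<^sup>2 + (norm y)\<^sup>2 + (norm (b - t))\<^sup>2)" by (simp only:)
  then have "(norm (a - b))\<^sup>2 \<le> ((norm (a - s))\<^sup>2 + (norm (b - t))\<^sup>2 + (norm (s - t))\<^sup>2) * 3"
    by (simp add: x_def y_def)
  then show ?thesis by (simp only: pos_divide_le_eq zero_less_numeral)
qed

text \<open>The equality case of \<open>three_segments\<close>.\<close>

lemma trisection_identity: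
  fixes a b :: "'a::real_inner"
  defines "s \<equiv> a - (a - b) /\<^sub>R 3" and "t \<equiv> b + (a - b) /\<^sub>R 3"
  shows "(norm (a - s))\<^sup>2 + (norm (b - t))\<^sup>2 + (norm (s - t))\<^sup>2 = (norm (a - b))\<^sup>2 / 3"
proof -
  define w where "w = (a - b) /\<^sub>R 3"
  have "w + w + w = (inverse 3 + inverse 3 + inverse 3) *\<^sub>R (a - b)" unfolding w_def by (simp only: scaleR_add_left)
  then have www: "w + w + w = a - b" by simp
  have "a - s = w" "b - t = - w" by (simp_all add: s_def t_def w_def)
  moreover have "s - t = w"
  proof -
    have "s - t = (a - b) - (w + w)" by (simp add: s_def t_def w_def)
    then show ?thesis unfolding www[symmetric] by simp
  qed
  moreover have "norm w = norm (a - b) / 3" by (simp add: w_def)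
  ultimately show ?thesis by (simp only: norm_minus_cancel) (simp add: power_divide)
qed

section \<open>Calculus of second order expansions\<close>

lemma second_order_at_transfer:
  assumes w: "second_order_at w z p A" and i: "\<And>h. norm (i h) = norm h"
    and eq: "\<And>h. f (s + h) - f s - q \<bullet> h - F h \<bullet> h / 2 = w (z + i h) - w z - p \<bullet> i h - A (i h) \<bullet> i h / 2"
  shows "second_order_at f s q F"
  using w unfolding second_order_at_def eq by (metis i)

lemma second_order_at_uminus:
  assumes "second_order_at f z p A"
  shows "second_order_at (\<lambda>z. - f z) z (- p) (\<lambda>h. - A h)"
proof -
  have "\<bar>- f (z + h) - (- f z) - (- p) \<bullet> h - (- A h) \<bullet> h / 2\<bar> = \<bar>f (z + h) - f z - p \<bullet> h - A h \<bullet> h / 2\<bar>" for h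
    by (simp add: abs_if)
  then show ?thesis using assms unfolding second_order_at_def by simp
qed

lemma second_order_at_Pair:
  assumes "second_order_at f s p F" "second_order_at g t q G"
  shows "second_order_at (\<lambda>z. f (fst z) + g (snd z)) (s, t) (p, q) (\<lambda>z. (F (fst z), G (snd z)))"
  unfolding second_order_at_def
proof (intro allI impI)
  fix e :: real assume e: "e > 0"
  obtain d where d: "d > 0" "\<And>h. norm h < d \<Longrightarrow> \<bar>f (s + h) - f s - p \<bullet> h - F h \<bullet> h / 2\<bar> \<le> e * (norm h)\<^sup>2"
    using assms(1) e unfolding second_order_at_def by blast
  obtain d' where d': "d' > 0" "\<And>h. norm h < d' \<Longrightarrow> \<bar>g (t + h) - g t - q \<bullet> h - G h \<bullet> h / 2\<bar> \<le> e * (norm h)\<^sup>2"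
    using assms(2) e unfolding second_order_at_def by blast
  show "\<exists>d>0. \<forall>z. norm z < d \<longrightarrow> \<bar>f (fst ((s, t) + z)) + g (snd ((s, t) + z)) - (f (fst (s, t)) + g (snd (s, t)))
      - (p, q) \<bullet> z - (F (fst z), G (snd z)) \<bullet> z / 2\<bar> \<le> e * (norm z)\<^sup>2"
  proof (intro exI conjI allI impI)
    show "min d d' > 0" using d d' by simp
    fix z :: "'a \<times> 'b" assume z: "norm z < min d d'"
    obtain h k where hk: "z = (h, k)" by fastforce
    have "norm h < d" "norm k < d'" using z norm_fst_le[of h k] norm_snd_le[of k h] by (auto simp: hk)
    then have "\<bar>f (s + h) - f s - p \<bullet> h - F h \<bullet> h / 2\<bar> + \<bar>g (t + k) - g t - q \<bullet> k - G k \<bullet> k / 2\<bar> \<le> e * (norm h)\<^sup>2 + e * (norm k)\<^sup>2"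
      using d(2) d'(2) by (intro add_mono)
    also have "\<dots> = e * (norm z)\<^sup>2" by (simp add: hk norm_Pair distrib_left)
    finally show "\<bar>f (fst ((s, t) + z)) + g (snd ((s, t) + z)) - (f (fst (s, t)) + g (snd (s, t)))
      - (p, q) \<bullet> z - (F (fst z), G (snd z)) \<bullet> z / 2\<bar> \<le> e * (norm z)\<^sup>2"
      unfolding hk fst_conv snd_conv inner_Pair add_Pair add_divide_distrib by linarith
  qed
qed

text \<open>Along the ray, the expansion and the assumed bound share their terms of order 0 and 1;
  dividing the difference by \<open>a\<^sup>2\<close> compares the quadratic terms.\<close>

lemma second_order_at_form_le:
  assumes f: "second_order_at f z p A" and A: "linear A"
    and le: "\<And>a. a > 0 \<Longrightarrow> f (z + a *\<^sub>R h) \<le> f z + a * (p \<bullet> h) + a\<^sup>2 * b"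
  shows "A h \<bullet> h \<le> 2 * b"
proof -
  have "0 \<le> 2 * b - A h \<bullet> h"
  proof (rule nonneg_if_scaled_small[where N = "2 * (norm h)\<^sup>2"])
    fix e :: real assume "e > 0"
    then obtain d where d: "d > 0" "\<And>h. norm h < d \<Longrightarrow> \<bar>f (z + h) - f z - p \<bullet> h - A h \<bullet> h / 2\<bar> \<le> e * (norm h)\<^sup>2"
      using f unfolding second_order_at_def by blast
    have pos: "norm h + 1 > 0" by (simp add: add_nonneg_pos)
    show "\<exists>d>0. \<forall>a. 0 < a \<and> a < d \<longrightarrow> - (e * (2 * (norm h)\<^sup>2) * a\<^sup>2) \<le> (2 * b - A h \<bullet> h) * a\<^sup>2"
    proof (intro exI conjI allI impI)
      show "d / (norm h + 1) > 0" using d pos by simp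
      fix a assume a: "0 < a \<and> a < d / (norm h + 1)"
      have "a * (norm h + 1) < d" using a pos by (simp add: field_simps)
      moreover have "a * norm h \<le> a * (norm h + 1)" using a by (auto intro!: mult_left_mono)
      moreover have "norm (a *\<^sub>R h) = a * norm h" using a by simp
      ultimately have "norm (a *\<^sub>R h) < d" by linarith
      note d(2)[OF this]
      moreover have "A (a *\<^sub>R h) \<bullet> (a *\<^sub>R h) = a\<^sup>2 * (A h \<bullet> h)" using A by (simp add: linear_scale power2_eq_square)
      moreover have "p \<bullet> (a *\<^sub>R h) = a * (p \<bullet> h)" "e * (norm (a *\<^sub>R h))\<^sup>2 = a\<^sup>2 * (e * (norm h)\<^sup>2)"
        by (simp_all add: power_mult_distrib)
      ultimately have "a\<^sup>2 * (A h \<bullet> h) / 2 \<le> a\<^sup>2 * b + a\<^sup>2 * (e * (norm h)\<^sup>2)"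
        using le[of a] a unfolding abs_le_iff by linarith
      then show "- (e * (2 * (norm h)\<^sup>2) * a\<^sup>2) \<le> (2 * b - A h \<bullet> h) * a\<^sup>2" by (simp add: algebra_simps)
    qed
  qed
  then show ?thesis by simp
qed

text \<open>Below, \<open>U s\<close> is the sup-convolution of \<open>u\<close>, attained at \<open>x\<close>. Jets of \<open>U\<close> at \<open>s\<close> are jets of
  \<open>u\<close> at \<open>x\<close>.\<close>

lemma sup_convolution_lower:
  fixes u U :: "'a::real_inner \<Rightarrow> real"
  assumes "u x - c * (norm (x - (s + h)))\<^sup>2 \<le> U (s + h)" "U s = u x - c * (norm (x - s))\<^sup>2"
  shows "U s + ((2 * c) *\<^sub>R (x - s)) \<bullet> h - c * (norm h)\<^sup>2 \<le> U (s + h)"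
proof -
  have "x - (s + h) = (x - s) - h" by simp
  then have "c * (norm (x - (s + h)))\<^sup>2 = c * (norm (x - s))\<^sup>2 - ((2 * c) *\<^sub>R (x - s)) \<bullet> h + c * (norm h)\<^sup>2"
    unfolding norm_diff_sq[of "x - s" h] by (simp only:) (simp add: right_diff_distrib distrib_left norm_diff_sq)
  then show ?thesis using assms by linarith
qed

lemma sup_convolution_jet:
  fixes u U :: "'a::real_inner \<Rightarrow> real"
  assumes U: "\<And>x s. x \<in> C \<Longrightarrow> u x - c * (norm (x - s))\<^sup>2 \<le> U s" and eq: "U s = u x - c * (norm (x - s))\<^sup>2"
    and so: "second_order_at U s q F" and e: "e > 0"
  shows "\<exists>d>0. \<forall>x'\<in>C. norm (x' - x) < d \<longrightarrow>
    u x' \<le> u x + q \<bullet> (x' - x) + F (x' - x) \<bullet> (x' - x) / 2 + e * (norm (x' - x))\<^sup>2"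
proof -
  obtain d where d: "d > 0" "\<And>h. norm h < d \<Longrightarrow> \<bar>U (s + h) - U s - q \<bullet> h - F h \<bullet> h / 2\<bar> \<le> e * (norm h)\<^sup>2"
    using so e unfolding second_order_at_def by blast
  have "u x' \<le> u x + q \<bullet> (x' - x) + F (x' - x) \<bullet> (x' - x) / 2 + e * (norm (x' - x))\<^sup>2"
    if x': "x' \<in> C" "norm (x' - x) < d" for x'
  proof -
    \<comment> \<open>Shifting \<open>s\<close> by the same vector as \<open>x\<close> leaves the
      penalty unchanged, so an upper expansion of \<open>U\<close> passes to
      \<open>u\<close>.\<close>
    have "x' - (s + (x' - x)) = x - s" by simp
    then have "u x' - c * (norm (x - s))\<^sup>2 \<le> U (s + (x' - x))" using U[OF x'(1), of "s + (x' - x)"] by simp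
    then show ?thesis using eq d(2)[OF x'(2)] unfolding abs_le_iff by linarith
  qed
  then show ?thesis using d(1) by blast
qed

lemma sup_convolution_exists:
  fixes u :: "'a::real_inner \<Rightarrow> real"
  assumes C: "compact C" "C \<noteq> {}" and u: "usc_on C u"
  obtains m where "\<And>s. m s \<in> C" "\<And>s x. x \<in> C \<Longrightarrow> u x - c * (norm (x - s))\<^sup>2 \<le> u (m s) - c * (norm (m s - s))\<^sup>2"
proof -
  have "\<exists>x\<in>C. \<forall>x'\<in>C. u x' - c * (norm (x' - s))\<^sup>2 \<le> u x - c * (norm (x - s))\<^sup>2" for s
  proof -
    have "usc_on C (\<lambda>x. u x + - (c * (norm (x - s))\<^sup>2))"
      by (intro usc_on_add u continuous_on_imp_usc_on continuous_intros)
    from usc_on_attains_max[OF C this] show ?thesis by simp metis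
  qed
  then show thesis using that by metis
qed

text \<open>\<open>v\<close> is added rather than subtracted so that both functions are
  sup-convolved alike. The perturbed maximum is sought for \<open>w\<close>, where the two
  regularizations are coupled; trisection translates it into an almost maximum of the penalized sum
  of the original functions.\<close>

theorem theorem_on_sums:
  fixes u v :: "'a::euclidean_space \<Rightarrow> real"
  assumes C: "compact C" "C \<noteq> {}" and u: "usc_on C u" and v: "usc_on C v" and eps: "\<epsilon> > 0" and r: "r > 0"
  obtains x y p q F G where "x \<in> C" "y \<in> C" "bounded_linear F" "bounded_linear G"
    "\<And>a b. a \<in> C \<Longrightarrow> b \<in> C \<Longrightarrow> u a + v b - (norm (a - b))\<^sup>2 / (2 * \<epsilon>) \<le> u x + v y - (norm (x - y))\<^sup>2 / (2 * \<epsilon>) + r"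
    "norm (p - (x - y) /\<^sub>R \<epsilon>) \<le> r" "norm (q + (x - y) /\<^sub>R \<epsilon>) \<le> r"
    "\<exists>d>0. \<forall>x'\<in>C. norm (x' - x) < d \<longrightarrow>
       u x' \<le> u x + p \<bullet> (x' - x) + F (x' - x) \<bullet> (x' - x) / 2 + r / 2 * (norm (x' - x))\<^sup>2"
    "\<exists>d>0. \<forall>y'\<in>C. norm (y' - y) < d \<longrightarrow>
       v y' \<le> v y + q \<bullet> (y' - y) + G (y' - y) \<bullet> (y' - y) / 2 + r / 2 * (norm (y' - y))\<^sup>2"
    "\<And>h k. F h \<bullet> h + G k \<bullet> k \<le> 3 / \<epsilon> * (norm (h - k))\<^sup>2"
    "\<And>h. - (3 / \<epsilon>) * (norm h)\<^sup>2 \<le> F h \<bullet> h" "\<And>k. - (3 / \<epsilon>) * (norm k)\<^sup>2 \<le> G k \<bullet> k"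
proof -
  \<comment> \<open>With \<open>c / 3 = 1 / (2 * \<epsilon>)\<close> the minimal cost in
    \<open>three_segments\<close> is the original penalty.\<close>
  define c where "c = 3 / (2 * \<epsilon>)"
  have c: "c > 0" using eps by (simp add: c_def)
  have c3: "s / (2 * \<epsilon>) = c * (s / 3)" for s using eps by (simp add: c_def field_simps)
  have c2: "3 / \<epsilon> = 2 * c" by (simp add: c_def)
  obtain xm where xm: "\<And>s. xm s \<in> C" "\<And>s x. x \<in> C \<Longrightarrow> u x - c * (norm (x - s))\<^sup>2 \<le> u (xm s) - c * (norm (xm s - s))\<^sup>2"
    using sup_convolution_exists[OF C u] by metis
  obtain ym where ym: "\<And>s. ym s \<in> C" "\<And>s x. x \<in> C \<Longrightarrow> v x - c * (norm (x - s))\<^sup>2 \<le> v (ym s) - c * (norm (ym s - s))\<^sup>2"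
    using sup_convolution_exists[OF C v] by metis
  define U where "U s = u (xm s) - c * (norm (xm s - s))\<^sup>2" for s
  define V where "V s = v (ym s) - c * (norm (ym s - s))\<^sup>2" for s
  have U_ge: "u x - c * (norm (x - s))\<^sup>2 \<le> U s" and V_ge: "v x - c * (norm (x - s))\<^sup>2 \<le> V s" if "x \<in> C" for x s
    using xm ym that by (simp_all add: U_def V_def)
  define w where "w = (\<lambda>(s, t). U s + V t - c * (norm (s - t))\<^sup>2)"
  \<comment> \<open>Gradient of what \<open>w\<close> becomes when the maximizers
    \<open>xm s\<close> and \<open>ym t\<close> are frozen; that function lies below
    \<open>w\<close> and touches it at \<open>(s, t)\<close>.\<close>
  define l where "l = (\<lambda>(s, t). ((2 * c) *\<^sub>R ((xm s - s) - (s - t)), (2 * c) *\<^sub>R ((ym t - t) + (s - t))))"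
  \<comment> \<open>Origin of \<open>6 * c\<close>: \<open>U\<close> and \<open>V\<close> lose
    \<open>c\<close> times \<bar>h\<bar>^2 and \<bar>k\<bar>^2, and the coupling at most
    \<open>2 * c\<close> times their sum by the parallelogram identity, in all \<open>3 * c\<close>,
    which is half of \<open>6 * c\<close>.\<close>
  have w_below: "w z' \<ge> w z + l z \<bullet> (z' - z) - (6 * c) / 2 * (norm (z' - z))\<^sup>2" for z z'
  proof -
    obtain s t where z: "z = (s, t)" by fastforce
    obtain h k where hk: "z' - z = (h, k)" by fastforce
    have z': "z' = (s + h, t + k)" using hk by (simp add: z algebra_simps flip: add_Pair)
    have "U s + ((2 * c) *\<^sub>R (xm s - s)) \<bullet> h - c * (norm h)\<^sup>2 \<le> U (s + h)"
      by (rule sup_convolution_lower[of u _ c s h U, OF U_ge[OF xm(1)] U_def])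
    moreover have "V t + ((2 * c) *\<^sub>R (ym t - t)) \<bullet> k - c * (norm k)\<^sup>2 \<le> V (t + k)"
      by (rule sup_convolution_lower[of v _ c t k V, OF V_ge[OF ym(1)] V_def])
    moreover have "c * (norm ((s + h) - (t + k)))\<^sup>2 = c * (norm (s - t))\<^sup>2 + ((2 * c) *\<^sub>R (s - t)) \<bullet> (h - k) + c * (norm (h - k))\<^sup>2"
    proof -
      have "(s + h) - (t + k) = (s - t) + (h - k)" by simp
      then show ?thesis by (simp only: norm_add_sq) (simp add: distrib_left)
    qed
    moreover have "l z \<bullet> (h, k) = ((2 * c) *\<^sub>R (xm s - s)) \<bullet> h + ((2 * c) *\<^sub>R (ym t - t)) \<bullet> k - ((2 * c) *\<^sub>R (s - t)) \<bullet> (h - k)"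
      by (simp add: l_def z inner_Pair inner_diff_left inner_diff_right inner_add_left algebra_simps)
    ultimately have "w z' \<ge> w z + l z \<bullet> (h, k) - (c * (norm h)\<^sup>2 + c * (norm k)\<^sup>2 + c * (norm (h - k))\<^sup>2)"
      unfolding w_def z z' prod.case by linarith
    moreover have "c * (norm h)\<^sup>2 + c * (norm k)\<^sup>2 + c * (norm (h - k))\<^sup>2 \<le> (6 * c) / 2 * (norm (h, k))\<^sup>2"
    proof -
      have par: "(norm (h - k))\<^sup>2 + (norm (h + k))\<^sup>2 = 2 * ((norm h)\<^sup>2 + (norm k)\<^sup>2)"
        by (simp add: norm_add_sq norm_diff_sq)
      have "(norm (h - k))\<^sup>2 \<le> (norm (h - k))\<^sup>2 + (norm (h + k))\<^sup>2" by simp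
      then have "(norm (h - k))\<^sup>2 \<le> 2 * ((norm h)\<^sup>2 + (norm k)\<^sup>2)" unfolding par .
      then have "c * (norm (h - k))\<^sup>2 \<le> c * (2 * ((norm h)\<^sup>2 + (norm k)\<^sup>2))" using c by (intro mult_left_mono) auto
      then show ?thesis by (simp add: norm_Pair distrib_left)
    qed
    ultimately show ?thesis unfolding hk by linarith
  qed
  have w_ge: "w (s, t) \<ge> u x + v y - c * ((norm (x - s))\<^sup>2 + (norm (y - t))\<^sup>2 + (norm (s - t))\<^sup>2)"
    if "x \<in> C" "y \<in> C" for x y s t
    using U_ge[OF that(1), of s] V_ge[OF that(2), of t] by (simp add: w_def distrib_left)
  have w_eq: "w (s, t) = u (xm s) + v (ym t) - c * ((norm (xm s - s))\<^sup>2 + (norm (ym t - t))\<^sup>2 + (norm (s - t))\<^sup>2)" for s t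
    by (simp add: w_def U_def V_def distrib_left)
  \<comment> \<open>Completing the square absorbs the linear term: it moves \<open>x\<close> and
    \<open>y\<close> to \<open>a x\<close> and \<open>b y\<close> and adds a term \<open>g\<close>
    free of \<open>s\<close> and \<open>t\<close>. The maximum over \<open>s\<close> and
    \<open>t\<close> is then explicit by trisection, and the remaining one runs over the compact set
    \<open>C \<times> C\<close>.\<close>
  have w_max: "\<exists>z. \<forall>z'. w z' \<le> w z + p \<bullet> (z' - z)" for p
  proof -
    obtain p1 p2 where p: "p = (p1, p2)" by fastforce
    define a where "a x = x - p1 /\<^sub>R (2 * c)" for x
    define b where "b y = y - p2 /\<^sub>R (2 * c)" for y
    define g where "g x y = c * ((norm (a x))\<^sup>2 + (norm (b y))\<^sup>2 - (norm x)\<^sup>2 - (norm y)\<^sup>2)" for x y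
    have shift: "- (c * (norm (x - s))\<^sup>2) - q \<bullet> s = - (c * (norm ((x - q /\<^sub>R (2 * c)) - s))\<^sup>2) + c * ((norm (x - q /\<^sub>R (2 * c)))\<^sup>2 - (norm x)\<^sup>2)" for x q s :: 'a
    proof -
      define d where "d = q /\<^sub>R (2 * c)"
      define x' where "x' = x - d"
      have ds: "q \<bullet> s = 2 * c * (d \<bullet> s)" using c by (simp add: d_def)
      have xs: "x \<bullet> s = x' \<bullet> s + d \<bullet> s" by (simp add: x'_def inner_diff_left)
      have "- (c * (norm (x - s))\<^sup>2) - q \<bullet> s = - (c * (norm (x' - s))\<^sup>2) + c * ((norm x')\<^sup>2 - (norm x)\<^sup>2)"
        unfolding norm_diff_sq xs ds by (simp add: algebra_simps)
      then show ?thesis unfolding x'_def d_def .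
    qed
    have key: "- c * ((norm (x - s))\<^sup>2 + (norm (y - t))\<^sup>2 + (norm (s - t))\<^sup>2) - p \<bullet> (s, t)
        = - c * ((norm (a x - s))\<^sup>2 + (norm (b y - t))\<^sup>2 + (norm (s - t))\<^sup>2) + g x y" for x y s t
      using shift[of x s p1] shift[of y t p2] by (simp add: p inner_Pair g_def a_def b_def algebra_simps)
    have cont: "continuous_on (C \<times> C) (\<lambda>q. - (c * ((norm (a (fst q) - b (snd q)))\<^sup>2 / 3)) + g (fst q) (snd q))"
      unfolding a_def b_def g_def by (intro continuous_intros) auto
    have "usc_on (C \<times> C) (\<lambda>q. (u (fst q) + v (snd q)) + (- (c * ((norm (a (fst q) - b (snd q)))\<^sup>2 / 3)) + g (fst q) (snd q)))"
      by (intro usc_on_add usc_on_Times_fst usc_on_Times_snd u v continuous_on_imp_usc_on cont)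
    moreover have "compact (C \<times> C)" "C \<times> C \<noteq> {}" using C by (auto intro: compact_Times)
    ultimately obtain q where q: "q \<in> C \<times> C" "\<And>q'. q' \<in> C \<times> C \<Longrightarrow>
       (u (fst q') + v (snd q')) + (- (c * ((norm (a (fst q') - b (snd q')))\<^sup>2 / 3)) + g (fst q') (snd q'))
        \<le> (u (fst q) + v (snd q)) + (- (c * ((norm (a (fst q) - b (snd q)))\<^sup>2 / 3)) + g (fst q) (snd q))"
      using usc_on_attains_max by blast
    obtain x y where xy: "q = (x, y)" "x \<in> C" "y \<in> C" using q(1) by blast
    define s where "s = a x - (a x - b y) /\<^sub>R 3"
    define t where "t = b y + (a x - b y) /\<^sub>R 3"
    have "w z' \<le> w (s, t) + p \<bullet> (z' - (s, t))" for z'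
    proof -
      obtain s' t' where z': "z' = (s', t')" by fastforce
      let ?x = "xm s'" and ?y = "ym t'"
      have "w z' - p \<bullet> z' = u ?x + v ?y + (- c * ((norm (?x - s'))\<^sup>2 + (norm (?y - t'))\<^sup>2 + (norm (s' - t'))\<^sup>2) - p \<bullet> (s', t'))"
        by (simp add: z' w_eq)
      also have "\<dots> = u ?x + v ?y + (- c * ((norm (a ?x - s'))\<^sup>2 + (norm (b ?y - t'))\<^sup>2 + (norm (s' - t'))\<^sup>2) + g ?x ?y)"
        by (simp only: key)
      also have "\<dots> \<le> u ?x + v ?y + (- c * ((norm (a ?x - b ?y))\<^sup>2 / 3) + g ?x ?y)"
        using mult_left_mono[OF three_segments[of "a ?x" "b ?y" s' t'], of c] c by simp
      also have "\<dots> \<le> u x + v y + (- c * ((norm (a x - b y))\<^sup>2 / 3) + g x y)"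
        using q(2)[of "(?x, ?y)"] xm(1) ym(1) by (simp add: xy)
      also have "\<dots> = u x + v y + (- c * ((norm (a x - s))\<^sup>2 + (norm (b y - t))\<^sup>2 + (norm (s - t))\<^sup>2) + g x y)"
        unfolding s_def t_def trisection_identity ..
      also have "\<dots> = u x + v y + (- c * ((norm (x - s))\<^sup>2 + (norm (y - t))\<^sup>2 + (norm (s - t))\<^sup>2) - p \<bullet> (s, t))"
        by (simp only: key)
      also have "\<dots> \<le> w (s, t) - p \<bullet> (s, t)" using w_ge[OF xy(2,3), of s t] by simp
      finally show ?thesis by (simp add: inner_diff_right)
    qed
    then show ?thesis by blast
  qed
  obtain R where R: "\<And>x. x \<in> C \<Longrightarrow> norm x \<le> R" "R > 0"
    using compact_imp_bounded[OF C(1)] bounded_pos by blast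
  \<comment> \<open>\<open>N\<close> bounds \<bar>x - s\<bar> and \<bar>y - t\<bar>, because
    \<open>2 * c\<close> times these is the norm of \<open>q1\<close> and of \<open>q2\<close>.
    \<open>M\<close> bounds the distance from the touching point to the trisection points used in
    \<open>approx\<close>, so \<open>\<rho> * M \<le> r\<close> keeps the linear perturbation below
    \<open>r\<close> there.\<close>
  define N where "N = (2 * R / \<epsilon> + r) / (2 * c)"
  have N: "N > 0" using R(2) r eps c by (simp add: N_def add_pos_pos)
  define M where "M = 6 * R + 2 * N"
  have M: "M > 0" using R(2) N by (simp add: M_def)
  define \<rho> where "\<rho> = min r (r / M)"
  have \<rho>: "\<rho> > 0" "\<rho> \<le> r" "\<rho> * M \<le> r"
    using r M by (auto simp: \<rho>_def min_def field_simps)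
  have semiconvex: "\<exists>l. \<forall>z'. w z' \<ge> w z + l \<bullet> (z' - z) - (6 * c) / 2 * (norm (z' - z))\<^sup>2" for z using w_below by blast
  have c6: "6 * c > 0" using c by simp
  obtain z p A where zp: "norm p \<le> \<rho>" "\<And>z'. w z' \<le> w z + p \<bullet> (z' - z)" and A: "bounded_linear A"
    and expand: "second_order_at w z p A"
    by (rule Jensen_Alexandrov[OF c6 \<rho>(1) semiconvex w_max]) (rule that, assumption+)
  interpret A: bounded_linear A by fact
  obtain s t where z: "z = (s, t)" by fastforce
  obtain p1 p2 where p: "p = (p1, p2)" by fastforce
  define x y where "x = xm s" and "y = ym t"
  have xy: "x \<in> C" "y \<in> C" using xm ym by (auto simp: x_def y_def)
  \<comment> \<open>The slope of the plane above must be that of the paraboloid below, which gives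
    two linear equations for \<open>x - s\<close> and \<open>y - t\<close>.\<close>
  have "l z = p"
    by (rule touching_slope_unique[of "6 * c" w z]) (use c w_below zp in auto)
  then have p1: "p1 = (2 * c) *\<^sub>R ((x - s) - (s - t))" and p2: "p2 = (2 * c) *\<^sub>R ((y - t) + (s - t))"
    by (auto simp: l_def z p x_def y_def)
  define q1 where "q1 = (2 * c) *\<^sub>R (x - s)"
  define q2 where "q2 = (2 * c) *\<^sub>R (y - t)"
  have np: "norm p1 \<le> \<rho>" "norm p2 \<le> \<rho>"
    using zp(1) norm_fst_le[of p1 p2] norm_snd_le[of p2 p1] by (auto simp: p intro: order_trans)
  have xyeps: "(x - y) /\<^sub>R \<epsilon> = (2 * c / 3) *\<^sub>R (x - y)"
  proof -
    have "inverse \<epsilon> = 2 * c / 3" using eps by (simp add: c_def field_simps)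
    then show ?thesis by (simp only:)
  qed
  \<comment> \<open>For \<open>p = 0\<close> the points \<open>s\<close> and \<open>t\<close>
    trisect the segment from \<open>x\<close> to \<open>y\<close>, and both slopes are
    \<open>(x - y) /\<^sub>R \<epsilon>\<close> up to sign; in general the deviation is a convex
    combination of \<open>p1\<close> and \<open>p2\<close>.\<close>
  have "q1 - (x - y) /\<^sub>R \<epsilon> = (2/3) *\<^sub>R p1 + (1/3) *\<^sub>R p2"
    unfolding xyeps q1_def p1 p2 by (rule euclidean_eqI) (simp add: inner_diff_left inner_add_left field_simps)
  moreover have "q2 + (x - y) /\<^sub>R \<epsilon> = (1/3) *\<^sub>R p1 + (2/3) *\<^sub>R p2"
    unfolding xyeps q2_def p1 p2 by (rule euclidean_eqI) (simp add: inner_diff_left inner_add_left field_simps)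
  moreover have "norm ((2/3) *\<^sub>R p1 + (1/3) *\<^sub>R p2) \<le> \<rho>" "norm ((1/3) *\<^sub>R p1 + (2/3) *\<^sub>R p2) \<le> \<rho>"
    using norm_triangle_ineq[of "(2/3) *\<^sub>R p1" "(1/3) *\<^sub>R p2"] norm_triangle_ineq[of "(1/3) *\<^sub>R p1" "(2/3) *\<^sub>R p2"] np by auto
  ultimately have q12: "norm (q1 - (x - y) /\<^sub>R \<epsilon>) \<le> r" "norm (q2 + (x - y) /\<^sub>R \<epsilon>) \<le> r"
    using \<rho>(2) by (auto simp only:)
  \<comment> \<open>Diagonal blocks of \<open>A\<close>, with the Hessian \<open>2 * c\<close> of
    the coupling term added back.\<close>
  define F where "F h = fst (A (h, 0)) + (2 * c) *\<^sub>R h" for h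
  define G where "G k = snd (A (0, k)) + (2 * c) *\<^sub>R k" for k
  have blF: "bounded_linear F"
    unfolding F_def
    by (intro bounded_linear_add bounded_linear_scaleR_right bounded_linear_fst_comp bounded_linear_compose[OF A] bounded_linear_Pair bounded_linear_ident bounded_linear_zero)
  have blG: "bounded_linear G"
    unfolding G_def
    by (intro bounded_linear_add bounded_linear_scaleR_right bounded_linear_snd_comp bounded_linear_compose[OF A] bounded_linear_Pair bounded_linear_ident bounded_linear_zero)
  have FF: "F h \<bullet> h = A (h, 0) \<bullet> (h, 0) + 2 * c * (norm h)\<^sup>2" for h
    by (cases "A (h, 0)") (simp add: F_def inner_Pair inner_add_left power2_norm_eq_inner)
  have GG: "G k \<bullet> k = A (0, k) \<bullet> (0, k) + 2 * c * (norm k)\<^sup>2" for k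
    by (cases "A (0, k)") (simp add: G_def inner_Pair inner_add_left power2_norm_eq_inner)
  \<comment> \<open>Varying \<open>s\<close> alone isolates \<open>U\<close>, from which
    \<open>w\<close> then differs by an explicit quadratic polynomial.\<close>
  have soU: "second_order_at U s q1 F"
  proof (rule second_order_at_transfer[OF expand, of "\<lambda>h. (h, 0)"])
    fix h
    have "U (s + h) - U s = w (z + (h, 0)) - w z + c * ((norm ((s - t) + h))\<^sup>2 - (norm (s - t))\<^sup>2)"
      by (simp add: w_def z algebra_simps)
    then have "U (s + h) - U s = w (z + (h, 0)) - w z + (2 * (c * ((s - t) \<bullet> h)) + c * (norm h)\<^sup>2)"
      unfolding norm_add_sq by (simp add: distrib_left)
    moreover have "q1 \<bullet> h = p1 \<bullet> h + 2 * (c * ((s - t) \<bullet> h))"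
      by (simp add: q1_def p1 inner_diff_left algebra_simps)
    moreover have "p \<bullet> (h, 0) = p1 \<bullet> h" by (simp add: p inner_Pair)
    ultimately show "U (s + h) - U s - q1 \<bullet> h - F h \<bullet> h / 2 = w (z + (h, 0)) - w z - p \<bullet> (h, 0) - A (h, 0) \<bullet> (h, 0) / 2"
      unfolding FF add_divide_distrib by simp
  qed (simp add: norm_Pair)
  have soV: "second_order_at V t q2 G"
  proof (rule second_order_at_transfer[OF expand, of "\<lambda>h. (0, h)"])
    fix k
    have "V (t + k) - V t = w (z + (0, k)) - w z + c * ((norm ((s - t) - k))\<^sup>2 - (norm (s - t))\<^sup>2)"
      by (simp add: w_def z algebra_simps)
    then have "V (t + k) - V t = w (z + (0, k)) - w z + (c * (norm k)\<^sup>2 - 2 * (c * ((s - t) \<bullet> k)))"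
      unfolding norm_diff_sq[of "s - t"] by (simp add: right_diff_distrib distrib_left)
    moreover have "q2 \<bullet> k = p2 \<bullet> k - 2 * (c * ((s - t) \<bullet> k))"
      by (simp add: q2_def p2 inner_diff_left inner_add_left algebra_simps)
    moreover have "p \<bullet> (0, k) = p2 \<bullet> k" by (simp add: p inner_Pair)
    ultimately show "V (t + k) - V t - q2 \<bullet> k - G k \<bullet> k / 2 = w (z + (0, k)) - w z - p \<bullet> (0, k) - A (0, k) \<bullet> (0, k) / 2"
      unfolding GG add_divide_distrib by simp
  qed (simp add: norm_Pair)
  have linFG: "linear F" "linear G" using blF blG by (auto intro: bounded_linear.linear)
  \<comment> \<open>The plane of slope \<open>p\<close> lies above \<open>w\<close>, so the Hessian
    of the uncoupled sum of \<open>U\<close> and \<open>V\<close> cannot exceed that of the coupling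
    term.\<close>
  have bound: "F h \<bullet> h + G k \<bullet> k \<le> 3 / \<epsilon> * (norm (h - k))\<^sup>2" for h k
  proof -
    let ?A = "\<lambda>z. (F (fst z), G (snd z))"
    have "linear ?A"
      by (intro bounded_linear.linear bounded_linear_Pair bounded_linear_compose[OF blF] bounded_linear_compose[OF blG] bounded_linear_fst bounded_linear_snd)
    then have "?A (h, k) \<bullet> (h, k) \<le> 2 * (c * (norm (h - k))\<^sup>2)"
    proof (rule second_order_at_form_le[OF second_order_at_Pair[OF soU soV]])
      fix a :: real
      have "w (z + a *\<^sub>R (h, k)) \<le> w z + p \<bullet> (a *\<^sub>R (h, k))" using zp(2)[of "z + a *\<^sub>R (h, k)"] by simp
      then have "U (s + a *\<^sub>R h) + V (t + a *\<^sub>R k) - c * (norm ((s - t) + a *\<^sub>R (h - k)))\<^sup>2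
          \<le> U s + V t - c * (norm (s - t))\<^sup>2 + a * (p1 \<bullet> h + p2 \<bullet> k)"
        by (simp add: w_def z p inner_Pair algebra_simps)
      moreover have "c * (norm ((s - t) + a *\<^sub>R (h - k)))\<^sup>2 = c * (norm (s - t))\<^sup>2 + a * (2 * (c * ((s - t) \<bullet> (h - k)))) + a\<^sup>2 * (c * (norm (h - k))\<^sup>2)"
        unfolding norm_add_sq by (simp add: power_mult_distrib distrib_left del: scaleR_diff_right)
      moreover have "a * ((q1, q2) \<bullet> (h, k)) = a * (p1 \<bullet> h + p2 \<bullet> k) + a * (2 * (c * ((s - t) \<bullet> (h - k))))"
        by (simp add: q1_def q2_def p1 p2 inner_Pair inner_diff_left inner_add_left inner_diff_right algebra_simps)
      ultimately show "U (fst ((s, t) + a *\<^sub>R (h, k))) + V (snd ((s, t) + a *\<^sub>R (h, k)))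
          \<le> U (fst (s, t)) + V (snd (s, t)) + a * ((q1, q2) \<bullet> (h, k)) + a\<^sup>2 * (c * (norm (h - k))\<^sup>2)"
        unfolding scaleR_Pair add_Pair fst_conv snd_conv by linarith
    qed
    then show ?thesis by (simp add: inner_Pair c2)
  qed
  \<comment> \<open>A sup-convolution is semiconvex with constant \<open>2 * c\<close>, which bounds
    each block from below on its own.\<close>
  have lower: "- (3 / \<epsilon>) * (norm h)\<^sup>2 \<le> H h \<bullet> h"
    if so: "second_order_at W s ((2 * c) *\<^sub>R (x - s)) H" and H: "linear H"
      and le: "\<And>h. W s + ((2 * c) *\<^sub>R (x - s)) \<bullet> h - c * (norm h)\<^sup>2 \<le> W (s + h)" for W H s x and h :: 'a
  proof -
    have "second_order_at (\<lambda>s. - W s) s (- ((2 * c) *\<^sub>R (x - s))) (\<lambda>h. - H h)"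
      by (rule second_order_at_uminus[OF so])
    moreover have "linear (\<lambda>h. - H h)" using H by (rule linear_compose_neg)
    ultimately have "- H h \<bullet> h \<le> 2 * (c * (norm h)\<^sup>2)"
    proof (rule second_order_at_form_le)
      fix a :: real
      show "- W (s + a *\<^sub>R h) \<le> - W s + a * (- ((2 * c) *\<^sub>R (x - s)) \<bullet> h) + a\<^sup>2 * (c * (norm h)\<^sup>2)"
        using le[of "a *\<^sub>R h"] by (simp add: power_mult_distrib mult_ac)
    qed
    then show ?thesis by (simp add: c2)
  qed
  have Us: "U s = u x - c * (norm (x - s))\<^sup>2" and Vt: "V t = v y - c * (norm (y - t))\<^sup>2" by (simp_all add: U_def V_def x_def y_def)
  have lowF: "- (3 / \<epsilon>) * (norm h)\<^sup>2 \<le> F h \<bullet> h" for h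
    by (rule lower[OF soU[unfolded q1_def] linFG(1)]) (rule sup_convolution_lower[of u x c s _ U, OF U_ge[OF xy(1)] Us])
  have lowG: "- (3 / \<epsilon>) * (norm h)\<^sup>2 \<le> G h \<bullet> h" for h
    by (rule lower[OF soV[unfolded q2_def] linFG(2)]) (rule sup_convolution_lower[of v y c t _ V, OF V_ge[OF xy(2)] Vt])
  have r2: "r / 2 > 0" using r by simp
  note jetu = sup_convolution_jet[OF U_ge Us soU r2]
  note jetv = sup_convolution_jet[OF V_ge Vt soV r2]
  \<comment> \<open>At the trisection points of \<open>a\<close> and \<open>b\<close> the value of
    \<open>w\<close> is at least that of the penalized sum; the plane at \<open>z\<close> compares
    it with the value at \<open>x\<close>, \<open>y\<close>, at the cost of \<open>norm p\<close>
    times a distance.\<close>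
  have approx: "u a + v b - (norm (a - b))\<^sup>2 / (2 * \<epsilon>) \<le> u x + v y - (norm (x - y))\<^sup>2 / (2 * \<epsilon>) + r" if ab: "a \<in> C" "b \<in> C" for a b
  proof -
    define s' where "s' = a - (a - b) /\<^sub>R 3"
    define t' where "t' = b + (a - b) /\<^sub>R 3"
    have "u a + v b - c * ((norm (a - b))\<^sup>2 / 3) \<le> w (s', t')"
      using w_ge[OF ab, of s' t'] unfolding s'_def t'_def trisection_identity .
    also have "\<dots> \<le> w z + p \<bullet> ((s', t') - z)" by (rule zp(2))
    also have "w z \<le> u x + v y - c * ((norm (x - y))\<^sup>2 / 3)"
      using mult_left_mono[OF three_segments[of x y s t], of c] c w_eq[of s t] by (simp add: z x_def y_def)
    also have "p \<bullet> ((s', t') - z) \<le> r"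
    proof -
      have "norm (a - b) \<le> 2 * R" using norm_triangle_ineq4[of a b] R(1)[OF ab(1)] R(1)[OF ab(2)] by linarith
      then have ab3: "norm ((a - b) /\<^sub>R 3) \<le> R" using R(2) by simp
      have "norm s' \<le> 2 * R" "norm t' \<le> 2 * R"
        using norm_triangle_ineq4[of a "(a - b) /\<^sub>R 3"] norm_triangle_ineq[of b "(a - b) /\<^sub>R 3"] ab3 R(1)[OF ab(1)] R(1)[OF ab(2)]
        unfolding s'_def t'_def by linarith+
      moreover have nxy: "norm ((x - y) /\<^sub>R \<epsilon>) \<le> 2 * R / \<epsilon>"
        using norm_triangle_ineq4[of x y] R(1)[OF xy(1)] R(1)[OF xy(2)] eps unfolding norm_scaleR by (simp add: field_simps)
      have "norm q1 \<le> 2 * R / \<epsilon> + r" "norm q2 \<le> 2 * R / \<epsilon> + r"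
        using norm_triangle_ineq2[of q1 "(x - y) /\<^sub>R \<epsilon>"] norm_triangle_ineq2[of q2 "- ((x - y) /\<^sub>R \<epsilon>)"] q12 nxy
        unfolding norm_minus_cancel diff_minus_eq_add by linarith+
      then have "norm (x - s) \<le> N" "norm (y - t) \<le> N"
        using c by (simp_all add: N_def q1_def q2_def pos_le_divide_eq mult.commute)
      then have "norm s \<le> R + N" "norm t \<le> R + N"
        using norm_triangle_ineq4[of x "x - s"] norm_triangle_ineq4[of y "y - t"] R(1)[OF xy(1)] R(1)[OF xy(2)] by simp_all
      moreover have "norm ((s', t') - z) \<le> norm (s' - s) + norm (t' - t)" by (simp add: z norm_Pair sqrt_sum_squares_le_sum)
      ultimately have "norm ((s', t') - z) \<le> M"
        using norm_triangle_ineq4[of s' s] norm_triangle_ineq4[of t' t] \<open>norm s' \<le> 2 * R\<close> \<open>norm t' \<le> 2 * R\<close> R(2)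
        unfolding M_def by linarith
      then have "norm p * norm ((s', t') - z) \<le> \<rho> * M" using zp(1) \<rho>(1) by (intro mult_mono) auto
      then show ?thesis using norm_cauchy_schwarz[of p "(s', t') - z"] \<rho>(3) by linarith
    qed
    finally show ?thesis by (simp add: c3)
  qed
  from xy blF blG approx q12 jetu jetv bound lowF lowG show thesis by (rule that)
qed

section \<open>Monotonicity of the determinant\<close>

lemma Sym_inner_commute:
  fixes M :: "real^'n^'n"
  assumes "M \<in> Sym"
  shows "a \<bullet> (M *v b) = (M *v a) \<bullet> b"
  using assms dot_lmul_matrix[of a M b] by (simp add: Sym_def flip: vector_transpose_matrix)

lemma quadratic_form_rank_one:
  fixes x z :: "real^'m"
  shows "z \<bullet> ((\<chi> i j. x$i * x$j) *v z) = (x \<bullet> z)\<^sup>2"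
  by (simp add: inner_vec_def matrix_vector_mult_def sum_distrib_left sum_distrib_right power2_eq_square mult_ac sum_product)

lemma psd_diag_nonneg:
  fixes A :: "real^'m^'m"
  assumes "\<And>z. 0 \<le> z \<bullet> (A *v z)"
  shows "0 \<le> A $ i $ i"
  using assms[of "axis i 1"] by (simp add: matrix_vector_mult_basis inner_axis' column_def)

text \<open>Cholesky elimination: subtract the rank one matrix built from a column with nonzero
  diagonal entry; the Schur complement stays semidefinite and loses that row and column. The clause
  on zero diagonal entries keeps column \<open>p\<close> of the next factor empty, so that the
  vector \<open>x\<close> can be stored there.\<close>

lemma psd_factorization:
  fixes A :: "real^'m^'m"
  assumes "transpose A = A" and "\<And>z. 0 \<le> z \<bullet> (A *v z)"
  shows "\<exists>V :: real^'m^'m. A = V ** transpose V \<and> (\<forall>j. A $ j $ j = 0 \<longrightarrow> (\<forall>i. V $ i $ j = 0))"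
  using assms
proof (induction "card {i. A $ i $ i \<noteq> 0}" arbitrary: A rule: less_induct)
  case less
  have sym: "A $ i $ j = A $ j $ i" for i j using arg_cong[OF less.prems(1), of "\<lambda>M. M $ j $ i"] by (simp add: transpose_def)
  show ?case
  proof (cases "\<exists>p. A $ p $ p \<noteq> 0")
    case False
    have "A $ i $ j = 0" for i j
    proof -
      have entry: "axis k 1 \<bullet> (A *v axis l 1) = A $ k $ l" for k l
        by (simp add: matrix_vector_mult_basis inner_axis' column_def)
      have q: "(a *\<^sub>R axis i 1 + axis j 1) \<bullet> (A *v (a *\<^sub>R axis i 1 + axis j 1)) = 2 * a * A $ i $ j" for a
        using False sym[of j i]
        by (simp add: matrix_vector_right_distrib matrix_vector_mult_scaleR inner_add_left inner_add_right entry)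
      \<comment> \<open>With zero diagonal the form at
        \<open>a *\<^sub>R axis i 1 + axis j 1\<close> is linear in \<open>a\<close>, and
        \<open>a = - A $ i $ j\<close> makes it nonpositive.\<close>
      have "0 \<le> 2 * (- A $ i $ j) * A $ i $ j"
        using less.prems(2)[of "(- A $ i $ j) *\<^sub>R axis i 1 + axis j 1"] unfolding q .
      then have "A $ i $ j * A $ i $ j \<le> 0" by simp
      then show ?thesis by (auto simp: mult_le_0_iff)
    qed
    then have "A = 0" by (simp add: vec_eq_iff)
    then show ?thesis by (intro exI[of _ 0]) simp
  next
    case True
    then obtain p where p: "A $ p $ p \<noteq> 0" by blast
    define d where "d = A $ p $ p"
    have d: "d > 0" using p psd_diag_nonneg[OF less.prems(2), of p] by (simp add: d_def)
    define x :: "real^'m" where "x = (1 / sqrt d) *\<^sub>R column p A"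
    define B where "B = A - (\<chi> i j. x$i * x$j)"
    have xx: "x$i * x$j = A$i$p * A$j$p / d" for i j using d by (simp add: x_def column_def)
    have Bp: "B $ i $ p = 0" "B $ p $ i = 0" for i
      unfolding B_def using d sym[of p i] by (auto simp: xx d_def)
    have Bt: "transpose B = B" using sym by (simp add: B_def transpose_def vec_eq_iff mult.commute)
    have Bpsd: "0 \<le> z \<bullet> (B *v z)" for z
    proof -
      let ?s = "column p A \<bullet> z"
      \<comment> \<open>\<open>?y\<close> minimizes the form of \<open>A\<close> over the translates
        of \<open>z\<close> along \<open>axis p 1\<close>; the minimum is the form of
        \<open>B\<close> at \<open>z\<close>.\<close>
      let ?y = "z - (?s / d) *\<^sub>R axis p 1"
      have Ap: "A *v axis p 1 = column p A" by (simp add: matrix_vector_mult_basis)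
      have "A \<in> Sym" using less.prems(1) by (simp add: Sym_def)
      then have 1: "axis p 1 \<bullet> (A *v z) = ?s" using Sym_inner_commute[of A "axis p 1" z] by (simp add: Ap)
      have 2: "axis p 1 \<bullet> column p A = d" by (simp add: inner_axis' column_def d_def)
      have "?y \<bullet> (A *v ?y) = z \<bullet> (A *v z) - ?s\<^sup>2 / d"
        using d by (simp add: matrix_vector_mult_diff_distrib matrix_vector_mult_scaleR inner_diff_left inner_diff_right 1 2 Ap
            inner_commute[of z "column p A"] power2_eq_square field_simps)
      moreover have "z \<bullet> (B *v z) = z \<bullet> (A *v z) - ?s\<^sup>2 / d"
        unfolding B_def matrix_vector_mult_diff_rdistrib inner_diff_right quadratic_form_rank_one
        using d by (simp add: x_def power_mult_distrib power_divide)
      ultimately show ?thesis using less.prems(2)[of ?y] by simp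
    qed
    have dz: "B $ j $ j = 0" if "A $ j $ j = 0" for j
    proof -
      have "B $ j $ j = - (x $ j)\<^sup>2" using that by (simp add: B_def power2_eq_square)
      then show ?thesis using psd_diag_nonneg[OF Bpsd, of j] by simp
    qed
    have "card {i. B $ i $ i \<noteq> 0} < card {i. A $ i $ i \<noteq> 0}"
    proof (rule psubset_card_mono)
      show "{i. B $ i $ i \<noteq> 0} \<subset> {i. A $ i $ i \<noteq> 0}" using dz p Bp by blast
    qed simp
    then obtain W :: "real^'m^'m" where W: "B = W ** transpose W" "\<And>i j. B $ j $ j = 0 \<Longrightarrow> W $ i $ j = 0"
      using less.hyps[OF _ Bt Bpsd] by blast
    define V :: "real^'m^'m" where "V = (\<chi> i j. if j = p then x $ i else W $ i $ j)"
    have "A = V ** transpose V"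
    proof (simp only: vec_eq_iff, intro allI)
      fix i j
      have "(V ** transpose V) $ i $ j = (\<Sum>k\<in>UNIV. V$i$k * V$j$k)"
        by (simp add: matrix_matrix_mult_def transpose_def)
      also have "\<dots> = x$i * x$j + (\<Sum>k\<in>UNIV - {p}. W$i$k * W$j$k)"
        by (subst sum.remove[of _ p]) (auto simp: V_def)
      also have "(\<Sum>k\<in>UNIV - {p}. W$i$k * W$j$k) = (\<Sum>k\<in>UNIV. W$i$k * W$j$k)"
        using W(2)[of p i] Bp by (subst sum.remove[of UNIV p]) auto
      also have "\<dots> = B $ i $ j" unfolding W(1) by (simp add: matrix_matrix_mult_def transpose_def)
      finally show "A $ i $ j = (V ** transpose V) $ i $ j" by (simp add: B_def)
    qed
    moreover have "V $ i $ j = 0" if "A $ j $ j = 0" for i j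
      using that p dz W(2) by (auto simp: V_def)
    ultimately show ?thesis by blast
  qed
qed

text \<open>The powers of a contraction have entries bounded by one, so their determinants stay bounded.\<close>

lemma abs_det_contraction_le_1:
  fixes T :: "real^'m^'m"
  assumes T: "\<And>z. norm (T *v z) \<le> norm z"
  shows "\<bar>det T\<bar> \<le> 1"
proof (rule ccontr)
  assume "\<not> \<bar>det T\<bar> \<le> 1"
  define P where "P k = ((\<lambda>M. T ** M) ^^ k) (mat 1)" for k
  have P: "norm (P k *v z) \<le> norm z" for k z
  proof (induction k)
    case (Suc k)
    have "P (Suc k) *v z = T *v (P k *v z)" by (simp add: P_def matrix_vector_mul_assoc)
    then show ?case using T[of "P k *v z"] Suc by simp
  qed (simp add: P_def)
  have detP: "det (P k) = det T ^ k" for k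
    by (induction k) (simp_all add: P_def det_mul)
  have entry: "\<bar>P k $ i $ j\<bar> \<le> 1" for k i j
  proof -
    have "\<bar>P k $ i $ j\<bar> = \<bar>(P k *v axis j 1) $ i\<bar>" by (simp add: matrix_vector_mult_basis column_def)
    also have "\<dots> \<le> norm (P k *v axis j 1)" by (rule component_le_norm_cart)
    also have "\<dots> \<le> 1" using P[of k "axis j 1"] by simp
    finally show ?thesis .
  qed
  define N where "N = real (card {p. p permutes (UNIV :: 'm set)})"
  have "\<bar>det (P k)\<bar> \<le> N" for k
  proof -
    have "\<bar>det (P k)\<bar> \<le> (\<Sum>p | p permutes (UNIV :: 'm set). \<bar>of_int (sign p) * (\<Prod>i\<in>UNIV. P k $ i $ p i)\<bar>)"
      unfolding det_def by (rule sum_abs)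
    also have "\<dots> \<le> (\<Sum>p | p permutes (UNIV :: 'm set). 1)"
    proof (rule sum_mono)
      fix p :: "'m \<Rightarrow> 'm"
      have "\<bar>\<Prod>i\<in>UNIV. P k $ i $ p i\<bar> \<le> 1"
        unfolding abs_prod using entry by (intro prod_le_1) auto
      moreover have "\<bar>of_int (sign p) :: real\<bar> = 1" by (simp add: sign_def)
      ultimately show "\<bar>of_int (sign p) * (\<Prod>i\<in>UNIV. P k $ i $ p i)\<bar> \<le> 1" by (simp add: abs_mult)
    qed
    finally show ?thesis by (simp add: N_def)
  qed
  then have "\<bar>det T\<bar> ^ k \<le> N" for k by (simp add: detP power_abs)
  moreover obtain k where "N < \<bar>det T\<bar> ^ k" using real_arch_pow[of "\<bar>det T\<bar>" N] \<open>\<not> \<bar>det T\<bar> \<le> 1\<close> by auto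
  ultimately show False by (meson not_le)
qed

lemma pos_def_factorization:
  fixes A :: "real^'m^'m"
  assumes "pos_def A"
  obtains V :: "real^'m^'m" where "A = V ** transpose V" "invertible V" "\<And>z. z \<bullet> (A *v z) = (norm (transpose V *v z))\<^sup>2"
    "det A = (det V)\<^sup>2" "det A > 0"
proof -
  have "transpose A = A" using assms by (simp add: pos_def_def Sym_def)
  moreover have "0 \<le> z \<bullet> (A *v z)" for z using assms unfolding pos_def_def by (cases "z = 0") (auto intro: less_imp_le)
  ultimately obtain V :: "real^'m^'m" where V: "A = V ** transpose V" using psd_factorization by blast
  have q: "z \<bullet> (A *v z) = (norm (transpose V *v z))\<^sup>2" for z
    by (simp add: V matrix_vector_mul_assoc[symmetric] power2_norm_eq_inner dot_lmul_matrix[symmetric])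
  have "inj ((*v) (transpose V))"
  proof (rule injI)
    fix y z assume "transpose V *v y = transpose V *v z"
    then have "transpose V *v (y - z) = 0" by (simp add: matrix_vector_mult_diff_distrib)
    then have "(y - z) \<bullet> (A *v (y - z)) = 0" by (simp add: q)
    then have "y - z = 0" using assms unfolding pos_def_def by (metis less_irrefl)
    then show "y = z" by simp
  qed
  then have "invertible (transpose V)" using invertible_left_inverse matrix_left_invertible_injective by blast
  then have inv: "invertible V" by (metis transpose_transpose transpose_invertible)
  have "det A = (det V)\<^sup>2" by (simp add: V det_mul power2_eq_square)
  moreover have "det V \<noteq> 0" using inv by (simp add: invertible_det_nz)
  ultimately show thesis using that[OF V inv q] by simp
qed

text \<open>Once both matrices are factored, the inequality of forms says that
  \<open>transpose W\<close> composed with the inverse of \<open>transpose V\<close> is a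
  contraction, so its determinant is at most 1 in absolute value.\<close>

lemma det_mono_pos_def:
  fixes A B :: "real^'m^'m"
  assumes A: "pos_def A" and B: "pos_def B" and AB: "B \<preceq> A"
  shows "det B \<le> det A"
proof -
  obtain V :: "real^'m^'m" where V: "invertible V" "\<And>z. z \<bullet> (A *v z) = (norm (transpose V *v z))\<^sup>2" "det A = (det V)\<^sup>2"
    using pos_def_factorization[OF A] by metis
  obtain W :: "real^'m^'m" where W: "\<And>z. z \<bullet> (B *v z) = (norm (transpose W *v z))\<^sup>2" "det B = (det W)\<^sup>2"
    using pos_def_factorization[OF B] by metis
  have "invertible (transpose V)" using V(1) by (rule transpose_invertible)
  then obtain V' :: "real^'m^'m" where V': "transpose V ** V' = mat 1" unfolding invertible_def by blast
  have "norm ((transpose W ** V') *v z) \<le> norm z" for z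
  proof -
    have "(norm (transpose W *v (V' *v z)))\<^sup>2 \<le> (norm (transpose V *v (V' *v z)))\<^sup>2"
      using AB unfolding mat_le_def V(2) W(1) by blast
    then show ?thesis by (simp add: matrix_vector_mul_assoc V' power2_le_iff_abs_le)
  qed
  then have "\<bar>det (transpose W ** V')\<bar> \<le> 1" by (rule abs_det_contraction_le_1)
  moreover have "det V * det V' = 1" using arg_cong[OF V', of det] by (simp add: det_mul)
  ultimately have "\<bar>det W\<bar> * \<bar>det V'\<bar> \<le> \<bar>det V\<bar> * \<bar>det V'\<bar>" by (simp add: det_mul flip: abs_mult)
  moreover have "det V' \<noteq> 0" using \<open>det V * det V' = 1\<close> by auto
  ultimately have "\<bar>det W\<bar> \<le> \<bar>det V\<bar>" by simp
  then show ?thesis by (simp add: V(3) W(2) abs_le_square_iff)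
qed

section \<open>Quadratic test functions and the vector fields\<close>

lemma grad_eqI:
  assumes "(f has_derivative (\<lambda>h. g \<bullet> h)) (at x)"
  shows "grad f x = g"
proof -
  have "frechet_derivative f (at x) = (\<lambda>h. g \<bullet> h)" using frechet_derivative_at[OF assms] by simp
  then show ?thesis by (simp add: grad_def vec_eq_iff inner_axis)
qed

lemma has_derivative_grad:
  assumes "f differentiable at x"
  shows "(f has_derivative (\<lambda>h. grad f x \<bullet> h)) (at x)"
proof -
  obtain f' where f': "(f has_derivative f') (at x)" using assms by (auto simp: differentiable_def)
  then have "linear f'" using has_derivative_linear by blast
  \<comment> \<open>Riesz representation: \<open>adjoint f' 1\<close> is the vector that represents
    the functional \<open>f'\<close>.\<close>
  then have "f' h = adjoint f' 1 \<bullet> h" for h using adjoint_works[of f' h 1] by (simp add: inner_commute)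
  then have "f' = (\<lambda>h. adjoint f' 1 \<bullet> h)" by blast
  with f' have "(f has_derivative (\<lambda>h. adjoint f' 1 \<bullet> h)) (at x)" by simp
  moreover from this have "grad f x = adjoint f' 1" by (rule grad_eqI)
  ultimately show ?thesis by simp
qed

definition quadratic :: "real^'n \<Rightarrow> real^'n \<Rightarrow> real^'n^'n \<Rightarrow> real^'n \<Rightarrow> real" where
  "quadratic x q M y = q \<bullet> (y - x) + (y - x) \<bullet> (M *v (y - x)) / 2"

lemma quadratic_at_center [simp]: "quadratic x q M x = 0"
  by (simp add: quadratic_def)

lemma has_derivative_grad_quadratic:
  "((\<lambda>y. q + M *v (y - x)) has_derivative (\<lambda>h. M *v h)) (at (y :: real^'n))"
proof -
  have "(\<lambda>y. q + M *v (y - x)) = (\<lambda>y. (q - M *v x) + M *v y)"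
    by (simp add: matrix_vector_mult_diff_distrib fun_eq_iff)
  moreover have "((\<lambda>y. (q - M *v x) + M *v y) has_derivative (\<lambda>h. 0 + M *v h)) (at y)"
    by (intro has_derivative_add has_derivative_const bounded_linear_imp_has_derivative matrix_vector_mul_bounded_linear)
  ultimately show ?thesis by simp
qed

lemma has_derivative_quadratic:
  assumes "M \<in> Sym"
  shows "(quadratic x q M has_derivative (\<lambda>h. (q + M *v (y - x)) \<bullet> h)) (at y)"
proof -
  have bl: "((\<lambda>y. M *v (y - x)) has_derivative (\<lambda>h. M *v h)) (at y)"
    using has_derivative_grad_quadratic[of 0 M x y] by simp
  have id: "((\<lambda>y. y - x) has_derivative (\<lambda>h. h)) (at y)"
    by (auto intro!: derivative_eq_intros)
  have "((\<lambda>y. q \<bullet> (y - x) + (y - x) \<bullet> (M *v (y - x)) / 2) has_derivative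
      (\<lambda>h. q \<bullet> h + ((y - x) \<bullet> (M *v h) + h \<bullet> (M *v (y - x))) / 2)) (at y)"
    by (intro has_derivative_add has_derivative_inner_right has_derivative_inner id bl
        bounded_linear.has_derivative[OF bounded_linear_divide])
  moreover have "q \<bullet> h + ((y - x) \<bullet> (M *v h) + h \<bullet> (M *v (y - x))) / 2 = (q + M *v (y - x)) \<bullet> h" for h
    unfolding Sym_inner_commute[OF assms, of "y - x" h] inner_commute[of h] inner_add_left by simp
  ultimately show ?thesis
    unfolding quadratic_def[abs_def] by simp
qed

lemma grad_quadratic:
  assumes "M \<in> Sym"
  shows "grad (quadratic x q M) = (\<lambda>y. q + M *v (y - x))"
  using grad_eqI[OF has_derivative_quadratic[OF assms]] by blast

lemma hess_quadratic:
  assumes "M \<in> Sym"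
  shows "hess (quadratic x q M) y = M"
  using frechet_derivative_at[OF has_derivative_grad_quadratic[of q M x y], symmetric]
  by (simp add: hess_def grad_quadratic[OF assms] jacobian_def)

lemma C2_on_quadratic:
  assumes "M \<in> Sym"
  shows "C2_on S (quadratic x q M)"
proof -
  have "quadratic x q M differentiable at y" for y
    using has_derivative_quadratic[OF assms] by (auto simp: differentiable_def)
  moreover have "grad (quadratic x q M) differentiable at y" for y
    unfolding grad_quadratic[OF assms] differentiable_def using has_derivative_grad_quadratic[of q M x y] by blast
  moreover have "hess (quadratic x q M) = (\<lambda>_. M)" using hess_quadratic[OF assms] by blast
  ultimately show ?thesis by (simp add: C2_on_def)
qed

text \<open>The derivative of the field \<open>\<sigma> y *v z\<close>, with \<open>z\<close>
  frozen, along itself at \<open>x\<close>. Its inner product with \<open>q\<close> is the value at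
  \<open>z\<close> of the quadratic form Q(x, q), the first order part of
  \<open>D2X\<close>.\<close>

definition field_drift :: "(real^'n \<Rightarrow> real^'m^'n) \<Rightarrow> real^'n \<Rightarrow> real^'m \<Rightarrow> real^'n" where
  "field_drift \<sigma> x z = (\<chi> l. \<Sum>i\<in>UNIV. \<Sum>j\<in>UNIV. z $ i * z $ j * (column i (\<sigma> x) \<bullet> grad (\<lambda>y. \<sigma> y $ l $ j) x))"

text \<open>Product rule. Quadratic test functions suffice because the theorem on sums bounds
  \<open>u\<close> and \<open>v\<close> by quadratic polynomials, and at the centre their gradient
  is just \<open>q\<close>.\<close>

lemma D2X_quadratic:
  fixes \<sigma> :: "real^'n \<Rightarrow> real^'m^'n"
  assumes M: "M \<in> Sym" and \<sigma>: "\<And>i j. (\<lambda>y. \<sigma> y $ i $ j) differentiable at x"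
  shows "z \<bullet> (D2X \<sigma> (quadratic x q M) x *v z) = (\<sigma> x *v z) \<bullet> (M *v (\<sigma> x *v z)) + q \<bullet> field_drift \<sigma> x z"
proof -
  let ?\<phi> = "quadratic x q M"
  define S where "S l i j = column i (\<sigma> x) \<bullet> grad (\<lambda>y. \<sigma> y $ l $ j) x" for l i j
  have grad_vf: "grad (vf \<sigma> j ?\<phi>) x = (\<Sum>l\<in>UNIV. (q $ l) *\<^sub>R grad (\<lambda>y. \<sigma> y $ l $ j) x) + M *v column j (\<sigma> x)" for j
  proof (rule grad_eqI)
    have e: "vf \<sigma> j ?\<phi> = (\<lambda>y. \<Sum>l\<in>UNIV. \<sigma> y $ l $ j * (q + M *v (y - x)) $ l)"
      by (simp add: vf_def fun_eq_iff grad_quadratic[OF M] inner_vec_def column_def)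
    have d: "((\<lambda>y. \<Sum>l\<in>UNIV. \<sigma> y $ l $ j * (q + M *v (y - x)) $ l) has_derivative
        (\<lambda>h. \<Sum>l\<in>UNIV. \<sigma> x $ l $ j * (M *v h) $ l + (grad (\<lambda>y. \<sigma> y $ l $ j) x \<bullet> h) * (q + M *v (x - x)) $ l)) (at x)"
      by (intro has_derivative_sum has_derivative_mult has_derivative_grad \<sigma>
          bounded_linear.has_derivative[OF bounded_linear_vec_nth] has_derivative_grad_quadratic)
    have "(\<Sum>l\<in>UNIV. \<sigma> x $ l $ j * (M *v h) $ l + (grad (\<lambda>y. \<sigma> y $ l $ j) x \<bullet> h) * (q + M *v (x - x)) $ l)
        = ((\<Sum>l\<in>UNIV. (q $ l) *\<^sub>R grad (\<lambda>y. \<sigma> y $ l $ j) x) + M *v column j (\<sigma> x)) \<bullet> h" for h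
    proof -
      have "(\<Sum>l\<in>UNIV. \<sigma> x $ l $ j * (M *v h) $ l) = column j (\<sigma> x) \<bullet> (M *v h)"
        by (simp add: inner_vec_def column_def)
      then show ?thesis
        by (simp add: sum.distrib inner_add_left inner_sum_left Sym_inner_commute[OF M] mult.commute)
    qed
    then show "(vf \<sigma> j ?\<phi> has_derivative (\<lambda>h. ((\<Sum>l\<in>UNIV. (q $ l) *\<^sub>R grad (\<lambda>y. \<sigma> y $ l $ j) x) + M *v column j (\<sigma> x)) \<bullet> h)) (at x)"
      using d unfolding e by simp
  qed
  have vv: "vf \<sigma> i (vf \<sigma> j ?\<phi>) x = (\<Sum>l\<in>UNIV. q $ l * S l i j) + column i (\<sigma> x) \<bullet> (M *v column j (\<sigma> x))" for i j
    by (simp add: vf_def[of \<sigma> i "vf \<sigma> j ?\<phi>"] grad_vf S_def inner_add_right inner_sum_right)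
  have Msym: "column j (\<sigma> x) \<bullet> (M *v column i (\<sigma> x)) = column i (\<sigma> x) \<bullet> (M *v column j (\<sigma> x))" for i j
    using Sym_inner_commute[OF M] by (simp add: inner_commute)
  have D: "D2X \<sigma> ?\<phi> x $ i $ j = column i (\<sigma> x) \<bullet> (M *v column j (\<sigma> x)) + ((\<Sum>l\<in>UNIV. q $ l * S l i j) + (\<Sum>l\<in>UNIV. q $ l * S l j i)) / 2" for i j
    by (simp add: D2X_def vv Msym[of j i] field_simps)
  have expand: "z \<bullet> (A *v z) = (\<Sum>i\<in>UNIV. \<Sum>j\<in>UNIV. z$i * z$j * A$i$j)" for A :: "real^'m^'m"
    by (simp add: inner_vec_def matrix_vector_mult_def sum_distrib_left mult_ac)
  have \<sigma>z: "\<sigma> x *v z = (\<Sum>j\<in>UNIV. z $ j *\<^sub>R column j (\<sigma> x))"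
    by (simp add: matrix_mult_sum scalar_mult_eq_scaleR)
  have 1: "(\<sigma> x *v z) \<bullet> (M *v (\<sigma> x *v z)) = (\<Sum>i\<in>UNIV. \<Sum>j\<in>UNIV. z$i * z$j * (column i (\<sigma> x) \<bullet> (M *v column j (\<sigma> x))))"
  proof -
    have "(\<sigma> x *v z) \<bullet> (M *v (\<sigma> x *v z)) = (\<Sum>a\<in>UNIV. \<Sum>n\<in>UNIV. z$a * (z$n * (column n (\<sigma> x) \<bullet> (M *v column a (\<sigma> x)))))"
      unfolding \<sigma>z by (simp add: linear_sum[OF matrix_vector_mul_linear] inner_sum_left inner_sum_right matrix_vector_mult_scaleR sum_distrib_left mult_ac)
    also have "\<dots> = (\<Sum>i\<in>UNIV. \<Sum>j\<in>UNIV. z$i * z$j * (column i (\<sigma> x) \<bullet> (M *v column j (\<sigma> x))))"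
      by (intro sum.cong refl) (subst Msym, simp)
    finally show ?thesis .
  qed
  have 2: "(\<Sum>i\<in>UNIV. \<Sum>j\<in>UNIV. z$i * z$j * (\<Sum>l\<in>UNIV. q $ l * S l i j)) = q \<bullet> field_drift \<sigma> x z"
  proof -
    have "(\<Sum>i\<in>UNIV. \<Sum>j\<in>UNIV. z$i * z$j * (\<Sum>l\<in>UNIV. q $ l * S l i j))
        = (\<Sum>i\<in>UNIV. \<Sum>j\<in>UNIV. \<Sum>l\<in>UNIV. q $ l * (z$i * z$j * S l i j))"
      by (simp add: sum_distrib_left mult_ac)
    also have "\<dots> = (\<Sum>i\<in>UNIV. \<Sum>l\<in>UNIV. \<Sum>j\<in>UNIV. q $ l * (z$i * z$j * S l i j))"
      by (intro sum.cong refl sum.swap)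
    also have "\<dots> = (\<Sum>l\<in>UNIV. \<Sum>i\<in>UNIV. \<Sum>j\<in>UNIV. q $ l * (z$i * z$j * S l i j))"
      by (rule sum.swap)
    also have "\<dots> = q \<bullet> field_drift \<sigma> x z"
      by (simp add: field_drift_def inner_vec_def S_def sum_distrib_left)
    finally show ?thesis .
  qed
  \<comment> \<open>Both orders of differentiation give the same sum over all pairs, so the
    symmetrization in \<open>D2X\<close> is invisible to the form.\<close>
  have 3: "(\<Sum>i\<in>UNIV. \<Sum>j\<in>UNIV. z$i * z$j * (\<Sum>l\<in>UNIV. q $ l * S l j i)) = q \<bullet> field_drift \<sigma> x z"
    unfolding 2[symmetric] by (subst sum.swap) (simp add: mult_ac)
  define a where "a i j = (\<Sum>l\<in>UNIV. q $ l * S l i j)" for i j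
  define b where "b i j = column i (\<sigma> x) \<bullet> (M *v column j (\<sigma> x))" for i j
  have D': "D2X \<sigma> ?\<phi> x $ i $ j = b i j + (a i j + a j i) / 2" for i j unfolding a_def b_def by (rule D)
  have "z \<bullet> (D2X \<sigma> ?\<phi> x *v z) = (\<Sum>i\<in>UNIV. \<Sum>j\<in>UNIV. z$i * z$j * b i j)
      + ((\<Sum>i\<in>UNIV. \<Sum>j\<in>UNIV. z$i * z$j * a i j) + (\<Sum>i\<in>UNIV. \<Sum>j\<in>UNIV. z$i * z$j * a j i)) / 2"
    unfolding expand D' by (simp add: distrib_left sum.distrib add_divide_distrib sum_divide_distrib)
  then show ?thesis unfolding a_def b_def 1 2 3 by simp
qed

lemma D2X_in_Sym: "D2X \<sigma> f x \<in> Sym"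
  by (simp add: D2X_def Sym_def transpose_def vec_eq_iff add.commute)

section \<open>Lipschitz bounds for the vector fields\<close>

definition lip_bdd_on :: "'a::real_normed_vector set \<Rightarrow> ('a \<Rightarrow> real) \<Rightarrow> bool" where
  "lip_bdd_on B f \<longleftrightarrow> (\<exists>L\<ge>0. (\<forall>x\<in>B. \<bar>f x\<bar> \<le> L) \<and> (\<forall>x\<in>B. \<forall>y\<in>B. \<bar>f x - f y\<bar> \<le> L * norm (x - y)))"

lemma lip_bdd_on_add:
  assumes "lip_bdd_on B f" "lip_bdd_on B g"
  shows "lip_bdd_on B (\<lambda>x. f x + g x)"
proof -
  obtain L where L: "L \<ge> 0" "\<And>x. x \<in> B \<Longrightarrow> \<bar>f x\<bar> \<le> L" "\<And>x y. x \<in> B \<Longrightarrow> y \<in> B \<Longrightarrow> \<bar>f x - f y\<bar> \<le> L * norm (x - y)"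
    using assms(1) unfolding lip_bdd_on_def by blast
  obtain L' where L': "L' \<ge> 0" "\<And>x. x \<in> B \<Longrightarrow> \<bar>g x\<bar> \<le> L'" "\<And>x y. x \<in> B \<Longrightarrow> y \<in> B \<Longrightarrow> \<bar>g x - g y\<bar> \<le> L' * norm (x - y)"
    using assms(2) unfolding lip_bdd_on_def by blast
  show ?thesis unfolding lip_bdd_on_def
  proof (intro exI[of _ "L + L'"] conjI ballI)
    fix x y assume xy: "x \<in> B" "y \<in> B"
    show "\<bar>f x + g x\<bar> \<le> L + L'" using L(2)[OF xy(1)] L'(2)[OF xy(1)] by linarith
    show "\<bar>f x + g x - (f y + g y)\<bar> \<le> (L + L') * norm (x - y)"
      using L(3)[OF xy] L'(3)[OF xy] unfolding distrib_right by linarith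
  qed (use L L' in auto)
qed

text \<open>Bounds are carried along with the Lipschitz constants because the constant of a product
  involves the bounds of its factors; the 2 counts the two terms of the product rule.\<close>

lemma lip_bdd_on_mult:
  assumes "lip_bdd_on B f" "lip_bdd_on B g"
  shows "lip_bdd_on B (\<lambda>x. f x * g x)"
proof -
  obtain L where L: "L \<ge> 0" "\<And>x. x \<in> B \<Longrightarrow> \<bar>f x\<bar> \<le> L" "\<And>x y. x \<in> B \<Longrightarrow> y \<in> B \<Longrightarrow> \<bar>f x - f y\<bar> \<le> L * norm (x - y)"
    using assms(1) unfolding lip_bdd_on_def by blast
  obtain L' where L': "L' \<ge> 0" "\<And>x. x \<in> B \<Longrightarrow> \<bar>g x\<bar> \<le> L'" "\<And>x y. x \<in> B \<Longrightarrow> y \<in> B \<Longrightarrow> \<bar>g x - g y\<bar> \<le> L' * norm (x - y)"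
    using assms(2) unfolding lip_bdd_on_def by blast
  show ?thesis unfolding lip_bdd_on_def
  proof (intro exI[of _ "2 * L * L'"] conjI ballI)
    fix x y assume xy: "x \<in> B" "y \<in> B"
    have "\<bar>f x * g x\<bar> \<le> L * L'" unfolding abs_mult using L(2)[OF xy(1)] L'(2)[OF xy(1)] by (intro mult_mono) (auto simp: L(1))
    moreover have "0 \<le> L * L'" using L(1) L'(1) by simp
    ultimately show "\<bar>f x * g x\<bar> \<le> 2 * L * L'" by linarith
    have "\<bar>f x * (g x - g y)\<bar> \<le> L * (L' * norm (x - y))"
      unfolding abs_mult using L(2)[OF xy(1)] L'(3)[OF xy] by (intro mult_mono) (auto simp: L(1))
    moreover have "\<bar>(f x - f y) * g y\<bar> \<le> (L * norm (x - y)) * L'"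
      unfolding abs_mult using L(3)[OF xy] L'(2)[OF xy(2)] by (intro mult_mono) (auto simp: L(1))
    moreover have "f x * g x - f y * g y = f x * (g x - g y) + (f x - f y) * g y" by (simp add: algebra_simps)
    ultimately show "\<bar>f x * g x - f y * g y\<bar> \<le> (2 * L * L') * norm (x - y)" by (simp add: mult_ac) 
  qed (use L L' in auto)
qed

lemma lip_bdd_on_sum:
  assumes "finite I" "\<And>i. i \<in> I \<Longrightarrow> lip_bdd_on B (f i)"
  shows "lip_bdd_on B (\<lambda>x. \<Sum>i\<in>I. f i x)"
  using assms
proof (induction I rule: finite_induct)
  case empty
  show ?case unfolding lip_bdd_on_def by (intro exI[of _ 0]) simp
next
  case (insert i I)
  then have "lip_bdd_on B (\<lambda>x. f i x + (\<Sum>i\<in>I. f i x))" by (intro lip_bdd_on_add) auto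
  then show ?case using insert.hyps by simp
qed

lemma lip_bdd_on_uniform:
  assumes "finite I" "\<And>i. i \<in> I \<Longrightarrow> lip_bdd_on B (f i)"
  obtains L where "L \<ge> 0" "\<And>i x. i \<in> I \<Longrightarrow> x \<in> B \<Longrightarrow> \<bar>f i x\<bar> \<le> L"
    "\<And>i x y. i \<in> I \<Longrightarrow> x \<in> B \<Longrightarrow> y \<in> B \<Longrightarrow> \<bar>f i x - f i y\<bar> \<le> L * norm (x - y)"
proof -
  obtain l where l: "\<And>i. i \<in> I \<Longrightarrow> l i \<ge> 0" "\<And>i x. i \<in> I \<Longrightarrow> x \<in> B \<Longrightarrow> \<bar>f i x\<bar> \<le> l i"
    "\<And>i x y. i \<in> I \<Longrightarrow> x \<in> B \<Longrightarrow> y \<in> B \<Longrightarrow> \<bar>f i x - f i y\<bar> \<le> l i * norm (x - y)"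
    using assms(2) unfolding lip_bdd_on_def by metis
  have le: "l i \<le> sum l I" if "i \<in> I" for i using assms(1) l(1) that by (intro member_le_sum) auto
  show thesis
  proof (rule that[of "sum l I"])
    show "sum l I \<ge> 0" using l(1) by (rule sum_nonneg)
    show "\<bar>f i x\<bar> \<le> sum l I" if "i \<in> I" "x \<in> B" for i x using l(2)[OF that] le[OF that(1)] by linarith
    show "\<bar>f i x - f i y\<bar> \<le> sum l I * norm (x - y)" if "i \<in> I" "x \<in> B" "y \<in> B" for i x y
      using l(3)[OF that] mult_right_mono[OF le[OF that(1)], of "norm (x - y)"] by simp
  qed
qed

text \<open>The mean value inequality requires a convex set, hence the ball; the comparison argument
  uses these bounds only near one interior point.\<close>

lemma C11_closure_lip_bdd_on:
  assumes f: "C11_closure \<Omega> f" and sub: "cball c \<rho> \<subseteq> \<Omega>" and \<rho>: "\<rho> \<ge> 0"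
  shows "lip_bdd_on (cball c \<rho>) f" "lip_bdd_on (cball c \<rho>) (\<lambda>x. grad f x $ k)"
proof -
  obtain L where L: "L-lipschitz_on \<Omega> (grad f)" using f unfolding C11_closure_def by blast
  have L0: "L \<ge> 0" using L by (rule lipschitz_on_nonneg)
  have lip: "norm (grad f x - grad f y) \<le> L * norm (x - y)" if "x \<in> cball c \<rho>" "y \<in> cball c \<rho>" for x y
  proof -
    have "x \<in> \<Omega>" "y \<in> \<Omega>" using that sub by auto
    then show ?thesis using lipschitz_onD[OF L, of x y] by (simp add: dist_norm)
  qed
  define G where "G = norm (grad f c) + L * \<rho>"
  have G0: "G \<ge> 0" using L0 \<rho> by (simp add: G_def)
  have G: "norm (grad f x) \<le> G" if "x \<in> cball c \<rho>" for x
  proof -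
    have "norm (grad f x - grad f c) \<le> L * norm (x - c)" using lip[OF that, of c] \<rho> by simp
    also have "\<dots> \<le> L * \<rho>" using that L0 by (intro mult_left_mono) (auto simp: dist_norm norm_minus_commute)
    finally show ?thesis using norm_triangle_ineq[of "grad f c" "grad f x - grad f c"] by (simp add: G_def)
  qed
  have comp: "\<bar>a $ k\<bar> \<le> norm a" for a :: "real^'a" by (rule component_le_norm_cart)
  show "lip_bdd_on (cball c \<rho>) (\<lambda>x. grad f x $ k)"
    unfolding lip_bdd_on_def
  proof (intro exI[of _ "G + L"] conjI ballI)
    fix x y assume xy: "x \<in> cball c \<rho>" "y \<in> cball c \<rho>"
    show "\<bar>grad f x $ k\<bar> \<le> G + L" using comp[of "grad f x"] G[OF xy(1)] L0 by linarith
    have "\<bar>grad f x $ k - grad f y $ k\<bar> \<le> L * norm (x - y)"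
      using comp[of "grad f x - grad f y"] lip[OF xy] by simp
    also have "\<dots> \<le> (G + L) * norm (x - y)" using G0 by (intro mult_right_mono) auto
    finally show "\<bar>grad f x $ k - grad f y $ k\<bar> \<le> (G + L) * norm (x - y)" .
  qed (use G0 L0 in auto)
  have flip: "\<bar>f x - f y\<bar> \<le> G * norm (x - y)" if xy: "x \<in> cball c \<rho>" "y \<in> cball c \<rho>" for x y
  proof -
    have "norm (f x - f y) \<le> G * norm (x - y)"
    proof (rule differentiable_bound[OF convex_cball _ _ xy])
      fix x assume x: "x \<in> cball c \<rho>"
      then have "f differentiable at x" using f sub unfolding C11_closure_def by blast
      then show "(f has_derivative (\<lambda>h. grad f x \<bullet> h)) (at x within cball c \<rho>)"
        using has_derivative_grad has_derivative_at_withinI by blast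
      show "onorm (\<lambda>h. grad f x \<bullet> h) \<le> G"
      proof (rule onorm_le)
        fix h show "norm (grad f x \<bullet> h) \<le> G * norm h"
          using Cauchy_Schwarz_ineq2[of "grad f x" h] mult_right_mono[OF G[OF x], of "norm h"] by simp
      qed
    qed
    then show ?thesis by simp
  qed
  show "lip_bdd_on (cball c \<rho>) f"
    unfolding lip_bdd_on_def
  proof (intro exI[of _ "\<bar>f c\<bar> + G * \<rho> + G"] conjI ballI)
    have G\<rho>: "G * \<rho> \<ge> 0" using G0 \<rho> by simp
    show "\<bar>f c\<bar> + G * \<rho> + G \<ge> 0" using G\<rho> G0 by simp
    fix x y assume xy: "x \<in> cball c \<rho>" "y \<in> cball c \<rho>"
    have "G * norm (x - c) \<le> G * \<rho>" using xy(1) G0 by (intro mult_left_mono) (auto simp: dist_norm norm_minus_commute)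
    then show "\<bar>f x\<bar> \<le> \<bar>f c\<bar> + G * \<rho> + G" using flip[OF xy(1), of c] \<rho> G0 by auto
    have "G * norm (x - y) \<le> (\<bar>f c\<bar> + G * \<rho> + G) * norm (x - y)" using G\<rho> by (intro mult_right_mono) auto
    then show "\<bar>f x - f y\<bar> \<le> (\<bar>f c\<bar> + G * \<rho> + G) * norm (x - y)" using flip[OF xy] by linarith
  qed
qed

lemma norm_field_le:
  fixes A :: "real^'m^'n"
  assumes "\<And>l j. \<bar>A $ l $ j\<bar> \<le> L"
  shows "norm (A *v z) \<le> real CARD('n) * real CARD('m) * L * norm z"
proof -
  have "norm (A *v z) \<le> (\<Sum>l\<in>UNIV. \<bar>(A *v z) $ l\<bar>)" by (rule norm_le_l1_cart)
  also have "\<dots> \<le> (\<Sum>(l::'n)\<in>UNIV. \<Sum>(j::'m)\<in>UNIV. L * norm z)"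
  proof (rule sum_mono)
    fix l
    have "\<bar>(A *v z) $ l\<bar> \<le> (\<Sum>j\<in>UNIV. \<bar>A $ l $ j * z $ j\<bar>)" unfolding matrix_vector_mult_def by simp
    also have "\<dots> \<le> (\<Sum>(j::'m)\<in>UNIV. L * norm z)"
      unfolding abs_mult using assms component_le_norm_cart[of z] by (intro sum_mono mult_mono) (auto intro: order_trans[OF abs_ge_zero])
    finally show "\<bar>(A *v z) $ l\<bar> \<le> (\<Sum>(j::'m)\<in>UNIV. L * norm z)" .
  qed
  finally show ?thesis by simp
qed

lemma norm_drift_le:
  fixes S :: "'n::finite \<Rightarrow> 'm::finite \<Rightarrow> 'm \<Rightarrow> real"
  assumes "\<And>l i j. \<bar>S l i j\<bar> \<le> L"
  shows "norm (\<chi> l. \<Sum>i\<in>UNIV. \<Sum>j\<in>UNIV. z $ i * z $ j * S l i j) \<le> real CARD('n) * (real CARD('m) * real CARD('m)) * L * (norm z)\<^sup>2"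
proof -
  let ?v = "(\<chi> l. \<Sum>i\<in>UNIV. \<Sum>j\<in>UNIV. z $ i * z $ j * S l i j)"
  have "norm ?v \<le> (\<Sum>l\<in>UNIV. \<bar>?v $ l\<bar>)" by (rule norm_le_l1_cart)
  also have "\<dots> \<le> (\<Sum>(l::'n)\<in>UNIV. \<Sum>(i::'m)\<in>UNIV. \<Sum>(j::'m)\<in>UNIV. (norm z * norm z) * L)"
  proof (rule sum_mono)
    fix l
    have "\<bar>?v $ l\<bar> \<le> (\<Sum>i\<in>UNIV. \<bar>\<Sum>j\<in>UNIV. z $ i * z $ j * S l i j\<bar>)" by simp
    also have "\<dots> \<le> (\<Sum>i\<in>UNIV. \<Sum>j\<in>UNIV. \<bar>z $ i * z $ j * S l i j\<bar>)" by (intro sum_mono sum_abs)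
    also have "\<dots> \<le> (\<Sum>(i::'m)\<in>UNIV. \<Sum>(j::'m)\<in>UNIV. (norm z * norm z) * L)"
      unfolding abs_mult using assms component_le_norm_cart[of z] by (intro sum_mono mult_mono) auto
    finally show "\<bar>?v $ l\<bar> \<le> (\<Sum>(i::'m)\<in>UNIV. \<Sum>(j::'m)\<in>UNIV. (norm z * norm z) * L)" .
  qed
  finally show ?thesis by (simp add: power2_eq_square mult_ac)
qed

definition field_bound :: "(real^'n \<Rightarrow> real^'m^'n) \<Rightarrow> (real^'n) set \<Rightarrow> real \<Rightarrow> bool" where
  "field_bound \<sigma> B L \<longleftrightarrow> L \<ge> 0 \<and>
     (\<forall>x\<in>B. \<forall>z. norm (\<sigma> x *v z) \<le> L * norm z \<and> norm (field_drift \<sigma> x z) \<le> L * (norm z)\<^sup>2) \<and>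
     (\<forall>x\<in>B. \<forall>y\<in>B. \<forall>z. norm (\<sigma> x *v z - \<sigma> y *v z) \<le> L * norm (x - y) * norm z \<and>
        norm (field_drift \<sigma> x z - field_drift \<sigma> y z) \<le> L * norm (x - y) * (norm z)\<^sup>2)"

text \<open>The drift contains products of coefficients with their gradients, so this is where the
  Lipschitz continuity of the gradients enters.\<close>

lemma field_bound_exists:
  fixes \<sigma> :: "real^'n \<Rightarrow> real^'m^'n"
  assumes \<sigma>: "\<And>i j. C11_closure \<Omega> (\<lambda>x. \<sigma> x $ i $ j)" and sub: "cball c \<rho> \<subseteq> \<Omega>" and \<rho>: "\<rho> \<ge> 0"
  shows "\<exists>L. field_bound \<sigma> (cball c \<rho>) L"
proof -
  let ?B = "cball c \<rho>"
  define S where "S x l i j = column i (\<sigma> x) \<bullet> grad (\<lambda>y. \<sigma> y $ l $ j) x" for x l i j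
  have "lip_bdd_on ?B (\<lambda>x. S x l i j)" for l i j
  proof -
    have "lip_bdd_on ?B (\<lambda>x. \<Sum>k\<in>UNIV. \<sigma> x $ k $ i * grad (\<lambda>y. \<sigma> y $ l $ j) x $ k)"
      by (intro lip_bdd_on_sum lip_bdd_on_mult C11_closure_lip_bdd_on[OF \<sigma> sub \<rho>]) auto
    then show ?thesis by (simp add: S_def inner_vec_def column_def)
  qed
  then have "lip_bdd_on ?B (\<lambda>x. S x (fst t) (fst (snd t)) (snd (snd t)))" for t .
  then obtain L1 where L1: "L1 \<ge> 0" "\<And>t x. t \<in> UNIV \<Longrightarrow> x \<in> ?B \<Longrightarrow> \<bar>S x (fst t) (fst (snd t)) (snd (snd t))\<bar> \<le> L1"
    "\<And>t x y. t \<in> UNIV \<Longrightarrow> x \<in> ?B \<Longrightarrow> y \<in> ?B \<Longrightarrow> \<bar>S x (fst t) (fst (snd t)) (snd (snd t)) - S y (fst t) (fst (snd t)) (snd (snd t))\<bar> \<le> L1 * norm (x - y)"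
    by (rule lip_bdd_on_uniform[of "UNIV :: ('n \<times> 'm \<times> 'm) set" ?B "\<lambda>t x. S x (fst t) (fst (snd t)) (snd (snd t))", OF finite]) (rule that, assumption+)
  have L1a: "\<bar>S x l i j\<bar> \<le> L1" if "x \<in> ?B" for x l i j using L1(2)[OF UNIV_I that, of "(l, i, j)"] by simp
  have L1b: "\<bar>S x l i j - S y l i j\<bar> \<le> L1 * norm (x - y)" if "x \<in> ?B" "y \<in> ?B" for x y l i j
    using L1(3)[OF UNIV_I that, of "(l, i, j)"] by simp
  have "lip_bdd_on ?B (\<lambda>x. \<sigma> x $ (fst t) $ (snd t))" for t by (rule C11_closure_lip_bdd_on[OF \<sigma> sub \<rho>])
  then obtain L2 where L2: "L2 \<ge> 0" "\<And>t x. t \<in> UNIV \<Longrightarrow> x \<in> ?B \<Longrightarrow> \<bar>\<sigma> x $ (fst t) $ (snd t)\<bar> \<le> L2"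
    "\<And>t x y. t \<in> UNIV \<Longrightarrow> x \<in> ?B \<Longrightarrow> y \<in> ?B \<Longrightarrow> \<bar>\<sigma> x $ (fst t) $ (snd t) - \<sigma> y $ (fst t) $ (snd t)\<bar> \<le> L2 * norm (x - y)"
    by (rule lip_bdd_on_uniform[of "UNIV :: ('n \<times> 'm) set" ?B "\<lambda>t x. \<sigma> x $ (fst t) $ (snd t)", OF finite]) (rule that, assumption+)
  have L2a: "\<bar>\<sigma> x $ i $ j\<bar> \<le> L2" if "x \<in> ?B" for x i j using L2(2)[OF UNIV_I that, of "(i, j)"] by simp
  have L2b: "\<bar>(\<sigma> x - \<sigma> y) $ i $ j\<bar> \<le> L2 * norm (x - y)" if "x \<in> ?B" "y \<in> ?B" for x y i j
    using L2(3)[OF UNIV_I that, of "(i, j)"] by simp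
  define N where "N = real CARD('n) * real CARD('m)"
  define N' where "N' = real CARD('n) * (real CARD('m) * real CARD('m))"
  have N: "N \<ge> 0" "N' \<ge> 0" by (auto simp: N_def N'_def)
  define L where "L = N * L2 + N' * L1"
  have le: "N * L2 \<le> L" "N' * L1 \<le> L" "L \<ge> 0" using L1(1) L2(1) N by (auto simp: L_def)
  have drift: "field_drift \<sigma> x z = (\<chi> l. \<Sum>i\<in>UNIV. \<Sum>j\<in>UNIV. z $ i * z $ j * S x l i j)" for x z
    by (simp add: field_drift_def S_def)
  show ?thesis
    unfolding field_bound_def
  proof (intro exI[of _ L] conjI ballI allI le(3))
    fix x z assume x: "x \<in> ?B"
    have "norm (\<sigma> x *v z) \<le> N * L2 * norm z" unfolding N_def using norm_field_le[OF L2a[OF x]] .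
    also have "\<dots> \<le> L * norm z" using le by (intro mult_right_mono) auto
    finally show "norm (\<sigma> x *v z) \<le> L * norm z" .
    have "norm (field_drift \<sigma> x z) \<le> N' * L1 * (norm z)\<^sup>2" unfolding N'_def drift by (rule norm_drift_le[OF L1a[OF x]])
    also have "\<dots> \<le> L * (norm z)\<^sup>2" using le by (intro mult_right_mono) auto
    finally show "norm (field_drift \<sigma> x z) \<le> L * (norm z)\<^sup>2" .
    fix y assume y: "y \<in> ?B"
    have "norm ((\<sigma> x - \<sigma> y) *v z) \<le> N * (L2 * norm (x - y)) * norm z" unfolding N_def using norm_field_le[OF L2b[OF x y]] .
    also have "\<dots> = (N * L2) * (norm (x - y) * norm z)" by simp
    also have "\<dots> \<le> L * (norm (x - y) * norm z)" using le by (intro mult_right_mono) auto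
    finally show "norm (\<sigma> x *v z - \<sigma> y *v z) \<le> L * norm (x - y) * norm z"
      by (simp add: matrix_vector_mult_diff_rdistrib mult.assoc)
    have "field_drift \<sigma> x z - field_drift \<sigma> y z = (\<chi> l. \<Sum>i\<in>UNIV. \<Sum>j\<in>UNIV. z $ i * z $ j * (S x l i j - S y l i j))"
      by (simp add: drift vec_eq_iff right_diff_distrib sum_subtractf)
    then have "norm (field_drift \<sigma> x z - field_drift \<sigma> y z) \<le> N' * (L1 * norm (x - y)) * (norm z)\<^sup>2"
      unfolding N'_def using norm_drift_le[OF L1b[OF x y]] by simp
    also have "\<dots> = (N' * L1) * (norm (x - y) * (norm z)\<^sup>2)" by simp
    also have "\<dots> \<le> L * (norm (x - y) * (norm z)\<^sup>2)" using le by (intro mult_right_mono) auto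
    finally show "norm (field_drift \<sigma> x z - field_drift \<sigma> y z) \<le> L * norm (x - y) * (norm z)\<^sup>2" by (simp add: mult.assoc)
  qed
qed

section \<open>The comparison argument\<close>

lemma block_quadratic_form:
  fixes A B C D :: "real^'n^'n" and z :: "real^('n + 'n)"
  defines "h \<equiv> (\<chi> a. z $ Inl a)" and "k \<equiv> (\<chi> a. z $ Inr a)"
  shows "z \<bullet> (block A B C D *v z) = h \<bullet> (A *v h) + h \<bullet> (B *v k) + k \<bullet> (C *v h) + k \<bullet> (D *v k)"
proof -
  have sum2: "(\<Sum>i\<in>UNIV. f i) = (\<Sum>a\<in>UNIV. f (Inl a)) + (\<Sum>a\<in>UNIV. f (Inr a))" for f :: "'n + 'n \<Rightarrow> real"
    unfolding UNIV_Plus_UNIV[symmetric] by (subst sum.Plus) auto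
  show ?thesis
    by (simp add: block_def inner_vec_def matrix_vector_mult_def sum2 h_def k_def sum.distrib distrib_left)
qed

lemma uminus_matrix_vector_mult: "(- A) *v x = - (A *v (x :: real^'n))"
  by (simp add: matrix_vector_mult_def vec_eq_iff sum_negf)

lemma mat_le_block_lower:
  fixes X Y :: "real^'n^'n"
  assumes "\<And>h k. - c * ((norm h)\<^sup>2 + (norm k)\<^sup>2) \<le> h \<bullet> (X *v h) - k \<bullet> (Y *v k)"
  shows "- c *\<^sub>R block (mat 1) 0 0 (mat 1) \<preceq> block X 0 0 (- Y)"
  unfolding mat_le_def scaleR_matrix_vector_assoc[symmetric] inner_scaleR_right block_quadratic_form
  using assms by (simp add: power2_norm_eq_inner uminus_matrix_vector_mult)

lemma mat_le_block_upper:
  fixes X Y :: "real^'n^'n"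
  assumes "\<And>h k. h \<bullet> (X *v h) - k \<bullet> (Y *v k) \<le> c * (norm (h - k))\<^sup>2"
  shows "block X 0 0 (- Y) \<preceq> c *\<^sub>R block (mat 1) (- mat 1) (- mat 1) (mat 1)"
  unfolding mat_le_def scaleR_matrix_vector_assoc[symmetric] inner_scaleR_right block_quadratic_form
proof
  fix z :: "real^('n + 'n)"
  let ?h = "\<chi> a. z $ Inl a" and ?k = "\<chi> a. z $ Inr a"
  show "?h \<bullet> (X *v ?h) + ?h \<bullet> (0 *v ?k) + ?k \<bullet> (0 *v ?h) + ?k \<bullet> (- Y *v ?k)
      \<le> c * (?h \<bullet> (mat 1 *v ?h) + ?h \<bullet> (- mat 1 *v ?k) + ?k \<bullet> (- mat 1 *v ?h) + ?k \<bullet> (mat 1 *v ?k))"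
    using assms[of ?h ?k]
    unfolding norm_diff_sq by (simp add: power2_norm_eq_inner uminus_matrix_vector_mult inner_commute[of ?k ?h])
qed

lemma symmetric_matrix_of_form:
  fixes F :: "real^'n \<Rightarrow> real^'n"
  assumes "bounded_linear F"
  obtains X where "X \<in> Sym" "\<And>h. h \<bullet> (X *v h) = F h \<bullet> h"
proof -
  have lin: "linear F" using assms by (rule bounded_linear.linear)
  define X where "X = (1/2) *\<^sub>R (matrix F + transpose (matrix F))"
  have "X \<in> Sym" by (simp add: X_def Sym_def transpose_def vec_eq_iff add.commute)
  moreover have "h \<bullet> (X *v h) = F h \<bullet> h" for h
  proof -
    have "h \<bullet> (transpose (matrix F) *v h) = F h \<bullet> h"
      using dot_lmul_matrix[of h "matrix F" h] lin by (simp add: matrix_works inner_commute flip: vector_transpose_matrix)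
    then show ?thesis
      using lin by (simp add: X_def scaleR_matrix_vector_assoc[symmetric] matrix_vector_mult_add_rdistrib inner_add_right matrix_works inner_commute)
  qed
  ultimately show thesis by (rule that)
qed

text \<open>Polarization on unit vectors bounds each entry by \<open>c\<close>. This turns the
  bounds on the forms into a priori bounds that confine the matrices to a compact set.\<close>

lemma norm_Sym_le:
  fixes X :: "real^'n^'n"
  assumes X: "X \<in> Sym" and b: "\<And>h. \<bar>h \<bullet> (X *v h)\<bar> \<le> c * (norm h)\<^sup>2"
  shows "norm X \<le> real CARD('n) * real CARD('n) * c"
proof -
  have entry: "\<bar>X $ i $ j\<bar> \<le> c" for i j
  proof -
    let ?i = "axis i 1 :: real^'n" and ?j = "axis j 1 :: real^'n"
    have "4 * X $ i $ j = (?i + ?j) \<bullet> (X *v (?i + ?j)) - (?i - ?j) \<bullet> (X *v (?i - ?j))"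
    proof -
      have "?i \<bullet> (X *v ?j) = X $ i $ j" by (simp add: matrix_vector_mult_basis inner_axis' column_def)
      moreover have "?j \<bullet> (X *v ?i) = X $ i $ j" using calculation Sym_inner_commute[OF X, of ?j ?i] by (simp add: inner_commute)
      ultimately show ?thesis
        by (simp add: matrix_vector_right_distrib matrix_vector_mult_diff_distrib inner_add_left inner_add_right inner_diff_left inner_diff_right)
    qed
    moreover have "(norm (?i + ?j))\<^sup>2 + (norm (?i - ?j))\<^sup>2 = 4"
      by (simp add: power2_norm_eq_inner inner_add_left inner_add_right inner_diff_left inner_diff_right)
    then have "c * (norm (?i + ?j))\<^sup>2 + c * (norm (?i - ?j))\<^sup>2 = 4 * c" by (metis distrib_left mult.commute)
    ultimately show ?thesis using b[of "?i + ?j"] b[of "?i - ?j"] by linarith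
  qed
  have "norm X \<le> (\<Sum>i\<in>UNIV. norm (X $ i))" by (simp add: norm_vec_def L2_set_le_sum)
  also have "\<dots> \<le> (\<Sum>(i::'n)\<in>UNIV. \<Sum>(j::'n)\<in>UNIV. c)"
  proof (rule sum_mono)
    fix i
    have "norm (X $ i) \<le> (\<Sum>j\<in>UNIV. \<bar>X $ i $ j\<bar>)" by (rule norm_le_l1_cart)
    also have "\<dots> \<le> (\<Sum>(j::'n)\<in>UNIV. c)" using entry by (intro sum_mono)
    finally show "norm (X $ i) \<le> (\<Sum>(j::'n)\<in>UNIV. c)" .
  qed
  finally show ?thesis by simp
qed

lemma closed_Sym: "closed (Sym :: (real^'n^'n) set)"
proof -
  have eq: "Sym = (\<Inter>i. \<Inter>j. {A :: real^'n^'n. A $ j $ i = A $ i $ j})"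
    by (auto simp: Sym_def transpose_def vec_eq_iff)
  show ?thesis unfolding eq
    by (intro closed_INT ballI closed_Collect_eq continuous_intros)
qed

lemma Sym_add_scaled_id:
  assumes "(X :: real^'n^'n) \<in> Sym"
  shows "X + r *\<^sub>R mat 1 \<in> Sym" "X - r *\<^sub>R mat 1 \<in> Sym"
  using assms by (auto simp: Sym_def transpose_def vec_eq_iff mat_def)

lemma add_scaled_id_mult:
  fixes X :: "real^'n^'n"
  shows "(X + r *\<^sub>R mat 1) *v h = X *v h + r *\<^sub>R h" "(X - r *\<^sub>R mat 1) *v h = X *v h - r *\<^sub>R h"
  by (simp_all add: matrix_vector_mult_add_rdistrib matrix_vector_mult_diff_rdistrib scaleR_matrix_vector_assoc[symmetric])

text \<open>Serves to exchange the jets actually reached, which carry errors of size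
  \<open>r\<close>, for the exact arguments of the structure condition. The domain is not compact,
  hence the bound \<open>R\<close> on the arguments.\<close>

lemma K_uniformly_continuous:
  fixes K :: "real^'n \<Rightarrow> real \<Rightarrow> real^'n \<Rightarrow> real^'n^'n \<Rightarrow> real"
  assumes K: "continuous_on (C \<times> UNIV \<times> UNIV \<times> Sym) (\<lambda>(x, r, p, X). K x r p X)"
    and C: "compact C" and \<eta>: "\<eta> > 0"
  obtains d where "d > 0"
    "\<And>x s p q X Y. x \<in> C \<Longrightarrow> \<bar>s\<bar> \<le> R \<Longrightarrow> norm p \<le> R \<Longrightarrow> norm q \<le> R \<Longrightarrow> X \<in> Sym \<Longrightarrow> Y \<in> Sym \<Longrightarrow>
      norm X \<le> R \<Longrightarrow> norm Y \<le> R \<Longrightarrow> norm (p - q) < d \<Longrightarrow> norm (X - Y) < d \<Longrightarrow> \<bar>K x s p X - K x s q Y\<bar> < \<eta>"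
proof -
  let ?S = "C \<times> {-R..R} \<times> cball (0 :: real^'n) R \<times> (cball (0 :: real^'n^'n) R \<inter> Sym)"
  have "compact ?S" using C closed_Sym by (intro compact_Times compact_Int_closed compact_Icc compact_cball)
  moreover have "continuous_on ?S (\<lambda>(x, r, p, X). K x r p X)" by (rule continuous_on_subset[OF K]) auto
  ultimately have "uniformly_continuous_on ?S (\<lambda>(x, r, p, X). K x r p X)" by (rule compact_uniformly_continuous[rotated])
  then obtain d where d: "d > 0" "\<And>a b. a \<in> ?S \<Longrightarrow> b \<in> ?S \<Longrightarrow> dist b a < d \<Longrightarrow>
      dist ((\<lambda>(x, r, p, X). K x r p X) b) ((\<lambda>(x, r, p, X). K x r p X) a) < \<eta>"
    using \<eta> unfolding uniformly_continuous_on_def by metis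
  show thesis
  proof (rule that[of "d / 2"])
    fix x p q :: "real^'n" and s and X Y :: "real^'n^'n"
    assume a: "x \<in> C" "\<bar>s\<bar> \<le> R" "norm p \<le> R" "norm q \<le> R" "X \<in> Sym" "Y \<in> Sym" "norm X \<le> R" "norm Y \<le> R"
      "norm (p - q) < d / 2" "norm (X - Y) < d / 2"
    have "dist (x, s, p, X) (x, s, q, Y) \<le> dist p q + dist X Y"
      by (simp add: dist_Pair_Pair sqrt_sum_squares_le_sum)
    then have "dist (x, s, p, X) (x, s, q, Y) < d" using a by (simp add: dist_norm)
    moreover have "(x, s, p, X) \<in> ?S" "(x, s, q, Y) \<in> ?S" using a by auto
    ultimately show "\<bar>K x s p X - K x s q Y\<bar> < \<eta>" using d(2) by (fastforce simp: dist_real_def)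
  qed (use d in simp)
qed

text \<open>Everything that one value of \<epsilon> yields. \<open>X\<close> and \<open>Y\<close>
  satisfy the block inequalities exactly, whereas the jets have the slopes \<open>q1\<close>,
  \<open>q2\<close> and matrices shifted by \<open>r\<close>; the last clause accounts for the
  difference in \<open>K\<close>, up to \<eta>, at all zero order arguments of size at most
  \<open>R\<close>.\<close>

definition penalized_contact where
  "penalized_contact C u v K R \<epsilon> \<eta> x y q1 q2 X Y r \<longleftrightarrow>
    x \<in> C \<and> y \<in> C \<and> X \<in> Sym \<and> Y \<in> Sym \<and> 0 < r \<and> r \<le> \<eta> \<and>
    (\<forall>a\<in>C. \<forall>b\<in>C. u a - v b - (norm (a - b))\<^sup>2 / (2 * \<epsilon>) \<le> u x - v y - (norm (x - y))\<^sup>2 / (2 * \<epsilon>) + r) \<and>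
    norm (q1 - (x - y) /\<^sub>R \<epsilon>) \<le> r \<and> norm (q2 - (x - y) /\<^sub>R \<epsilon>) \<le> r \<and>
    (\<exists>d>0. \<forall>x'\<in>C. norm (x' - x) < d \<longrightarrow> u x' \<le> u x + quadratic x q1 (X + r *\<^sub>R mat 1) x') \<and>
    (\<exists>d>0. \<forall>y'\<in>C. norm (y' - y) < d \<longrightarrow> v y' \<ge> v y + quadratic y q2 (Y - r *\<^sub>R mat 1) y') \<and>
    (\<forall>h k. h \<bullet> (X *v h) - k \<bullet> (Y *v k) \<le> 3 / \<epsilon> * (norm (h - k))\<^sup>2) \<and>
    - (3 / \<epsilon>) *\<^sub>R block (mat 1) 0 0 (mat 1) \<preceq> block X 0 0 (- Y) \<and>
    block X 0 0 (- Y) \<preceq> (3 / \<epsilon>) *\<^sub>R block (mat 1) (- mat 1) (- mat 1) (mat 1) \<and>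
    (\<forall>s. \<bar>s\<bar> \<le> R \<longrightarrow> K x s ((x - y) /\<^sub>R \<epsilon>) X - \<eta> \<le> K x s q1 (X + r *\<^sub>R mat 1) \<and>
       K y s q2 (Y - r *\<^sub>R mat 1) \<le> K y s ((x - y) /\<^sub>R \<epsilon>) Y + \<eta>)"

lemma penalized_contact_exists:
  fixes u v :: "real^'n \<Rightarrow> real" and K :: "real^'n \<Rightarrow> real \<Rightarrow> real^'n \<Rightarrow> real^'n^'n \<Rightarrow> real"
  assumes C: "compact C" "C \<noteq> {}" and u: "usc_on C u" and v: "lsc_on C v"
    and K: "continuous_on (C \<times> UNIV \<times> UNIV \<times> Sym) (\<lambda>(x, r, p, X). K x r p X)"
    and eps: "\<epsilon> > 0" and \<eta>: "\<eta> > 0"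
  shows "\<exists>x y q1 q2 X Y r. penalized_contact C u v K R \<epsilon> \<eta> x y q1 q2 X Y r"
proof -
  obtain R1 where R1: "R1 > 0" "\<And>x. x \<in> C \<Longrightarrow> norm x \<le> R1"
    using compact_imp_bounded[OF C(1)] bounded_pos by blast
  define N where "N = real CARD('n) * real CARD('n) * (3 / \<epsilon>)"
  define I where "I = norm (mat 1 :: real^'n^'n)"
  \<comment> \<open>A priori bounds available before \<open>r\<close> is chosen: the slopes are
    within 1 of \<open>(x - y) /\<^sub>R \<epsilon>\<close>, the matrices within \<open>I\<close> of
    matrices of norm at most \<open>N\<close>.\<close>
  define R' where "R' = \<bar>R\<bar> + (2 * R1 / \<epsilon> + 1) + (N + I)"
  have N0: "N \<ge> 0" "I \<ge> 0" using eps by (auto simp: N_def I_def)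
  have R1e: "2 * R1 / \<epsilon> > 0" using R1(1) eps by simp
  obtain d where d: "d > 0" "\<And>x s p q X Y. x \<in> C \<Longrightarrow> \<bar>s\<bar> \<le> R' \<Longrightarrow> norm p \<le> R' \<Longrightarrow> norm q \<le> R' \<Longrightarrow> X \<in> Sym \<Longrightarrow> Y \<in> Sym \<Longrightarrow>
      norm X \<le> R' \<Longrightarrow> norm Y \<le> R' \<Longrightarrow> norm (p - q) < d \<Longrightarrow> norm (X - Y) < d \<Longrightarrow> \<bar>K x s p X - K x s q Y\<bar> < \<eta>"
    by (rule K_uniformly_continuous[OF K C(1) \<eta>, of R']) blast
  \<comment> \<open>Makes both \<open>r\<close> and \<open>r * I\<close>, the perturbations of slope
    and matrix, smaller than \<open>d\<close>.\<close>
  define r where "r = min (min 1 \<eta>) (d / (2 * (I + 1)))"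
  have r: "r > 0" "r \<le> 1" "r \<le> \<eta>" "r < d" "r * I < d"
  proof -
    have "d / (2 * (I + 1)) > 0" using d(1) N0 by simp
    then show "r > 0" using \<eta> by (simp add: r_def)
    show "r \<le> 1" "r \<le> \<eta>" by (auto simp: r_def)
    have *: "r \<le> d / (2 * (I + 1))" by (simp add: r_def)
    then have "r * (2 * (I + 1)) \<le> d" using N0 by (simp add: pos_le_divide_eq)
    then have "r * I + (r * I + (r + r)) \<le> d" by (simp add: algebra_simps)
    moreover have "r * I \<ge> 0" using \<open>r > 0\<close> N0 by simp
    ultimately show "r < d" "r * I < d" using \<open>r > 0\<close> by linarith+
  qed
  obtain x y q1 q F H where xy: "x \<in> C" "y \<in> C" and FH: "bounded_linear F" "bounded_linear H"
    and approx': "\<And>a b. a \<in> C \<Longrightarrow> b \<in> C \<Longrightarrow> u a + - v b - (norm (a - b))\<^sup>2 / (2 * \<epsilon>) \<le> u x + - v y - (norm (x - y))\<^sup>2 / (2 * \<epsilon>) + r"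
    and q1: "norm (q1 - (x - y) /\<^sub>R \<epsilon>) \<le> r" and q': "norm (q + (x - y) /\<^sub>R \<epsilon>) \<le> r"
    and ju: "\<exists>d>0. \<forall>x'\<in>C. norm (x' - x) < d \<longrightarrow>
       u x' \<le> u x + q1 \<bullet> (x' - x) + F (x' - x) \<bullet> (x' - x) / 2 + r / 2 * (norm (x' - x))\<^sup>2"
    and jv: "\<exists>d>0. \<forall>y'\<in>C. norm (y' - y) < d \<longrightarrow>
       - v y' \<le> - v y + q \<bullet> (y' - y) + H (y' - y) \<bullet> (y' - y) / 2 + r / 2 * (norm (y' - y))\<^sup>2"
    and up': "\<And>h k. F h \<bullet> h + H k \<bullet> k \<le> 3 / \<epsilon> * (norm (h - k))\<^sup>2"
    and lowF: "\<And>h. - (3 / \<epsilon>) * (norm h)\<^sup>2 \<le> F h \<bullet> h"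
    and lowH: "\<And>k. - (3 / \<epsilon>) * (norm k)\<^sup>2 \<le> H k \<bullet> k"
    by (rule theorem_on_sums[OF C u v[folded usc_on_uminus_iff] eps r(1)]) (rule that, assumption+)
  \<comment> \<open>The theorem on sums was applied to \<open>- v\<close>, so its slope and form
    change sign.\<close>
  define q2 where "q2 = - q"
  define G where "G k = - H k" for k
  have "q2 - (x - y) /\<^sub>R \<epsilon> = - (q + (x - y) /\<^sub>R \<epsilon>)" by (simp add: q2_def)
  then have q: "norm (q1 - (x - y) /\<^sub>R \<epsilon>) \<le> r" "norm (q2 - (x - y) /\<^sub>R \<epsilon>) \<le> r"
    using q1 q' by (simp_all only: norm_minus_cancel)
  have FG: "bounded_linear F" "bounded_linear G" using FH by (auto simp: G_def[abs_def] intro: bounded_linear_minus)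
  have approx: "u a - v b - (norm (a - b))\<^sup>2 / (2 * \<epsilon>) \<le> u x - v y - (norm (x - y))\<^sup>2 / (2 * \<epsilon>) + r"
    if "a \<in> C" "b \<in> C" for a b using approx'[OF that] by simp
  have up: "F h \<bullet> h - G k \<bullet> k \<le> 3 / \<epsilon> * (norm (h - k))\<^sup>2" for h k using up'[of h k] by (simp add: G_def)
  have uppG: "G k \<bullet> k \<le> 3 / \<epsilon> * (norm k)\<^sup>2" for k using lowH[of k] by (simp add: G_def)
  obtain X where X: "X \<in> Sym" "\<And>h. h \<bullet> (X *v h) = F h \<bullet> h" using symmetric_matrix_of_form[OF FG(1)] by blast
  obtain Y where Y: "Y \<in> Sym" "\<And>h. h \<bullet> (Y *v h) = G h \<bullet> h" using symmetric_matrix_of_form[OF FG(2)] by blast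
  have zero: "F 0 = 0" "G 0 = 0" using FG by (auto simp: linear_0 bounded_linear.linear)
  have nX: "norm X \<le> N" unfolding N_def
  proof (rule norm_Sym_le[OF X(1)])
    fix h show "\<bar>h \<bullet> (X *v h)\<bar> \<le> 3 / \<epsilon> * (norm h)\<^sup>2"
      using lowF[of h] up[of h 0] zero by (simp add: X(2) abs_le_iff)
  qed
  have nY: "norm Y \<le> N" unfolding N_def
  proof (rule norm_Sym_le[OF Y(1)])
    fix h show "\<bar>h \<bullet> (Y *v h)\<bar> \<le> 3 / \<epsilon> * (norm h)\<^sup>2"
      using uppG[of h] up[of 0 h] zero by (simp add: Y(2) abs_le_iff)
  qed
  let ?p = "(x - y) /\<^sub>R \<epsilon>"
  have np: "norm ?p \<le> 2 * R1 / \<epsilon>"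
  proof -
    have "norm (x - y) \<le> 2 * R1" using norm_triangle_ineq4[of x y] R1(2)[OF xy(1)] R1(2)[OF xy(2)] by linarith
    then show ?thesis using eps by (simp add: divide_inverse mult.commute mult_left_mono)
  qed
  have nq: "norm q1 \<le> R'" "norm q2 \<le> R'" "norm ?p \<le> R'"
    using norm_triangle_ineq2[of q1 ?p] norm_triangle_ineq2[of q2 ?p] np q r(2) N0 unfolding R'_def by linarith+
  have rI: "norm (r *\<^sub>R (mat 1 :: real^'n^'n)) = r * I" using r(1) by (simp add: I_def)
  have nXr: "norm (X + r *\<^sub>R mat 1) \<le> R'" "norm (Y - r *\<^sub>R mat 1) \<le> R'" "norm X \<le> R'" "norm Y \<le> R'"
    using norm_triangle_ineq[of X "r *\<^sub>R mat 1"] norm_triangle_ineq4[of Y "r *\<^sub>R mat 1"] nX nY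
      mult_right_mono[OF r(2) N0(2)] R1e N0 unfolding rI R'_def by linarith+
  have Kx: "K x s ?p X - \<eta> \<le> K x s q1 (X + r *\<^sub>R mat 1)" "K y s q2 (Y - r *\<^sub>R mat 1) \<le> K y s ?p Y + \<eta>" if "\<bar>s\<bar> \<le> R" for s
  proof -
    have s: "\<bar>s\<bar> \<le> R'" using that N0 R1e unfolding R'_def by linarith
    have "\<bar>K x s q1 (X + r *\<^sub>R mat 1) - K x s ?p X\<bar> < \<eta>"
      using q r rI by (intro d(2) xy s nq nXr X Sym_add_scaled_id) auto
    moreover have "\<bar>K y s q2 (Y - r *\<^sub>R mat 1) - K y s ?p Y\<bar> < \<eta>"
      using q r rI by (intro d(2) xy s nq nXr Y Sym_add_scaled_id) auto
    ultimately show "K x s ?p X - \<eta> \<le> K x s q1 (X + r *\<^sub>R mat 1)" "K y s q2 (Y - r *\<^sub>R mat 1) \<le> K y s ?p Y + \<eta>" by linarith+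
  qed
  have low: "- (3 / \<epsilon>) *\<^sub>R block (mat 1) 0 0 (mat 1) \<preceq> block X 0 0 (- Y)"
  proof (rule mat_le_block_lower)
    fix h k show "- (3 / \<epsilon>) * ((norm h)\<^sup>2 + (norm k)\<^sup>2) \<le> h \<bullet> (X *v h) - k \<bullet> (Y *v k)"
      using lowF[of h] uppG[of k] unfolding X(2) Y(2) by (simp add: distrib_left)
  qed
  have upp: "block X 0 0 (- Y) \<preceq> (3 / \<epsilon>) *\<^sub>R block (mat 1) (- mat 1) (- mat 1) (mat 1)"
    by (rule mat_le_block_upper) (unfold X(2) Y(2), rule up)
  have qu: "q1 \<bullet> h + F h \<bullet> h / 2 + r / 2 * (norm h)\<^sup>2 = q1 \<bullet> h + h \<bullet> ((X + r *\<^sub>R mat 1) *v h) / 2" for h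
    by (simp add: add_scaled_id_mult inner_add_right X(2) power2_norm_eq_inner add_divide_distrib)
  have qv: "q \<bullet> h + H h \<bullet> h / 2 + r / 2 * (norm h)\<^sup>2 = - (q2 \<bullet> h + h \<bullet> ((Y - r *\<^sub>R mat 1) *v h) / 2)" for h
    by (simp add: add_scaled_id_mult inner_diff_right Y(2) G_def q2_def power2_norm_eq_inner diff_divide_distrib)
  have ju': "\<exists>d>0. \<forall>x'\<in>C. norm (x' - x) < d \<longrightarrow> u x' \<le> u x + quadratic x q1 (X + r *\<^sub>R mat 1) x'"
    using ju unfolding quadratic_def qu[symmetric] by (simp add: add.assoc)
  have jv': "\<exists>d>0. \<forall>y'\<in>C. norm (y' - y) < d \<longrightarrow> v y' \<ge> v y + quadratic y q2 (Y - r *\<^sub>R mat 1) y'"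
  proof -
    have "- v y' \<le> - v y + q \<bullet> (y' - y) + H (y' - y) \<bullet> (y' - y) / 2 + r / 2 * (norm (y' - y))\<^sup>2
        \<longleftrightarrow> v y + quadratic y q2 (Y - r *\<^sub>R mat 1) y' \<le> v y'" for y'
      using qv[of "y' - y"] unfolding quadratic_def by linarith
    then show ?thesis using jv by simp
  qed
  have upXY: "\<forall>h k. h \<bullet> (X *v h) - k \<bullet> (Y *v k) \<le> 3 / \<epsilon> * (norm (h - k))\<^sup>2" unfolding X(2) Y(2) using up by blast
  have "penalized_contact C u v K R \<epsilon> \<eta> x y q1 q2 X Y r"
    unfolding penalized_contact_def
    by (intro conjI xy X(1) Y(1) r(1) r(3) q ju' jv' upXY low upp ballI allI impI approx Kx)
  then show ?thesis by blast
qed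

text \<open>Since \<open>A\<close> dominates \<gamma> times the identity, the additive error
  \<delta> is a relative one: \<open>B\<close> dominates
  \<open>(1 - \<delta> / \<gamma>) *\<^sub>R A\<close>, and the determinant is monotone. The factor
  \<open>CARD('m)\<close> is the homogeneity of the determinant.\<close>

lemma ln_det_perturbation:
  fixes A B :: "real^'m^'m"
  assumes A: "A \<in> Sym" and B: "B \<in> Sym" and g: "\<gamma> > 0" "\<gamma> *\<^sub>R mat 1 \<preceq> A"
    and AB: "\<And>z. z \<bullet> (A *v z) - \<delta> * (norm z)\<^sup>2 \<le> z \<bullet> (B *v z)" and \<delta>: "0 \<le> \<delta>" "\<delta> < \<gamma>"
  shows "pos_def B" and "real CARD('m) * ln (1 - \<delta> / \<gamma>) + ln (det A) \<le> ln (det B)"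
proof -
  have gA: "\<gamma> * (norm z)\<^sup>2 \<le> z \<bullet> (A *v z)" for z
    using g(2) unfolding mat_le_def scaleR_matrix_vector_assoc[symmetric] by (simp add: power2_norm_eq_inner)
  have posA: "pos_def A"
    unfolding pos_def_def using A gA g(1) by (metis less_le_trans mult_pos_pos zero_less_norm_iff zero_less_power)
  show posB: "pos_def B"
    unfolding pos_def_def
  proof (intro conjI allI impI B)
    fix z :: "real^'m" assume "z \<noteq> 0"
    then have "(\<gamma> - \<delta>) * (norm z)\<^sup>2 > 0" using \<delta> by simp
    then show "0 < z \<bullet> (B *v z)" using AB[of z] gA[of z] by (simp add: algebra_simps)
  qed
  define s where "s = 1 - \<delta> / \<gamma>"
  have s: "s > 0" using \<delta> g(1) by (simp add: s_def)
  have "pos_def (s *\<^sub>R A)"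
    using posA s unfolding pos_def_def by (auto simp: Sym_def scaleR_matrix_vector_assoc[symmetric] transpose_scalar scalar_mult_eq_scaleR transpose_def vec_eq_iff)
  moreover have "s *\<^sub>R A \<preceq> B"
    unfolding mat_le_def
  proof
    fix z
    have "\<delta> * (norm z)\<^sup>2 \<le> \<delta> / \<gamma> * (z \<bullet> (A *v z))"
      using mult_left_mono[OF gA[of z], of "\<delta> / \<gamma>"] \<delta> g(1) by simp
    then show "z \<bullet> (s *\<^sub>R A *v z) \<le> z \<bullet> (B *v z)"
      using AB[of z] by (simp add: s_def scaleR_matrix_vector_assoc[symmetric] left_diff_distrib)
  qed
  ultimately have "det (s *\<^sub>R A) \<le> det B" using posB by (intro det_mono_pos_def)
  moreover have "det (s *\<^sub>R A) = s ^ CARD('m) * det A"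
  proof -
    have "s *\<^sub>R A = (\<chi> i. s *s A $ i)" by (simp add: vec_eq_iff)
    then show ?thesis using det_rows_mul[of "\<lambda>_. s" "\<lambda>i. A $ i"] by simp
  qed
  moreover have dA: "det A > 0" using pos_def_factorization[OF posA] by metis
  moreover have "s ^ CARD('m) * det A > 0" using s dA by simp
  ultimately have "ln (s ^ CARD('m) * det A) \<le> ln (det B)" by simp
  moreover have "ln (s ^ CARD('m) * det A) = real CARD('m) * ln s + ln (det A)"
    using s dA by (simp add: ln_mult ln_realpow)
  ultimately show "real CARD('m) * ln (1 - \<delta> / \<gamma>) + ln (det A) \<le> ln (det B)"
    unfolding s_def[symmetric] by simp
qed

text \<open>The strict inequality at \<open>x\<close> and the inequality at \<open>y\<close> are
  subtracted. Three errors remain on the right: that of the determinants, the modulus of the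
  structure condition, and the exchange of jets in \<open>K\<close>, once at each point.\<close>

lemma contradiction_estimate:
  fixes \<sigma> :: "real^'n \<Rightarrow> real^'m^'n" and u v :: "real^'n \<Rightarrow> real"
    and K :: "real^'n \<Rightarrow> real \<Rightarrow> real^'n \<Rightarrow> real^'n^'n \<Rightarrow> real"
  assumes B: "B \<subseteq> \<Omega>" and \<Omega>: "\<Omega> \<subseteq> C"
    and diff: "\<And>i j x. x \<in> \<Omega> \<Longrightarrow> (\<lambda>y. \<sigma> y $ i $ j) differentiable at x"
    and convex: "\<gamma> > 0" "\<And>\<phi> x. C2_on \<Omega> \<phi> \<and> local_max_at \<Omega> (\<lambda>y. u y - \<phi> y) x \<Longrightarrow> \<gamma> *\<^sub>R mat 1 \<preceq> D2X \<sigma> \<phi> x"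
    and sub: "strict_subsolution \<Omega> \<sigma> K B \<gamma>\<^sub>1 u"
    and super: "supersolution \<Omega> \<sigma> K v"
    and Kmono: "\<And>x r s p X. x \<in> \<Omega> \<Longrightarrow> X \<in> Sym \<Longrightarrow> r \<le> s \<Longrightarrow> K x r p X \<le> K x s p X"
    and K\<omega>: "\<And>\<epsilon> x y r X Y. \<epsilon> > 0 \<Longrightarrow> x \<in> C \<Longrightarrow> y \<in> C \<Longrightarrow> X \<in> Sym \<Longrightarrow> Y \<in> Sym \<Longrightarrow>
      - (3 / \<epsilon>) *\<^sub>R block (mat 1) 0 0 (mat 1) \<preceq> block X 0 0 (- Y) \<Longrightarrow>
      block X 0 0 (- Y) \<preceq> (3 / \<epsilon>) *\<^sub>R block (mat 1) (- mat 1) (- mat 1) (mat 1) \<Longrightarrow>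
      K y r ((x - y) /\<^sub>R \<epsilon>) Y - K x r ((x - y) /\<^sub>R \<epsilon>) X \<le> \<omega> (norm (x - y) * (1 + norm (x - y) / \<epsilon>))"
    and fb: "field_bound \<sigma> B L" and xy: "x \<in> B" "y \<in> B" and eps: "\<epsilon> > 0"
    and pc: "penalized_contact C u v K b \<epsilon> \<eta> x y q1 q2 X Y r"
    and uv: "v y \<le> u x" and vb: "\<bar>v y\<bar> \<le> b"
    and \<delta>: "\<delta> = (3 * L\<^sup>2 + L) * ((norm (x - y))\<^sup>2 / \<epsilon>) + (2 * L + 2 * L\<^sup>2) * r" "\<delta> < \<gamma>"
  shows "\<gamma>\<^sub>1 \<le> - (real CARD('m) * ln (1 - \<delta> / \<gamma>)) + (\<omega> (norm (x - y) * (1 + norm (x - y) / \<epsilon>)) + 2 * \<eta>)"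
proof -
  have XY: "X \<in> Sym" "Y \<in> Sym" and r: "r > 0"
    and q: "norm (q1 - (x - y) /\<^sub>R \<epsilon>) \<le> r" "norm (q2 - (x - y) /\<^sub>R \<epsilon>) \<le> r"
    and ju: "\<exists>d>0. \<forall>x'\<in>C. norm (x' - x) < d \<longrightarrow> u x' \<le> u x + quadratic x q1 (X + r *\<^sub>R mat 1) x'"
    and jv: "\<exists>d>0. \<forall>y'\<in>C. norm (y' - y) < d \<longrightarrow> v y' \<ge> v y + quadratic y q2 (Y - r *\<^sub>R mat 1) y'"
    and up: "h \<bullet> (X *v h) - k \<bullet> (Y *v k) \<le> 3 / \<epsilon> * (norm (h - k))\<^sup>2" for h k
    using pc unfolding penalized_contact_def by simp_all
  have L: "L \<ge> 0"
    "norm (\<sigma> x *v z) \<le> L * norm z" "norm (\<sigma> y *v z) \<le> L * norm z"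
    "norm (\<sigma> x *v z - \<sigma> y *v z) \<le> L * norm (x - y) * norm z"
    "norm (field_drift \<sigma> x z) \<le> L * (norm z)\<^sup>2" "norm (field_drift \<sigma> y z) \<le> L * (norm z)\<^sup>2"
    "norm (field_drift \<sigma> x z - field_drift \<sigma> y z) \<le> L * norm (x - y) * (norm z)\<^sup>2" for z
    using fb xy unfolding field_bound_def by blast+
  let ?\<phi> = "quadratic x q1 (X + r *\<^sub>R mat 1)" and ?\<psi> = "quadratic y q2 (Y - r *\<^sub>R mat 1)"
  let ?A = "D2X \<sigma> ?\<phi> x" and ?B = "D2X \<sigma> ?\<psi> y"
  have S: "X + r *\<^sub>R mat 1 \<in> Sym" "Y - r *\<^sub>R mat 1 \<in> Sym" using XY Sym_add_scaled_id by auto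
  have in\<Omega>: "x \<in> \<Omega>" "y \<in> \<Omega>" using xy B by auto
  have lmax: "local_max_at \<Omega> (\<lambda>z. u z - ?\<phi> z) x"
    unfolding local_max_at_def eventually_at using in\<Omega> ju subsetD[OF \<Omega>] by (fastforce simp: dist_norm)
  have lmin: "local_min_at \<Omega> (\<lambda>z. v z - ?\<psi> z) y"
    unfolding local_min_at_def eventually_at using in\<Omega> jv subsetD[OF \<Omega>] by (fastforce simp: dist_norm)
  have gA: "\<gamma> *\<^sub>R mat 1 \<preceq> ?A" using convex(2) C2_on_quadratic[OF S(1)] lmax by blast
  have Mu: "MA_op \<sigma> K (u x) ?\<phi> x \<le> - \<gamma>\<^sub>1"
    using sub xy(1) C2_on_quadratic[OF S(1)] lmax unfolding strict_subsolution_def by blast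
  \<comment> \<open>The block inequality at \<open>\<sigma> x *v z\<close> and
    \<open>\<sigma> y *v z\<close> contributes \<open>3 * L\<^sup>2\<close> and the difference of
    the drifts against the common slope contributes \<open>L\<close>, both times \<bar>x - y\<bar>^2
    / \<epsilon>. The slope errors give \<open>2 * L * r\<close>, the matrix shifts
    \<open>2 * L\<^sup>2 * r\<close>.\<close>
  have AB: "z \<bullet> (?A *v z) - \<delta> * (norm z)\<^sup>2 \<le> z \<bullet> (?B *v z)" for z
  proof -
    let ?s = "\<sigma> x *v z" and ?t = "\<sigma> y *v z" and ?p = "(x - y) /\<^sub>R \<epsilon>"
    let ?b = "field_drift \<sigma> x z" and ?c = "field_drift \<sigma> y z"
    define D where "D = norm (x - y)"
    define Z where "Z = norm z"
    have A: "z \<bullet> (?A *v z) = ?s \<bullet> (X *v ?s) + r * (norm ?s)\<^sup>2 + q1 \<bullet> ?b"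
      unfolding D2X_quadratic[OF S(1) diff[OF in\<Omega>(1)]] by (simp add: add_scaled_id_mult inner_add_right power2_norm_eq_inner)
    have Bq: "z \<bullet> (?B *v z) = ?t \<bullet> (Y *v ?t) - r * (norm ?t)\<^sup>2 + q2 \<bullet> ?c"
      unfolding D2X_quadratic[OF S(2) diff[OF in\<Omega>(2)]] by (simp add: add_scaled_id_mult inner_diff_right power2_norm_eq_inner)
    have 1: "?s \<bullet> (X *v ?s) - ?t \<bullet> (Y *v ?t) \<le> 3 * L\<^sup>2 * (D\<^sup>2 / \<epsilon>) * Z\<^sup>2"
    proof -
      have "(norm (?s - ?t))\<^sup>2 \<le> (L * D * Z)\<^sup>2" using L(4)[of z] by (intro power_mono) (auto simp: D_def Z_def)
      then have "3 / \<epsilon> * (norm (?s - ?t))\<^sup>2 \<le> 3 / \<epsilon> * (L * D * Z)\<^sup>2" using eps by (intro mult_left_mono) auto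
      then show ?thesis using up[of ?s ?t] by (simp add: power_mult_distrib)
    qed
    have 2: "(norm ?s)\<^sup>2 \<le> L\<^sup>2 * Z\<^sup>2" "(norm ?t)\<^sup>2 \<le> L\<^sup>2 * Z\<^sup>2"
      using power_mono[OF L(2)[of z], of 2] power_mono[OF L(3)[of z], of 2] by (auto simp: power_mult_distrib Z_def)
    have 3: "r * (norm ?s)\<^sup>2 + r * (norm ?t)\<^sup>2 \<le> 2 * L\<^sup>2 * r * Z\<^sup>2"
    proof -
      have "r * (norm ?s)\<^sup>2 \<le> r * (L\<^sup>2 * Z\<^sup>2)" "r * (norm ?t)\<^sup>2 \<le> r * (L\<^sup>2 * Z\<^sup>2)"
        using 2 r by (auto intro!: mult_left_mono)
      moreover have "2 * L\<^sup>2 * r * Z\<^sup>2 = r * (L\<^sup>2 * Z\<^sup>2) + r * (L\<^sup>2 * Z\<^sup>2)" by simp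
      ultimately show ?thesis by linarith
    qed
    have 4: "(q1 - ?p) \<bullet> ?b \<le> r * (L * Z\<^sup>2)"
    proof -
      have "(q1 - ?p) \<bullet> ?b \<le> norm (q1 - ?p) * norm ?b" by (rule norm_cauchy_schwarz)
      also have "\<dots> \<le> r * (L * Z\<^sup>2)" using q(1) L(5)[of z] r by (intro mult_mono) (auto simp: Z_def)
      finally show ?thesis .
    qed
    have 5: "- ((q2 - ?p) \<bullet> ?c) \<le> r * (L * Z\<^sup>2)"
    proof -
      have "- ((q2 - ?p) \<bullet> ?c) \<le> norm (q2 - ?p) * norm ?c" using Cauchy_Schwarz_ineq2[of "q2 - ?p" ?c] by linarith
      also have "\<dots> \<le> r * (L * Z\<^sup>2)" using q(2) L(6)[of z] r by (intro mult_mono) (auto simp: Z_def)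
      finally show ?thesis .
    qed
    have 6: "?p \<bullet> (?b - ?c) \<le> L * (D\<^sup>2 / \<epsilon>) * Z\<^sup>2"
    proof -
      have "?p \<bullet> (?b - ?c) \<le> norm ?p * norm (?b - ?c)" by (rule norm_cauchy_schwarz)
      also have "\<dots> \<le> (D / \<epsilon>) * (L * D * Z\<^sup>2)"
        using L(7)[of z] eps by (intro mult_mono) (auto simp: D_def Z_def divide_inverse mult.commute)
      finally show ?thesis by (simp add: power2_eq_square mult_ac)
    qed
    have 7: "q1 \<bullet> ?b - q2 \<bullet> ?c = (q1 - ?p) \<bullet> ?b + - ((q2 - ?p) \<bullet> ?c) + ?p \<bullet> (?b - ?c)"
      by (simp add: inner_diff_left inner_diff_right)
    have "\<delta> * Z\<^sup>2 = 3 * L\<^sup>2 * (D\<^sup>2 / \<epsilon>) * Z\<^sup>2 + L * (D\<^sup>2 / \<epsilon>) * Z\<^sup>2 + (r * (L * Z\<^sup>2) + r * (L * Z\<^sup>2)) + 2 * L\<^sup>2 * r * Z\<^sup>2"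
      unfolding \<delta>(1) D_def[symmetric] by (simp add: algebra_simps)
    then show ?thesis unfolding A Bq Z_def[symmetric] using 1 3 4 5 6 7 by linarith
  qed
  have \<delta>0: "0 \<le> \<delta>" unfolding \<delta>(1) using L(1) r eps by (intro add_nonneg_nonneg mult_nonneg_nonneg) auto
  note pert = ln_det_perturbation[OF D2X_in_Sym D2X_in_Sym convex(1) gA AB \<delta>0 \<delta>(2)]
  \<comment> \<open>Testing the supersolution is allowed only now that the matrix at
    \<open>y\<close> is known to be positive definite.\<close>
  have "MA_op \<sigma> K (v y) ?\<psi> y \<ge> 0"
    using super C2_on_quadratic[OF S(2)] lmin pert(1) unfolding supersolution_def by blast
  then have Kv: "ln (det ?B) \<le> K y (v y) q2 (Y - r *\<^sub>R mat 1)"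
    by (simp add: MA_op_def grad_quadratic[OF S(2)] hess_quadratic[OF S(2)])
  have Ku: "\<gamma>\<^sub>1 + K x (u x) q1 (X + r *\<^sub>R mat 1) \<le> ln (det ?A)"
    using Mu by (simp add: MA_op_def grad_quadratic[OF S(1)] hess_quadratic[OF S(1)])
  \<comment> \<open>The structure condition compares equal zero order arguments, so
    \<open>u x\<close> is first lowered to \<open>v y\<close>.\<close>
  have "K x (v y) q1 (X + r *\<^sub>R mat 1) \<le> K x (u x) q1 (X + r *\<^sub>R mat 1)" by (rule Kmono[OF in\<Omega>(1) S(1) uv])
  moreover have "K x (v y) ((x - y) /\<^sub>R \<epsilon>) X - \<eta> \<le> K x (v y) q1 (X + r *\<^sub>R mat 1)"
    "K y (v y) q2 (Y - r *\<^sub>R mat 1) \<le> K y (v y) ((x - y) /\<^sub>R \<epsilon>) Y + \<eta>"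
    using pc vb unfolding penalized_contact_def by blast+
  moreover have "K y (v y) ((x - y) /\<^sub>R \<epsilon>) Y - K x (v y) ((x - y) /\<^sub>R \<epsilon>) X \<le> \<omega> (norm (x - y) * (1 + norm (x - y) / \<epsilon>))"
    by (rule K\<omega>[OF eps _ _ XY]) (use pc in \<open>auto simp: penalized_contact_def\<close>)
  ultimately show ?thesis using pert(2) Kv Ku by linarith
qed

section \<open>Passage to the limit in the penalization\<close>

lemma usc_on_subset: "usc_on S f \<Longrightarrow> T \<subseteq> S \<Longrightarrow> usc_on T f"
  unfolding usc_on_def using filter_leD[OF at_le[of T S]] by (meson subsetD)

lemma usc_on_eventually_less:
  assumes "usc_on S f" "x \<in> S" "f x < a" "X \<longlonglongrightarrow> x" "\<And>n. X n \<in> S"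
  shows "\<forall>\<^sub>F n in sequentially. f (X n) < a"
proof -
  obtain T where T: "open T" "x \<in> T" "\<forall>y\<in>T \<inter> S. f y < a" using assms(1-3) unfolding usc_on_iff_open by blast
  have "\<forall>\<^sub>F n in sequentially. X n \<in> T" using topological_tendstoD[OF assms(4) T(1,2)] .
  then show ?thesis
  proof eventually_elim
    case (elim n)
    then show ?case using T(3) assms(5)[of n] by simp
  qed
qed

text \<open>Boundedness first forces \<bar>x - y\<bar>^2 to be of order \<epsilon>, so both
  sequences have the same limit. By semicontinuity \<open>u (x n) - v (y n)\<close> is
  asymptotically at most \<open>u z - v z\<close>, hence at most \<open>M\<close>, and
  \<open>near\<close> then leaves nothing for the penalty.\<close>

lemma penalization_limit:
  fixes u v :: "real^'n \<Rightarrow> real"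
  assumes C: "compact C" and u: "usc_on C u" and v: "lsc_on C v"
    and bd: "\<And>x. x \<in> C \<Longrightarrow> \<bar>u x\<bar> \<le> b" "\<And>x. x \<in> C \<Longrightarrow> \<bar>v x\<bar> \<le> b"
    and M: "\<And>x. x \<in> C \<Longrightarrow> u x - v x \<le> M"
    and xy: "\<And>n. x n \<in> C" "\<And>n. y n \<in> C"
    and near: "\<And>n. M - inverse (Suc n) \<le> u (x n) - v (y n) - (norm (x n - y n))\<^sup>2 / (2 * inverse (Suc n))"
  obtains z f where "z \<in> C" "strict_mono f" "(x \<circ> f) \<longlonglongrightarrow> z" "(y \<circ> f) \<longlonglongrightarrow> z"
    "(\<lambda>n. (norm (x (f n) - y (f n)))\<^sup>2 / inverse (Suc (f n))) \<longlonglongrightarrow> 0" "M \<le> u z - v z"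
proof -
  obtain z f where z: "z \<in> C" and f: "strict_mono f" and xz: "(x \<circ> f) \<longlonglongrightarrow> z"
    using C xy(1) unfolding compact_def by metis
  define X where "X = x \<circ> f"
  define Y where "Y = y \<circ> f"
  define e where "e n = inverse (real (Suc (f n)))" for n
  have e: "e n > 0" "e n \<le> 1" for n by (auto simp: e_def inverse_le_1_iff)
  have e0: "e \<longlonglongrightarrow> 0"
    using LIMSEQ_subseq_LIMSEQ[OF LIMSEQ_inverse_real_of_nat f] by (simp add: e_def[abs_def] o_def)
  have near': "(norm (X n - Y n))\<^sup>2 / (2 * e n) \<le> u (X n) - v (Y n) - M + e n" for n
    using near[of "f n"] by (simp add: X_def Y_def e_def)
  have XY: "X n \<in> C" "Y n \<in> C" for n using xy by (auto simp: X_def Y_def)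
  \<comment> \<open>Twice an upper bound for the right-hand side of \<open>near'\<close>.\<close>
  define c where "c = 2 * (2 * b + \<bar>M\<bar> + 1)"
  have "(norm (X n - Y n))\<^sup>2 \<le> c * e n" for n
  proof -
    have "(norm (X n - Y n))\<^sup>2 / (2 * e n) \<le> c / 2"
    proof -
      have "u (X n) \<le> b" "- v (Y n) \<le> b" "- M \<le> \<bar>M\<bar>" using bd(1)[OF XY(1), of n] bd(2)[OF XY(2), of n] by auto
      moreover have "c / 2 = 2 * b + \<bar>M\<bar> + 1" by (simp add: c_def)
      ultimately show ?thesis using near'[of n] e(2)[of n] by linarith
    qed
    then show ?thesis using e(1)[of n] by (simp add: pos_divide_le_eq)
  qed
  moreover have "(\<lambda>n. c * e n) \<longlonglongrightarrow> 0" using tendsto_mult_right_zero[OF e0] .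
  ultimately have "(\<lambda>n. (norm (X n - Y n))\<^sup>2) \<longlonglongrightarrow> 0"
    by (intro Lim_null_comparison[of "\<lambda>n. (norm (X n - Y n))\<^sup>2" "\<lambda>n. c * e n"]) auto
  then have "(\<lambda>n. sqrt ((norm (X n - Y n))\<^sup>2)) \<longlonglongrightarrow> sqrt 0" by (rule tendsto_real_sqrt)
  then have "(\<lambda>n. X n - Y n) \<longlonglongrightarrow> 0" by (simp add: tendsto_norm_zero_iff)
  then have "(\<lambda>n. X n - (X n - Y n)) \<longlonglongrightarrow> z - 0" using xz unfolding X_def by (intro tendsto_diff)
  then have Yz: "Y \<longlonglongrightarrow> z" by simp
  have Xz: "X \<longlonglongrightarrow> z" using xz by (simp add: X_def)
  have small: "\<forall>\<^sub>F n in sequentially. u (X n) - v (Y n) < u z - v z + d" if "d > 0" for d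
  proof -
    have "\<forall>\<^sub>F n in sequentially. u (X n) < u z + d / 2"
      using that by (intro usc_on_eventually_less[OF u z _ Xz XY(1)]) auto
    moreover have "\<forall>\<^sub>F n in sequentially. - v (Y n) < - v z + d / 2"
      using that v by (intro usc_on_eventually_less[OF _ z _ Yz XY(2), of "\<lambda>x. - v x"]) (auto simp: usc_on_uminus_iff)
    ultimately show ?thesis by eventually_elim simp
  qed
  have Mz: "M \<le> u z - v z"
  proof (rule field_le_epsilon)
    fix d :: real assume d: "d > 0"
    have "\<forall>\<^sub>F n in sequentially. e n < d / 2" using order_tendstoD(2)[OF e0, of "d / 2"] d by simp
    moreover have "\<forall>\<^sub>F n in sequentially. u (X n) - v (Y n) < u z - v z + d / 2" using small[of "d / 2"] d by simp
    ultimately have "\<forall>\<^sub>F n in sequentially. M \<le> u z - v z + d"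
    proof eventually_elim
      case (elim n)
      have "0 \<le> (norm (X n - Y n))\<^sup>2 / (2 * e n)" using e(1)[of n] by simp
      then show ?case using near'[of n] elim by linarith
    qed
    then show "M \<le> u z - v z + d" by simp
  qed
  have "(\<lambda>n. (norm (X n - Y n))\<^sup>2 / e n) \<longlonglongrightarrow> 0"
  proof (rule tendstoI)
    fix d :: real assume d: "d > 0"
    have 1: "\<forall>\<^sub>F n in sequentially. e n < d / 4" using order_tendstoD(2)[OF e0, of "d / 4"] d by simp
    have 2: "\<forall>\<^sub>F n in sequentially. u (X n) - v (Y n) < u z - v z + d / 4" using small[of "d / 4"] d by simp
    show "\<forall>\<^sub>F n in sequentially. dist ((norm (X n - Y n))\<^sup>2 / e n) 0 < d"
      using 1 2
    proof eventually_elim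
      case (elim n)
      have "(norm (X n - Y n))\<^sup>2 / (2 * e n) < d / 2" using near'[of n] elim M[OF z] by linarith
      moreover have "(norm (X n - Y n))\<^sup>2 / (2 * e n) = ((norm (X n - Y n))\<^sup>2 / e n) / 2" by simp
      moreover have "0 \<le> (norm (X n - Y n))\<^sup>2 / e n" using e(1)[of n] by simp
      ultimately show ?case by (simp add: dist_real_def)
    qed
  qed
  then show thesis using that[OF z f xz] Yz Mz by (simp add: X_def Y_def e_def o_def)
qed

text \<open>The limit of the penalized contact points again attains the maximal value. If that value
  is missed on the frontier, the limit is interior, and a small ball around it serves as the
  compactly contained domain where the subsolution is strict.\<close>

lemma no_interior_positive_max:
  fixes \<Omega> :: "(real^'n) set"
    and \<sigma> :: "real^'n \<Rightarrow> real^'m^'n"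
    and K :: "real^'n \<Rightarrow> real \<Rightarrow> real^'n \<Rightarrow> real^'n^'n \<Rightarrow> real"
    and u v :: "real^'n \<Rightarrow> real"
  assumes \<Omega>: "open \<Omega>" "bounded \<Omega>" "\<Omega> \<noteq> {}"
    and \<sigma>: "\<And>i j. C11_closure \<Omega> (\<lambda>x. \<sigma> x $ i $ j)"
    and K: "structure_conditions \<Omega> K"
    and bu: "bounded (u ` closure \<Omega>)"
    and conv: "uniformly_X_convex \<Omega> \<sigma> u"
    and sub: "\<And>\<Omega>\<^sub>1. open \<Omega>\<^sub>1 \<Longrightarrow> closure \<Omega>\<^sub>1 \<subseteq> \<Omega>
           \<Longrightarrow> \<exists>\<gamma>\<^sub>1>0. strict_subsolution \<Omega> \<sigma> K \<Omega>\<^sub>1 \<gamma>\<^sub>1 u"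
    and bv: "bounded (v ` closure \<Omega>)"
    and lsc: "lsc_on (closure \<Omega>) v"
    and super: "supersolution \<Omega> \<sigma> K v"
    and x0: "x0 \<in> closure \<Omega>" "\<And>x. x \<in> closure \<Omega> \<Longrightarrow> u x - v x \<le> u x0 - v x0"
    and pos: "u x0 - v x0 > 0"
  shows "\<exists>z\<in>frontier \<Omega>. u x0 - v x0 \<le> u z - v z"
proof (rule ccontr)
  assume "\<not> ?thesis"
  then have bdry: "\<And>z. z \<in> frontier \<Omega> \<Longrightarrow> u z - v z < u x0 - v x0" by force
  define C where "C = closure \<Omega>"
  define M where "M = u x0 - v x0"
  have C: "compact C" "C \<noteq> {}" using \<Omega> by (auto simp: C_def compact_closure)
  have sub\<Omega>: "\<Omega> \<subseteq> C" by (simp add: C_def closure_subset)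
  have usc: "usc_on C u" using conv by (simp add: uniformly_X_convex_def C_def)
  have lsc': "lsc_on C v" using lsc by (simp add: C_def)
  obtain \<gamma> where \<gamma>: "\<gamma> > 0" "\<And>\<phi> x. C2_on \<Omega> \<phi> \<and> local_max_at \<Omega> (\<lambda>y. u y - \<phi> y) x \<Longrightarrow> \<gamma> *\<^sub>R mat 1 \<preceq> D2X \<sigma> \<phi> x"
    using conv unfolding uniformly_X_convex_def by blast
  obtain b where b: "\<And>x. x \<in> C \<Longrightarrow> \<bar>u x\<bar> \<le> b" "\<And>x. x \<in> C \<Longrightarrow> \<bar>v x\<bar> \<le> b"
  proof -
    obtain b1 where b1: "\<And>x. x \<in> C \<Longrightarrow> \<bar>u x\<bar> \<le> b1" using bu unfolding bounded_iff C_def by auto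
    obtain b2 where b2: "\<And>x. x \<in> C \<Longrightarrow> \<bar>v x\<bar> \<le> b2" using bv unfolding bounded_iff C_def by auto
    show thesis by (rule that[of "max b1 b2"]) (use b1 b2 in \<open>auto intro: max.coboundedI1 max.coboundedI2\<close>)
  qed
  have Kcont: "continuous_on (C \<times> UNIV \<times> UNIV \<times> Sym) (\<lambda>(x, r, p, X). K x r p X)"
    using K by (simp add: structure_conditions_def C_def)
  have Kmono: "\<And>x r s p X. x \<in> \<Omega> \<Longrightarrow> X \<in> Sym \<Longrightarrow> r \<le> s \<Longrightarrow> K x r p X \<le> K x s p X"
    using K sub\<Omega> unfolding structure_conditions_def C_def by blast
  obtain \<omega> where \<omega>: "modulus \<omega>" and K\<omega>: "\<And>\<epsilon> x y r X Y. \<epsilon> > 0 \<Longrightarrow> x \<in> C \<Longrightarrow> y \<in> C \<Longrightarrow> X \<in> Sym \<Longrightarrow> Y \<in> Sym \<Longrightarrow>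
      - (3 / \<epsilon>) *\<^sub>R block (mat 1) 0 0 (mat 1) \<preceq> block X 0 0 (- Y) \<Longrightarrow>
      block X 0 0 (- Y) \<preceq> (3 / \<epsilon>) *\<^sub>R block (mat 1) (- mat 1) (- mat 1) (mat 1) \<Longrightarrow>
      K y r ((x - y) /\<^sub>R \<epsilon>) Y - K x r ((x - y) /\<^sub>R \<epsilon>) X \<le> \<omega> (norm (x - y) * (1 + norm (x - y) / \<epsilon>))"
  proof -
    obtain \<omega> where w: "modulus \<omega>" "\<forall>\<epsilon>>0. \<forall>x\<in>closure \<Omega>. \<forall>y\<in>closure \<Omega>. \<forall>r. \<forall>X\<in>Sym. \<forall>Y\<in>Sym.
          - (3 / \<epsilon>) *\<^sub>R block (mat 1) 0 0 (mat 1) \<preceq> block X 0 0 (- Y) \<and>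
          block X 0 0 (- Y) \<preceq> (3 / \<epsilon>) *\<^sub>R block (mat 1) (- mat 1) (- mat 1) (mat 1)
          \<longrightarrow> K y r ((x - y) /\<^sub>R \<epsilon>) Y - K x r ((x - y) /\<^sub>R \<epsilon>) X
              \<le> \<omega> (norm (x - y) * (1 + norm (x - y) / \<epsilon>))"
      using K unfolding structure_conditions_def by blast
    show thesis by (rule that[OF w(1)]) (use w(2) in \<open>simp add: C_def\<close>)
  qed
  define E where "E n = inverse (real (Suc n))" for n
  have E: "E n > 0" for n by (simp add: E_def)
  \<comment> \<open>One sequence serves both as penalization parameter and as tolerance.\<close>
  have "\<forall>n. \<exists>x y q1 q2 X Y r. penalized_contact C u v K b (E n) (E n) x y q1 q2 X Y r"
    using penalized_contact_exists[OF C usc lsc' Kcont E E] by blast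
  then obtain x y q1 q2 X Y r where pc: "\<And>n. penalized_contact C u v K b (E n) (E n) (x n) (y n) (q1 n) (q2 n) (X n) (Y n) (r n)"
    by metis
  have xyC: "x n \<in> C" "y n \<in> C" and rn: "0 < r n" "r n \<le> E n" for n
    using pc[of n] unfolding penalized_contact_def by blast+
  \<comment> \<open>Almost maximality is tested at \<open>a = b = x0\<close>, where the penalty
    vanishes.\<close>
  have near: "M - E n \<le> u (x n) - v (y n) - (norm (x n - y n))\<^sup>2 / (2 * E n)" for n
  proof -
    have "u x0 - v x0 - (norm (x0 - x0))\<^sup>2 / (2 * E n) \<le> u (x n) - v (y n) - (norm (x n - y n))\<^sup>2 / (2 * E n) + r n"
      using pc[of n] x0(1) unfolding penalized_contact_def C_def by blast
    then show ?thesis using rn(2)[of n] by (simp add: M_def)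
  qed
  obtain z f where z: "z \<in> C" "strict_mono f" "(x \<circ> f) \<longlonglongrightarrow> z" "(y \<circ> f) \<longlonglongrightarrow> z"
    and t0: "(\<lambda>n. (norm (x (f n) - y (f n)))\<^sup>2 / E (f n)) \<longlonglongrightarrow> 0" and Mz: "M \<le> u z - v z"
    using penalization_limit[OF C(1) usc lsc' b, of M x y] x0(2) xyC near unfolding M_def C_def E_def by blast
  have "z \<in> \<Omega>"
  proof (rule ccontr)
    assume "z \<notin> \<Omega>"
    then have "z \<in> frontier \<Omega>" using z(1) \<Omega>(1) by (simp add: frontier_def C_def interior_open)
    then show False using bdry Mz by (force simp: M_def)
  qed
  then obtain \<rho> where \<rho>: "\<rho> > 0" "cball z \<rho> \<subseteq> \<Omega>" using \<Omega>(1) open_contains_cball by blast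
  define B where "B = ball z \<rho>"
  have B: "B \<subseteq> cball z \<rho>" "B \<subseteq> \<Omega>" using \<rho> by (auto simp: B_def)
  have "closure B \<subseteq> \<Omega>" using \<rho> by (simp add: B_def)
  then obtain \<gamma>\<^sub>1 where g1: "\<gamma>\<^sub>1 > 0" "strict_subsolution \<Omega> \<sigma> K B \<gamma>\<^sub>1 u" using sub[of B] by (auto simp: B_def)
  obtain L where "field_bound \<sigma> (cball z \<rho>) L" using field_bound_exists[OF \<sigma> \<rho>(2)] \<rho>(1) by fastforce
  then have fb: "field_bound \<sigma> B L" using subsetD[OF B(1)] unfolding field_bound_def by blast
  \<comment> \<open>\<open>t n\<close> is twice the penalty, and \<open>a n\<close> is the argument
    of \<open>\<omega>\<close> multiplied out.\<close>
  define t where "t n = (norm (x (f n) - y (f n)))\<^sup>2 / E (f n)" for n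
  define a where "a n = norm (x (f n) - y (f n)) + t n" for n
  define \<delta> where "\<delta> n = (3 * L\<^sup>2 + L) * t n + (2 * L + 2 * L\<^sup>2) * r (f n)" for n
  define rhs where "rhs n = - (real CARD('m) * ln (1 - \<delta> n / \<gamma>)) + (\<omega> (a n) + 2 * E (f n))" for n
  have tt: "t \<longlonglongrightarrow> 0" using t0 by (simp add: t_def[abs_def])
  have Ef: "(\<lambda>n. E (f n)) \<longlonglongrightarrow> 0"
    using LIMSEQ_subseq_LIMSEQ[OF LIMSEQ_inverse_real_of_nat z(2)] by (simp add: E_def o_def)
  have rf: "(\<lambda>n. r (f n)) \<longlonglongrightarrow> 0"
    by (rule Lim_null_comparison[OF _ Ef]) (use rn less_imp_le in \<open>simp add: abs_of_pos\<close>)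
  have "\<delta> \<longlonglongrightarrow> (3 * L\<^sup>2 + L) * 0 + (2 * L + 2 * L\<^sup>2) * 0"
    unfolding \<delta>_def[abs_def] by (intro tendsto_intros tt rf)
  then have \<delta>0: "\<delta> \<longlonglongrightarrow> 0" by simp
  have "(\<lambda>n. (x \<circ> f) n - (y \<circ> f) n) \<longlonglongrightarrow> z - z" using z(3,4) by (rule tendsto_diff)
  then have "(\<lambda>n. norm (x (f n) - y (f n))) \<longlonglongrightarrow> norm (0 :: real^'n)" by (intro tendsto_norm) simp
  then have a0: "a \<longlonglongrightarrow> 0" unfolding a_def[abs_def] using tendsto_add[OF _ tt] by fastforce
  have apos: "a n \<ge> 0" for n using E[of "f n"] by (simp add: a_def t_def)
  have "(\<lambda>n. \<omega> (a n)) \<longlonglongrightarrow> \<omega> 0"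
    using \<omega> a0 apos unfolding modulus_def by (intro continuous_on_tendsto_compose[of "{0..}" \<omega>]) auto
  then have \<omega>0: "(\<lambda>n. \<omega> (a n)) \<longlonglongrightarrow> 0" using \<omega> by (simp add: modulus_def)
  have "rhs \<longlonglongrightarrow> - (real CARD('m) * ln (1 - 0 / \<gamma>)) + (0 + 2 * 0)"
    unfolding rhs_def[abs_def] using \<gamma>(1) by (intro tendsto_intros \<delta>0 \<omega>0 Ef) auto
  then have rhs0: "rhs \<longlonglongrightarrow> 0" by simp
  have "\<forall>\<^sub>F n in sequentially. \<gamma>\<^sub>1 \<le> rhs n"
  proof -
    have 1: "\<forall>\<^sub>F n in sequentially. \<delta> n < \<gamma>" using order_tendstoD(2)[OF \<delta>0 \<gamma>(1)] .
    have 2: "\<forall>\<^sub>F n in sequentially. x (f n) \<in> B" "\<forall>\<^sub>F n in sequentially. y (f n) \<in> B"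
      using topological_tendstoD[OF z(3), of B] topological_tendstoD[OF z(4), of B] \<rho>(1) by (auto simp: B_def)
    \<comment> \<open>Positivity of the maximum enters here: once the tolerance is below
      \<open>M\<close>, the value of \<open>v\<close> at its contact point is at most that of
      \<open>u\<close> at its own.\<close>
    have 3: "\<forall>\<^sub>F n in sequentially. E (f n) < M" using order_tendstoD(2)[OF Ef] pos by (simp add: M_def)
    show ?thesis using 1 2 3
    proof eventually_elim
      case (elim n)
      let ?n = "f n"
      have "0 \<le> (norm (x ?n - y ?n))\<^sup>2 / (2 * E ?n)" using E[of ?n] by simp
      then have uv: "v (y ?n) \<le> u (x ?n)" using near[of ?n] elim(4) by linarith
      have diff: "\<And>i j x. x \<in> \<Omega> \<Longrightarrow> (\<lambda>y. \<sigma> y $ i $ j) differentiable at x"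
        using \<sigma> unfolding C11_closure_def by blast
      have "\<gamma>\<^sub>1 \<le> - (real CARD('m) * ln (1 - \<delta> n / \<gamma>)) + (\<omega> (norm (x ?n - y ?n) * (1 + norm (x ?n - y ?n) / E ?n)) + 2 * E ?n)"
        by (rule contradiction_estimate[OF B(2) sub\<Omega> diff \<gamma> g1(2) super Kmono K\<omega> fb elim(2,3) E pc uv b(2)[OF xyC(2)]])
          (use elim(1) in \<open>simp_all add: \<delta>_def t_def\<close>)
      moreover have "norm (x ?n - y ?n) * (1 + norm (x ?n - y ?n) / E ?n) = a n"
        by (simp add: a_def t_def power2_eq_square distrib_left)
      ultimately show ?case unfolding rhs_def by (simp only:)
    qed
  qed
  then have "\<gamma>\<^sub>1 \<le> 0" using rhs0 by (intro tendsto_lowerbound[OF rhs0]) auto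
  then show False using g1(1) by simp
qed

theorem theorem1p1:
  fixes \<Omega> :: "(real^'n) set"
    and \<sigma> :: "real^'n \<Rightarrow> real^'m^'n"
    and K :: "real^'n \<Rightarrow> real \<Rightarrow> real^'n \<Rightarrow> real^'n^'n \<Rightarrow> real"
    and u v :: "real^'n \<Rightarrow> real"
  assumes "open \<Omega>" and "bounded \<Omega>" and "\<Omega> \<noteq> {}"
    and "\<And>i j. C11_closure \<Omega> (\<lambda>x. \<sigma> x $ i $ j)"
    and "structure_conditions \<Omega> K"
    and "bounded (u ` closure \<Omega>)"
    and "uniformly_X_convex \<Omega> \<sigma> u"
    and "\<And>\<Omega>\<^sub>1. open \<Omega>\<^sub>1 \<Longrightarrow> closure \<Omega>\<^sub>1 \<subseteq> \<Omega>
           \<Longrightarrow> \<exists>\<gamma>\<^sub>1>0. strict_subsolution \<Omega> \<sigma> K \<Omega>\<^sub>1 \<gamma>\<^sub>1 u"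
    and "bounded (v ` closure \<Omega>)"
    and "lsc_on (closure \<Omega>) v"
    and "supersolution \<Omega> \<sigma> K v"
  shows "\<exists>z\<in>frontier \<Omega>.
           (\<forall>y\<in>frontier \<Omega>. max (u y - v y) 0 \<le> max (u z - v z) 0) \<and>
           (SUP x\<in>\<Omega>. u x - v x) \<le> max (u z - v z) 0"
proof -
  let ?C = "closure \<Omega>"
  have C: "compact ?C" using assms(2) by (simp add: compact_closure)
  have usc: "usc_on ?C (\<lambda>x. u x - v x)"
    using usc_on_add[of ?C u "\<lambda>x. - v x"] assms(7,10) by (simp add: uniformly_X_convex_def usc_on_uminus_iff)
  have "frontier \<Omega> \<noteq> {}"
    using assms(2,3) frontier_eq_empty not_bounded_UNIV by blast
  moreover have "compact (frontier \<Omega>)" using assms(2) by (rule compact_frontier_bounded)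
  moreover have "usc_on (frontier \<Omega>) (\<lambda>x. u x - v x)"
    using usc by (rule usc_on_subset) (simp add: frontier_def)
  ultimately obtain z where z: "z \<in> frontier \<Omega>" "\<And>y. y \<in> frontier \<Omega> \<Longrightarrow> u y - v y \<le> u z - v z"
    using usc_on_attains_max[of "frontier \<Omega>" "\<lambda>x. u x - v x"] by blast
  have "?C \<noteq> {}" using assms(3) by simp
  then obtain x0 where x0: "x0 \<in> ?C" "\<And>x. x \<in> ?C \<Longrightarrow> u x - v x \<le> u x0 - v x0"
    using usc_on_attains_max[OF C _ usc] by blast
  \<comment> \<open>A maximum that is not positive is covered by the 0 in
    \<open>max\<close>.\<close>
  have "u x0 - v x0 \<le> max (u z - v z) 0"
  proof (cases "u x0 - v x0 > 0")
    case True
    then obtain z' where "z' \<in> frontier \<Omega>" "u x0 - v x0 \<le> u z' - v z'"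
      using no_interior_positive_max[OF assms x0] by blast
    then show ?thesis using z(2)[of z'] by linarith
  qed simp
  then have "(SUP x\<in>\<Omega>. u x - v x) \<le> max (u z - v z) 0"
    using assms(3) x0(2) closure_subset[of \<Omega>] by (intro cSUP_least) (auto intro: order_trans)
  moreover have "\<forall>y\<in>frontier \<Omega>. max (u y - v y) 0 \<le> max (u z - v z) 0"
    by (intro ballI max.mono z(2) order_refl)
  ultimately show ?thesis using z(1) by blast
qed

end
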